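(* Let $f\colon\mathbb{R}^d\to\mathbb{R}$ be $L$-Lipschitz, let $\delta\in(0,1)$ and $\epsilon>0$, and let $\gamma$ denote the failure probability. Fix an initial point $x_0\in\mathbb{R}^d$, and define $\Delta=f(x_0)-\inf_x f(x)$. Set the number of iterations $T=\frac{4\Delta}{\delta\epsilon}$. Then, with probability $1-\gamma$, the point $x_T=\mathtt{INGD}(x_0,T)$ satisfies $\mathrm{dist}(0,\partial_{\delta}f(x_T))\leq \epsilon$ in a total of at most $$\left\lceil\frac{4\Delta}{\delta\epsilon} \right\rceil \cdot \left\lceil \frac{64L^2 }{\epsilon^2}\right\rceil \cdot \left\lceil 2\log\left(\frac{4\Delta}{\gamma\delta\epsilon}\right)\right\rceil$$ function-value and gradient evaluations.
   Context: Notation. $\|\cdot\|_2$ is the Euclidean norm on $\mathbb{R}^d$, $\mathbb{B}_r(x)$ is the open Euclidean ball of radius $r$ around $x$, and $\hat g:=g/\|g\|_2$ for any nonzero vector $g$. The set $\mathrm{dom}(\nabla f)$ of points where $f$ is differentiable has full Lebesgue measure (Rademacher's theorem). For $a,b\in\mathbb{R}^d$, $[a,b]$ denotes the line segment joining them. The Clarke subdifferential of $f$ at $x$ is $\partial f(x)=\mathrm{conv}\{\lim_{i\to\infty}\nabla f(x_i): x_i\to x,\ x_i\in\mathrm{dom}(\nabla f)\}$. The Goldstein subdifferential of $f$ at $x$ is $\partial_\delta f(x)=\mathrm{conv}\big(\bigcup_{y\in\mathbb{B}_\delta(x)}\partial f(y)\big)$, and $\mathrm{dist}(0,S)=\inf_{s\in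 S}\|s\|_2$. Randomized procedure $\mathtt{MinNorm}(x)$ (with parameters $\delta>0$ and $\epsilon>0$). Let $k=0$ and $g_0=\nabla f(\zeta_0)$, where $\zeta_0$ is sampled uniformly from $\mathbb{B}_\delta(x)$. While $\|g_k\|_2>\epsilon$ and $\frac{\delta}{4}\|g_k\|_2\ge f(x)-f(x-\delta\hat g_k)$, do the following: choose any $r$ satisfying $0<r<\|g_k\|_2\cdot\sqrt{1-\big(1-\frac{\|g_k\|_2^2}{128L^2}\big)^2}$; sample $\zeta_k$ uniformly from $\mathbb{B}_r(g_k)$; choose $y_k$ uniformly at random from the segment $[x,x-\delta\hat\zeta_k]$; set $g_{k+1}=\mathrm{argmin}_{z\in[g_k,\nabla f(y_k)]}\|z\|_2$; set $k=k+1$. When the loop ends, return $g_k$. Procedure $\mathtt{INGD}(x_0,T)$ (Interpolated Normalized Gradient Descent). For $t=0,\dots,T-1$: compute $g=\mathtt{MinNorm}(x_t)$ and set $x_{t+1}=x_t-\delta\hat g$. Return $x_T$. The oracle model is that function values and gradients of $f$ can be evaluated at points of differentiability of $f$ (almost every point of $\mathbb{R}^d$).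
   Formalization: INGD is modified to stop and return x_t as soon as MinNorm returns g with ‖g‖ ≤ ε (as written it would step away, and the claim can fail; ĝ is also undefined for g = 0); f is assumed bounded below, 0<γ<1, and for non-integer T the loop runs ⌊T⌋ times. *)

theory Defs
  imports "HOL-Probability.Probability"
begin

text \<open>Only meaningful where \<open>f\<close> is differentiable; an arbitrary fixed vector elsewhere.\<close>

definition grad :: "('a::euclidean_space \<Rightarrow> real) \<Rightarrow> 'a \<Rightarrow> 'a" where
  "grad f x = (THE D. GDERIV f x :> D)"

definition clarke_subdiff :: "('a::euclidean_space \<Rightarrow> real) \<Rightarrow> 'a \<Rightarrow> 'a set" where
  "clarke_subdiff f x = convex hull
     {v. \<exists>X. X \<longlonglongrightarrow> x \<and> (\<forall>i::nat. f differentiable (at (X i))) \<and> (\<lambda>i. grad f (X i)) \<longlonglongrightarrow> v}"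

definition goldstein_subdiff :: "('a::euclidean_space \<Rightarrow> real) \<Rightarrow> real \<Rightarrow> 'a \<Rightarrow> 'a set" where
  "goldstein_subdiff f \<delta> x = convex hull (\<Union>y\<in>ball x \<delta>. clarke_subdiff f y)"

definition uniform_ball :: "'a::euclidean_space \<Rightarrow> real \<Rightarrow> 'a measure" where
  "uniform_ball x r = uniform_measure lborel (ball x r)"

definition uniform_segment :: "'a::euclidean_space \<Rightarrow> 'a \<Rightarrow> 'a measure" where
  "uniform_segment a b =
     distr (uniform_measure lborel {0..1::real}) borel (\<lambda>s. (1 - s) *\<^sub>R a + s *\<^sub>R b)"

text \<open>
  The finite sequence of all points sampled so far: its length, and the points themselves
  (the values beyond the length are irrelevant). Functions \<open>nat \<Rightarrow> 'a\<close> are used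
  instead of lists because they carry the Borel structure of the product topology.
\<close>

type_synonym 'a history = "nat \<times> (nat \<Rightarrow> 'a)"

definition empty_history :: "'a::zero history" where
  "empty_history = (0, \<lambda>_. 0)"

definition snoc :: "'a history \<Rightarrow> 'a \<Rightarrow> 'a history" where
  "snoc h v = (Suc (fst h), (snd h)(fst h := v))"

text \<open>
  The radius is a free choice within an interval that depends on the current vector \<open>g\<close>. A rule
  for making this choice may use everything that has been sampled so far; only measurability is
  required, so that the iterates are random variables. Along a run, \<open>norm g \<le> L\<close> holds almost
  surely; for larger \<open>g\<close> the interval can be empty.
\<close>

definition radius_rule :: "real \<Rightarrow> real \<Rightarrow> ('a::euclidean_space history \<Rightarrow> 'a \<Rightarrow> real) \<Rightarrow> bool" where
  "radius_rule L \<epsilon> r \<longleftrightarrow>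
     (\<lambda>(h, g). r h g) \<in> borel_measurable borel \<and>
     (\<forall>h g. \<epsilon> < norm g \<and> norm g \<le> L \<longrightarrow>
        0 < r h g \<and> r h g < norm g * sqrt (1 - (1 - (norm g)\<^sup>2 / (128 * L\<^sup>2))\<^sup>2))"

context
  fixes f :: "'a::euclidean_space \<Rightarrow> real"
    and \<delta> \<epsilon> :: real
    and r :: "'a history \<Rightarrow> 'a \<Rightarrow> real"
begin

text \<open>The unit vector in direction \<open>g\<close> is \<open>sgn g\<close>.\<close>

definition loop_guard :: "'a \<Rightarrow> 'a \<Rightarrow> bool" where
  "loop_guard x g \<longleftrightarrow> norm g > \<epsilon> \<and> \<delta> / 4 * norm g \<ge> f x - f (x - \<delta> *\<^sub>R sgn g)"

text \<open>
  Function values needed by the \<open>k\<close>-th test of the guard: none if its first conjunct already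
  fails; otherwise \<open>f (x - \<delta> *\<^sub>R sgn g)\<close>, and also \<open>f x\<close> the first time, which is then remembered.
\<close>

definition guard_evals :: "nat \<Rightarrow> 'a \<Rightarrow> nat" where
  "guard_evals k g = (if norm g > \<epsilon> then (if k = 0 then 2 else 1) else 0)"

text \<open>
  The randomized procedures are programs in the Giry monad over sub-probability measures. The
  argument \<open>i\<close> bounds the number of tests of the guard in each call of the while loop: a run that
  would need more contributes no mass. The number \<open>n\<close> counts all function-value and gradient
  evaluations so far.
\<close>

primrec minnorm_loop ::
  "nat \<Rightarrow> nat \<Rightarrow> 'a \<Rightarrow> 'a \<Rightarrow> nat \<Rightarrow> 'a history \<Rightarrow> ('a \<times> nat \<times> 'a history) measure" where
  "minnorm_loop 0 k x g n h = null_measure borel"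
| "minnorm_loop (Suc i) k x g n h =
     (let n' = n + guard_evals k g in
      if loop_guard x g then
        do {
          \<zeta> \<leftarrow> uniform_ball g (r h g);
          y \<leftarrow> uniform_segment x (x - \<delta> *\<^sub>R sgn \<zeta>);
          minnorm_loop i (Suc k) x
            (ARG_MIN norm z. z \<in> closed_segment g (grad f y)) (n' + 1) (snoc (snoc h \<zeta>) y)
        }
      else return borel (g, n', h))"

definition minnorm ::
  "nat \<Rightarrow> 'a \<Rightarrow> nat \<Rightarrow> 'a history \<Rightarrow> ('a \<times> nat \<times> 'a history) measure" where
  "minnorm i x n h =
     do {
       \<zeta> \<leftarrow> uniform_ball x \<delta>;
       minnorm_loop i 0 x (grad f \<zeta>) (n + 1) (snoc h \<zeta>)
     }"

text \<open>
  A vector \<open>g\<close> with \<open>norm g \<le> \<epsilon>\<close> returned by \<open>minnorm\<close> certifies that the current point \<open>x\<close> is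
  approximately stationary, and the method stops there with output \<open>x\<close>. Moving on regardless can
  lead from such a point to one that is not approximately stationary. The first argument after
  \<open>i\<close> is the number of iterations that remain.
\<close>

primrec ingd :: "nat \<Rightarrow> nat \<Rightarrow> 'a \<Rightarrow> nat \<Rightarrow> 'a history \<Rightarrow> ('a \<times> nat) measure" where
  "ingd i 0 x n h = return borel (x, n)"
| "ingd i (Suc t) x n h =
     do {
       (g, n', h') \<leftarrow> minnorm i x n h;
       if norm g \<le> \<epsilon> then return borel (x, n')
       else ingd i t (x - \<delta> *\<^sub>R sgn g) n' h'
     }"

text \<open>
  The probability that \<open>ingd\<close>, with unbounded while loops, terminates with an output and a number
  of evaluations in \<open>E\<close>: the limit of the increasing probabilities for the bounded loops.
\<close>

definition ingd_prob :: "nat \<Rightarrow> 'a \<Rightarrow> ('a \<times> nat) set \<Rightarrow> ennreal" where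
  "ingd_prob T x\<^sub>0 E = (SUP i. emeasure (ingd i T x\<^sub>0 0 empty_history) E)"

end

end

theory Submission
  imports Defs
begin

text \<open>
  A wrong output is impossible (up to probability zero); the only thing that can go wrong is that
  the while loops run for too long.

  Outputs. All vectors \<open>g\<close> in a call of \<open>minnorm\<close> at \<open>x\<close> are convex combinations of gradients at
  points of the ball of radius \<open>\<delta>\<close> around \<open>x\<close>, hence elements of the Goldstein subdifferential. If a
  call returns \<open>g\<close> with \<open>norm g \<le> \<epsilon>\<close>, this element shows that \<open>x\<close> is approximately stationary.
  Otherwise the failed guard says that the step along \<open>- g\<close> lowers \<open>f\<close> by more than \<open>\<delta> * \<epsilon> / 4\<close>.
  Since \<open>f\<close> can only drop by \<open>\<Delta>\<close>, after \<open>\<lfloor>T\<rfloor>\<close> such steps the value of \<open>f\<close> exceeds its infimum by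
  less than \<open>\<delta> * \<epsilon> / 4\<close>, and this alone forces approximate stationarity: if all elements of the
  Goldstein subdifferential were longer than \<open>\<epsilon>\<close>, a step of length \<open>\<delta>\<close> against the shortest one
  would lower \<open>f\<close> by at least \<open>\<delta> * \<epsilon> / 2\<close> (\<open>approx_stationary_if_near_optimal\<close>).

  Running time. By the fundamental theorem of calculus, the mean of \<open>grad f y \<bullet> sgn \<zeta>\<close> over the
  segment from \<open>x\<close> to \<open>x - \<delta> *\<^sub>R sgn \<zeta>\<close> is the difference quotient of \<open>f\<close> along the segment, which is
  small as long as the guard holds. The radius is so small that \<open>\<zeta>\<close> can be replaced by \<open>g\<close> up to
  an error of \<open>norm g / 8\<close> on each side, and the mean of \<open>grad f y \<bullet> g\<close> is at most half of the square
  \<open>a\<close> of \<open>norm g\<close> (\<open>expected_inner_grad_le\<close>). Moving from \<open>g\<close> towards \<open>grad f y\<close> by the fraction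
  \<open>a / (2 * L\<^sup>2)\<close> then gives a vector whose expected squared norm is at most \<open>a - a\<^sup>2 / (4 * L\<^sup>2)\<close>, and
  the shortest vector of the segment is at least as good. The potential \<open>exp (- (\<epsilon>\<^sup>2 / a))\<close>, cut off to
  \<open>0\<close> when \<open>norm g \<le> \<epsilon>\<close>, lies below its tangent at the current value of \<open>a\<close>; hence its expectation
  shrinks by the factor \<open>1 - \<epsilon>\<^sup>2 / (4 * L\<^sup>2)\<close> in each pass, and more than \<open>i\<close> passes happen with
  probability at most \<open>exp 1 * (1 - \<epsilon>\<^sup>2 / (4 * L\<^sup>2)) ^ i\<close> (\<open>loop_mass_ge\<close>). A pass costs two
  evaluations. An equal share of the total budget pays for enough passes to make this probability at
  most \<open>\<gamma> / T\<close>, and a union bound over the iterations finishes the proof.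

  All of this takes gradients at random points, so it rests on Rademacher's theorem: a Lipschitz
  function is differentiable almost everywhere. The proof reduces to lines by Fubini's theorem; on a
  line, Vitali's covering theorem shows that the difference quotients of a monotone function cannot
  oscillate on a set of positive measure.
\<close>

section \<open>Lipschitz functions of one real variable\<close>

text \<open>Vitali's covering theorem for intervals that need not be centred at the covered point. The
end points of countably many intervals form a null set, so the open intervals still cover.\<close>

lemma vitali_cover_by_intervals:
  fixes E :: "real set"
  assumes "open U" "E \<subseteq> U"
    and fine: "\<And>x d. x \<in> E \<Longrightarrow> 0 < d \<Longrightarrow> \<exists>a b. a < b \<and> x \<in> {a..b} \<and> b - a < d \<and> P a b"
  obtains C where "countable C" "\<And>a b. (a, b) \<in> C \<Longrightarrow> a < b \<and> {a..b} \<subseteq> U \<and> P a b"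
    "disjoint_family_on (\<lambda>(a, b). {a..b}) C" "negligible (E - (\<Union>(a, b)\<in>C. {a<..<b}))"
proof -
  define K where "K = {(a, b). a < b \<and> {a..b} \<subseteq> U \<and> P a b}"
  define m where "m = (\<lambda>(a::real, b). (a + b) / 2)"
  define \<rho> where "\<rho> = (\<lambda>(a::real, b). (b - a) / 2)"
  have cb: "cball (m i) (\<rho> i) = {fst i..snd i}" for i
    by (cases i) (auto simp: m_def \<rho>_def cball_eq_atLeastAtMost field_simps)
  have covers: "\<exists>i. i \<in> K \<and> x \<in> cball (m i) (\<rho> i) \<and> \<rho> i < d" if x: "x \<in> E" and d: "0 < d" for x d
  proof -
    obtain e where e: "0 < e" "ball x e \<subseteq> U"
      using openE[OF \<open>open U\<close>, of x] \<open>E \<subseteq> U\<close> x by blast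
    obtain a b where ab: "a < b" "x \<in> {a..b}" "b - a < min d e" "P a b"
      using fine[OF x, of "min d e"] e d by auto
    have "{a..b} \<subseteq> ball x e" using ab by (auto simp: dist_real_def abs_less_iff)
    with e ab have "(a, b) \<in> K" by (auto simp: K_def)
    moreover have "\<rho> (a, b) < d" using ab by (auto simp: \<rho>_def)
    ultimately show ?thesis using ab(2) by (intro exI[of _ "(a, b)"]) (auto simp: cb)
  qed
  have pos: "0 < \<rho> i" if "i \<in> K" for i using that by (auto simp: K_def \<rho>_def)
  obtain C where C: "countable C" "C \<subseteq> K"
     "pairwise (\<lambda>i j. disjnt (cball (m i) (\<rho> i)) (cball (m j) (\<rho> j))) C"
     "negligible (E - (\<Union>i \<in> C. cball (m i) (\<rho> i)))"
    using Vitali_covering_theorem_cballs[of K \<rho> E m, OF pos covers] by blast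
  show thesis
  proof
    show "countable C" by fact
    show "a < b \<and> {a..b} \<subseteq> U \<and> P a b" if "(a, b) \<in> C" for a b
      using C(2) that by (auto simp: K_def)
    show "disjoint_family_on (\<lambda>(a, b). {a..b}) C"
      using C(3) unfolding pairwise_def disjoint_family_on_def disjnt_def cb case_prod_beta by blast
    have "fst ` C \<union> snd ` C \<in> null_sets lborel"
      using C(1) by (intro countable_imp_null_set_lborel) auto
    then have "fst ` C \<union> snd ` C \<in> null_sets lebesgue" by (rule null_sets_completionI)
    with C(4) have "negligible ((E - (\<Union>i \<in> C. cball (m i) (\<rho> i))) \<union> (fst ` C \<union> snd ` C))"
      unfolding negligible_iff_null_sets by (rule null_sets.Un)
    then show "negligible (E - (\<Union>(a, b)\<in>C. {a<..<b}))"
    proof (rule negligible_subset)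
      show "E - (\<Union>(a, b)\<in>C. {a<..<b}) \<subseteq> (E - (\<Union>i \<in> C. cball (m i) (\<rho> i))) \<union> (fst ` C \<union> snd ` C)"
        unfolding cb by (force simp: less_le image_iff)
    qed
  qed
qed

lemma emeasure_lborel_eq_0_if_negligible:
  assumes "negligible S" "S \<in> sets borel"
  shows "emeasure lborel S = 0"
  using assms null_sets_completion_iff[of S lborel] by (auto simp: negligible_iff_null_sets null_setsD1)

lemma emeasure_UN_le_UN:
  assumes "countable C" "disjoint_family_on X C" "\<And>i. i \<in> C \<Longrightarrow> X i \<in> sets M" "sets N = sets M"
    and "\<And>i. i \<in> C \<Longrightarrow> emeasure M (X i) \<le> emeasure N (X i)"
  shows "emeasure M (\<Union>i\<in>C. X i) \<le> emeasure N (\<Union>i\<in>C. X i)"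
  using assms by (simp add: emeasure_UN_countable) (auto intro!: nn_integral_mono)

text \<open>A measure that is at least \<open>q\<close> times Lebesgue measure on arbitrarily short intervals at each
point of \<open>E\<close> is so on a disjoint family of them that exhausts \<open>E\<close> and stays inside \<open>U\<close>.\<close>

lemma measure_ge_of_fine_cover:
  fixes \<mu> :: "real measure"
  assumes [simp]: "sets \<mu> = sets borel" and "open U" "E \<subseteq> U" and [measurable]: "E \<in> sets borel"
    and fine: "\<And>x d. x \<in> E \<Longrightarrow> 0 < d \<Longrightarrow> \<exists>a b. a < b \<and> x \<in> {a..b} \<and> b - a < d \<and>
      q * emeasure lborel {a..b} \<le> emeasure \<mu> {a..b}"
  shows "q * emeasure lborel E \<le> emeasure \<mu> U"
proof -
  obtain C where C: "countable C"
    "\<And>a b. (a, b) \<in> C \<Longrightarrow> a < b \<and> {a..b} \<subseteq> U \<and> q * emeasure lborel {a..b} \<le> emeasure \<mu> {a..b}"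
    "disjoint_family_on (\<lambda>(a, b). {a..b}) C" "negligible (E - (\<Union>(a, b)\<in>C. {a<..<b}))"
    using vitali_cover_by_intervals[OF assms(2,3), where P = "\<lambda>a b. q * emeasure lborel {a..b} \<le> emeasure \<mu> {a..b}", OF fine] by blast
  let ?J = "\<Union>(a, b)\<in>C. {a..b}" and ?I = "\<Union>(a, b)\<in>C. {a<..<b}"
  have J[measurable]: "?J \<in> sets borel" and I[measurable]: "?I \<in> sets borel"
    using C(1) by (auto intro!: sets.countable_UN')
  have IJ: "?I \<subseteq> ?J" by (intro UN_mono) auto
  have JU: "?J \<subseteq> U" using C(2) by blast
  have "emeasure lborel (E - ?I) = 0"
    using C(4) by (intro emeasure_lborel_eq_0_if_negligible) auto
  have "emeasure lborel E \<le> emeasure lborel (?I \<union> (E - ?I))" by (intro emeasure_mono) auto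
  also have "\<dots> \<le> emeasure lborel ?I + emeasure lborel (E - ?I)" by (intro emeasure_subadditive) auto
  also have "\<dots> = emeasure lborel ?I" using \<open>emeasure lborel (E - ?I) = 0\<close> by simp
  also have "\<dots> \<le> emeasure lborel ?J" by (rule emeasure_mono[OF IJ]) (use J in simp)
  finally have "q * emeasure lborel E \<le> q * emeasure lborel ?J" by (rule mult_left_mono) simp
  also have "\<dots> = emeasure (density lborel (\<lambda>_. q)) ?J" by (simp add: emeasure_density_const)
  also have "\<dots> \<le> emeasure \<mu> ?J"
    by (intro emeasure_UN_le_UN C(1,3)) (simp_all add: emeasure_density_const split: prod.splits, use C(2) in blast)
  also have "\<dots> \<le> emeasure \<mu> U" by (rule emeasure_mono[OF JU]) (use \<open>open U\<close> in simp)
  finally show ?thesis .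
qed

text \<open>The counterpart from above. The union of the chosen open intervals serves as the set on which
\<open>measure_ge_of_fine_cover\<close> is applied afterwards.\<close>

lemma open_with_small_measure_of_fine_cover:
  fixes \<mu> :: "real measure"
  assumes [simp]: "sets \<mu> = sets borel" and "open U" "E \<subseteq> U" and [measurable]: "E \<in> sets borel"
    and fine: "\<And>x d. x \<in> E \<Longrightarrow> 0 < d \<Longrightarrow> \<exists>a b. a < b \<and> x \<in> {a..b} \<and> b - a < d \<and>
      emeasure \<mu> {a..b} \<le> p * emeasure lborel {a..b}"
  obtains V where "open V" "emeasure lborel (E - V) = 0" "emeasure \<mu> V \<le> p * emeasure lborel U"
proof -
  obtain C where C: "countable C"
    "\<And>a b. (a, b) \<in> C \<Longrightarrow> a < b \<and> {a..b} \<subseteq> U \<and> emeasure \<mu> {a..b} \<le> p * emeasure lborel {a..b}"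
    "disjoint_family_on (\<lambda>(a, b). {a..b}) C" "negligible (E - (\<Union>(a, b)\<in>C. {a<..<b}))"
    using vitali_cover_by_intervals[OF assms(2,3), where P = "\<lambda>a b. emeasure \<mu> {a..b} \<le> p * emeasure lborel {a..b}", OF fine] by blast
  let ?J = "\<Union>(a, b)\<in>C. {a..b}" and ?I = "\<Union>(a, b)\<in>C. {a<..<b}"
  have J[measurable]: "?J \<in> sets borel" and I[measurable]: "?I \<in> sets borel"
    using C(1) by (auto intro!: sets.countable_UN')
  have IJ: "?I \<subseteq> ?J" by (intro UN_mono) auto
  have JU: "?J \<subseteq> U" using C(2) by blast
  show thesis
  proof (rule that[of ?I])
    show "open ?I" by (intro open_UN ballI) (auto split: prod.splits)
    show "emeasure lborel (E - ?I) = 0"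
      using C(4) by (intro emeasure_lborel_eq_0_if_negligible) auto
    have "emeasure \<mu> ?I \<le> emeasure \<mu> ?J" by (rule emeasure_mono[OF IJ]) (use J in simp)
    also have "\<dots> \<le> emeasure (density lborel (\<lambda>_. p)) ?J"
      by (intro emeasure_UN_le_UN C(1,3)) (simp_all add: emeasure_density_const split: prod.splits, use C(2) in blast)
    also have "\<dots> \<le> emeasure (density lborel (\<lambda>_. p)) U"
      by (rule emeasure_mono[OF JU]) (use \<open>open U\<close> in simp)
    finally show "emeasure \<mu> ?I \<le> p * emeasure lborel U"
      using \<open>open U\<close> by (simp add: emeasure_density_const)
  qed
qed

text \<open>Since \<open>F\<close> is continuous, the points with a small difference quotient for some step below \<open>d\<close> form
an open set, and it suffices to let \<open>d\<close> run through the numbers \<open>inverse (Suc n)\<close>.\<close>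

lemma oscillation_set_borel:
  fixes F :: "real \<Rightarrow> real"
  assumes F: "continuous_on UNIV F"
  shows "{x. \<bar>x\<bar> < R \<and>
      (\<forall>d>0. \<exists>h. h \<noteq> 0 \<and> \<bar>h\<bar> < d \<and> (F (x + h) - F x) / h < p) \<and>
      (\<forall>d>0. \<exists>h. h \<noteq> 0 \<and> \<bar>h\<bar> < d \<and> q < (F (x + h) - F x) / h)} \<in> sets borel" (is "?E \<in> _")
proof -
  have cF: "continuous_on A (\<lambda>x. (F (x + h) - F x) / h)" if "h \<noteq> 0" for h A
    using that by (intro continuous_intros continuous_on_compose2[OF F]) auto
  define A where "A d = (\<Union>h\<in>{h. h \<noteq> 0 \<and> \<bar>h\<bar> < d}. {x. (F (x + h) - F x) / h < p})" for d
  define B where "B d = (\<Union>h\<in>{h. h \<noteq> 0 \<and> \<bar>h\<bar> < d}. {x. q < (F (x + h) - F x) / h})" for d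
  have oA: "open {x. (F (x + h) - F x) / h < p}" and oB: "open {x. q < (F (x + h) - F x) / h}"
    if "h \<noteq> 0" for h
    using open_Collect_less[OF cF[OF that] continuous_on_const] open_Collect_less[OF continuous_on_const cF[OF that]]
    by blast+
  have A: "open (A d)" and B: "open (B d)" for d
    unfolding A_def B_def using oA oB by blast+
  have "?E = {-R<..<R} \<inter> (\<Inter>n. A (inverse (Suc n))) \<inter> (\<Inter>n. B (inverse (Suc n)))"
    (is "_ = ?E'")
  proof (rule set_eqI)
    fix x
    have A_iff: "x \<in> A d \<longleftrightarrow> (\<exists>h. h \<noteq> 0 \<and> \<bar>h\<bar> < d \<and> (F (x + h) - F x) / h < p)" for d
      unfolding A_def by blast
    have B_iff: "x \<in> B d \<longleftrightarrow> (\<exists>h. h \<noteq> 0 \<and> \<bar>h\<bar> < d \<and> q < (F (x + h) - F x) / h)" for d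
      unfolding B_def by blast
    have mono: "x \<in> A d \<Longrightarrow> d \<le> d' \<Longrightarrow> x \<in> A d'" "x \<in> B d \<Longrightarrow> d \<le> d' \<Longrightarrow> x \<in> B d'" for d d'
      unfolding A_iff B_iff by (meson less_le_trans)+
    have seq: "(\<forall>d>0. x \<in> X d) \<longleftrightarrow> (\<forall>n. x \<in> X (inverse (real (Suc n))))"
      if X: "\<And>d d'. x \<in> X d \<Longrightarrow> d \<le> d' \<Longrightarrow> x \<in> X d'" for X
    proof safe
      fix d :: real assume n: "\<forall>n. x \<in> X (inverse (real (Suc n)))" and "0 < d"
      obtain n where "inverse (real (Suc n)) < d" using reals_Archimedean[OF \<open>0 < d\<close>] by blast
      then show "x \<in> X d" using X[of "inverse (real (Suc n))" d] n by simp
    qed simp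
    have "(\<forall>d>0. x \<in> A d) \<longleftrightarrow> (\<forall>n. x \<in> A (inverse (real (Suc n))))"
      "(\<forall>d>0. x \<in> B d) \<longleftrightarrow> (\<forall>n. x \<in> B (inverse (real (Suc n))))"
      by (rule seq; rule mono; assumption)+
    then
have "x \<in> ?E \<longleftrightarrow> \<bar>x\<bar> < R \<and> (\<forall>n. x \<in> A (inverse (real (Suc n)))) \<and> (\<forall>n. x \<in> B (inverse (real (Suc n))))"
      unfolding A_iff B_iff mem_Collect_eq by argo
    also have "\<dots> \<longleftrightarrow> x \<in> ?E'" by auto
    finally show "x \<in> ?E \<longleftrightarrow> x \<in> ?E'" .
  qed
  moreover have "?E' \<in> sets borel"
  proof -
    have [measurable]: "A d \<in> sets borel" "B d \<in> sets borel" for d by (simp_all add: A B)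
    show ?thesis by measurable
  qed
  ultimately show ?thesis by simp
qed

text \<open>Cover the set \<open>E\<close> of oscillation first by intervals on which \<open>F\<close> grows by at most \<open>p\<close> times their
length, inside an open set that is barely larger than \<open>E\<close>, and then, inside this cover, by intervals
on which \<open>F\<close> grows by at least \<open>q\<close> times their length. Growth is additive on disjoint intervals,
because it is the measure \<open>interval_measure F\<close>; so \<open>q\<close> times the measure of \<open>E\<close> is at most \<open>p\<close> times it.\<close>

lemma mono_oscillation_null:
  fixes F :: "real \<Rightarrow> real"
  assumes F: "mono F" "continuous_on UNIV F" and "0 \<le> p" "p < q"
  shows "emeasure lborel {x. \<bar>x\<bar> < R \<and>
      (\<forall>d>0. \<exists>h. h \<noteq> 0 \<and> \<bar>h\<bar> < d \<and> (F (x + h) - F x) / h < p) \<and>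
      (\<forall>d>0. \<exists>h. h \<noteq> 0 \<and> \<bar>h\<bar> < d \<and> q < (F (x + h) - F x) / h)} = 0" (is "emeasure lborel ?E = 0")
proof -
  define E where "E = ?E"
  have E[measurable]: "E \<in> sets borel" unfolding E_def by (rule oscillation_set_borel[OF F(2)])
  have EA: "\<forall>d>0. \<exists>h. h \<noteq> 0 \<and> \<bar>h\<bar> < d \<and> (F (x + h) - F x) / h < p"
    and EB: "\<forall>d>0. \<exists>h. h \<noteq> 0 \<and> \<bar>h\<bar> < d \<and> q < (F (x + h) - F x) / h"
    and ER: "x \<in> {-R..R}" if "x \<in> E" for x
    using that unfolding E_def mem_Collect_eq by (blast, blast, auto)
  define \<mu> where "\<mu> = interval_measure F"
  have [simp]: "sets \<mu> = sets borel" by (simp add: \<mu>_def)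
  have \<mu>: "emeasure \<mu> {a..b} = ennreal (F b - F a)" if "a \<le> b" for a b
    unfolding \<mu>_def using F that
    by (intro emeasure_interval_measure_Icc) (auto simp: mono_def intro: continuous_on_subset)
  have diff_quot: "\<exists>a b. a < b \<and> x \<in> {a..b} \<and> b - a < d \<and> (F (x + h) - F x) / h = (F b - F a) / (b - a)"
    if "h \<noteq> 0" "\<bar>h\<bar> < d" for x h d
  proof (cases "h > 0")
    case True then show ?thesis using that by (intro exI[of _ x] exI[of _ "x + h"]) auto
  next
    case False
    then have "(F (x + h) - F x) / h = (F x - F (x + h)) / (x - (x + h))" using that by (simp add: field_simps)
    with False show ?thesis using that by (intro exI[of _ "x + h"] exI[of _ x]) auto
  qed
  have fineA: "\<exists>a b. a < b \<and> x \<in> {a..b} \<and> b - a < d \<and>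
      emeasure \<mu> {a..b} \<le> ennreal p * emeasure lborel {a..b}" if x: "x \<in> E" and d: "0 < d" for x d
  proof -
    obtain h where "h \<noteq> 0" "\<bar>h\<bar> < d" "(F (x + h) - F x) / h < p" using EA[OF x] d by blast
    then obtain a b where ab: "a < b" "x \<in> {a..b}" "b - a < d" "(F b - F a) / (b - a) < p"
      using diff_quot[of h d x] by auto
    then have "F b - F a \<le> p * (b - a)" by (simp add: field_simps)
    with ab \<open>0 \<le> p\<close> have "emeasure \<mu> {a..b} \<le> ennreal p * emeasure lborel {a..b}"
      by (simp add: \<mu> ennreal_mult[symmetric] ennreal_leI)
    with ab show ?thesis by blast
  qed
  have fineB: "\<exists>a b. a < b \<and> x \<in> {a..b} \<and> b - a < d \<and>
      ennreal q * emeasure lborel {a..b} \<le> emeasure \<mu> {a..b}" if x: "x \<in> E" and d: "0 < d" for x d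
  proof -
    obtain h where h: "h \<noteq> 0" "\<bar>h\<bar> < d" "q < (F (x + h) - F x) / h" using EB[OF x] d by blast
    then obtain a b where ab: "a < b" "x \<in> {a..b}" "b - a < d" "(F b - F a) / (b - a) > q"
      using diff_quot[of h d x] by auto
    then have "F b - F a \<ge> q * (b - a)" by (simp add: field_simps)
    with ab \<open>0 \<le> p\<close> \<open>p < q\<close> have "ennreal q * emeasure lborel {a..b} \<le> emeasure \<mu> {a..b}"
      by (simp add: \<mu> ennreal_mult[symmetric] ennreal_leI)
    with ab show ?thesis by blast
  qed
  have "emeasure lborel E \<le> emeasure lborel {-R..R}" using ER by (intro emeasure_mono) auto
  also have "\<dots> < \<infinity>" by (simp add: emeasure_lborel_Icc_eq)
  finally obtain l where l: "emeasure lborel E = ennreal l" "0 \<le> l"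
    by (cases "emeasure lborel E") auto
  have "q * l \<le> p * (l + e)" if "0 < e" for e
  proof -
    \<comment> \<open>The measure of an open neighbourhood of \<open>E\<close> may exceed that of \<open>E\<close> by an arbitrarily small \<open>e\<close>.\<close>
    obtain O' where O': "open O'" "E \<subseteq> O'" "O' - E \<in> lmeasurable" "emeasure lebesgue (O' - E) < ennreal e"
      using sets_lebesgue_outer_open[OF _ \<open>0 < e\<close>, of E] E by (auto intro: sets_completionI_sets)
    have "emeasure lborel O' = emeasure lborel (E \<union> (O' - E))" using O'(2) by (intro arg_cong2[of _ _ _ _ emeasure]) auto
    also have "\<dots> \<le> emeasure lborel E + emeasure lborel (O' - E)"
      using O'(1) E by (intro emeasure_subadditive) auto
    also have "\<dots> \<le> ennreal (l + e)"
      using O'(1,4) E l \<open>0 < e\<close> by (auto simp: l(1) intro!: add_left_mono)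
    finally have O'le: "emeasure lborel O' \<le> ennreal (l + e)" .
    obtain V where V: "open V" "emeasure lborel (E - V) = 0" "emeasure \<mu> V \<le> ennreal p * emeasure lborel O'"
      using open_with_small_measure_of_fine_cover[of \<mu> O' E "ennreal p"] O' E fineA by auto
    have "emeasure lborel E \<le> emeasure lborel ((E \<inter> V) \<union> (E - V))" using E V(1) by (intro emeasure_mono) auto
    also have "\<dots> \<le> emeasure lborel (E \<inter> V) + emeasure lborel (E - V)"
      using E V(1) by (intro emeasure_subadditive) auto
    finally have "ennreal q * emeasure lborel E \<le> ennreal q * emeasure lborel (E \<inter> V)"
      using V(2) by (intro mult_left_mono) auto
    also have "\<dots> \<le> emeasure \<mu> V"
      using E V(1) fineB by (intro measure_ge_of_fine_cover) auto
    also have "\<dots> \<le> ennreal p * ennreal (l + e)"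
      using V(3) O'le by (meson mult_left_mono order_trans zero_le)
    finally show ?thesis
      using l \<open>0 \<le> p\<close> \<open>p < q\<close> \<open>0 < e\<close> by (simp add: l(1) ennreal_mult[symmetric] ennreal_le_iff del: ennreal_plus)
  qed
  note le = this
  have "l = 0"
  proof (rule ccontr)
    assume "l \<noteq> 0"
    \<comment> \<open>Chosen such that \<open>p * e\<close> is less than \<open>(q - p) * l\<close> if \<open>l\<close> is positive.\<close>
    define e where "e = (q - p) * l / (2 * (p + 1))"
    have "0 < e" using l \<open>l \<noteq> 0\<close> \<open>0 \<le> p\<close> \<open>p < q\<close> by (simp add: e_def)
    have "(q - p) * l \<le> p * e" using le[OF \<open>0 < e\<close>] by (simp add: algebra_simps)
    also have "\<dots> \<le> (p + 1) * e" using \<open>0 < e\<close> by (simp add: algebra_simps)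
    also have "\<dots> = (q - p) * l / 2" using \<open>0 \<le> p\<close> by (simp add: e_def divide_simps)
    finally show False using l \<open>l \<noteq> 0\<close> \<open>p < q\<close> by (simp add: zero_less_mult_iff)
  qed
  then show ?thesis using l unfolding E_def by simp
qed
text \<open>If lower and upper limit differ, there are rational numbers \<open>p < q\<close> between them. Rational
numbers matter because the exceptional null sets are indexed by \<open>p\<close> and \<open>q\<close>.\<close>

lemma bounded_tendsto_if_no_rational_oscillation:
  fixes Q :: "real \<Rightarrow> real"
  assumes bdd: "\<And>h. h \<noteq> 0 \<Longrightarrow> 0 \<le> Q h \<and> Q h \<le> C"
    and osc: "\<And>p q. p \<in> \<rat> \<Longrightarrow> q \<in> \<rat> \<Longrightarrow> 0 \<le> p \<Longrightarrow> p < q \<Longrightarrow>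
      (\<forall>d>0. \<exists>h. h \<noteq> 0 \<and> \<bar>h\<bar> < d \<and> Q h < p) \<Longrightarrow>
      (\<forall>d>0. \<exists>h. h \<noteq> 0 \<and> \<bar>h\<bar> < d \<and> q < Q h) \<Longrightarrow> False"
  shows "\<exists>D. (Q \<longlongrightarrow> D) (at 0)"
proof -
  let ?l = "Liminf (at 0) (\<lambda>h. ereal (Q h))" and ?u = "Limsup (at 0) (\<lambda>h. ereal (Q h))"
  have ev: "\<forall>\<^sub>F h in at 0. 0 \<le> ereal (Q h)" "\<forall>\<^sub>F h in at 0. ereal (Q h) \<le> ereal C"
    using bdd by (auto simp: eventually_at intro!: exI[of _ 1])
  have "0 \<le> ?l" "?u \<le> ereal C" by (rule Liminf_bounded[OF ev(1)], rule Limsup_bounded[OF ev(2)])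
  have lu: "?l \<le> ?u" by (rule Liminf_le_Limsup) simp
  have eq: "?u = ?l"
  proof (rule ccontr)
    assume "?u \<noteq> ?l"
    then have "?l < ?u" using lu by simp
    then obtain a where a: "?l < ereal a" "ereal a < ?u" using ereal_dense2 by blast
    then obtain b where b: "a < b" "ereal b < ?u" using ereal_dense2[of "ereal a" ?u] by auto
    then obtain q where q: "q \<in> \<rat>" "a < q" "q < b" using Rats_dense_in_real by blast
    obtain p where p: "p \<in> \<rat>" "a < p" "p < q" using Rats_dense_in_real[OF q(2)] by blast
    have "0 \<le> ereal a" using \<open>0 \<le> ?l\<close> a(1) by (meson less_imp_le order_trans)
    then have "0 \<le> p" using p by simp
    have *: "\<exists>h. h \<noteq> 0 \<and> \<bar>h\<bar> < d \<and> Q h < p" if "0 < d" for d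
    proof (rule ccontr)
      assume "\<not> ?thesis"
      then have "\<forall>\<^sub>F h in at 0. ereal p \<le> ereal (Q h)"
        using \<open>0 < d\<close> by (auto simp: eventually_at intro!: exI[of _ d])
      from Liminf_bounded[OF this] a p show False by (simp add: not_less[symmetric] less_imp_le order.strict_trans)
    qed
    have **: "\<exists>h. h \<noteq> 0 \<and> \<bar>h\<bar> < d \<and> q < Q h" if "0 < d" for d
    proof (rule ccontr)
      assume "\<not> ?thesis"
      then have "\<forall>\<^sub>F h in at 0. ereal (Q h) \<le> ereal q"
        using \<open>0 < d\<close> by (auto simp: eventually_at intro!: exI[of _ d])
      from Limsup_bounded[OF this] have "?u \<le> ereal q" .
      also have "ereal q < ereal b" using q by simp
      finally show False using b by simp
    qed
    show False using osc[OF p(1) q(1) \<open>0 \<le> p\<close> p(3)] * ** by blast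
  qed
  have "?l \<le> ereal C" using lu \<open>?u \<le> ereal C\<close> by (rule order_trans)
  then obtain D where "?l = ereal D" using \<open>0 \<le> ?l\<close> by (cases ?l) auto
  then have "((\<lambda>h. ereal (Q h)) \<longlongrightarrow> ereal D) (at 0)" using tendsto_Liminf[OF _ eq] by simp
  then show ?thesis by auto
qed

text \<open>Adding \<open>K * x\<close> makes the function monotone without affecting differentiability.\<close>

lemma lipschitz_real_differentiable_AE:
  fixes \<phi> :: "real \<Rightarrow> real"
  assumes lip: "K-lipschitz_on UNIV \<phi>"
  shows "AE t in lborel. \<exists>D. (\<phi> has_real_derivative D) (at t)"
proof -
  define F where "F = (\<lambda>x. \<phi> x + K * x)"
  have K: "\<bar>\<phi> x - \<phi> y\<bar> \<le> K * \<bar>x - y\<bar>" for x y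
    using lipschitz_onD[OF lip, of x y] by (simp add: dist_real_def)
  have F: "mono F" unfolding mono_def F_def
  proof (intro allI impI)
    fix x y :: real assume "x \<le> y"
    with K[of x y] show "\<phi> x + K * x \<le> \<phi> y + K * y" by (simp add: algebra_simps)
  qed
  have cF: "continuous_on UNIV F"
    unfolding F_def by (intro continuous_intros lipschitz_on_continuous_on[OF lip])
  define E where "E p q R = {x. \<bar>x\<bar> < R \<and>
      (\<forall>d>0. \<exists>h. h \<noteq> 0 \<and> \<bar>h\<bar> < d \<and> (F (x + h) - F x) / h < p) \<and>
      (\<forall>d>0. \<exists>h. h \<noteq> 0 \<and> \<bar>h\<bar> < d \<and> q < (F (x + h) - F x) / h)}" for p q R :: real
  have E: "E p q R \<in> null_sets lborel" if "0 \<le> p" "p < q" for p q R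
    unfolding E_def using mono_oscillation_null[OF F cF that] oscillation_set_borel[OF cF]
    by (intro null_setsI) simp_all
  define I where "I = {(p, q) \<in> \<rat> \<times> \<rat>. 0 \<le> p \<and> p < (q::real)}"
  have "countable I" unfolding I_def
    by (rule countable_subset[of _ "\<rat> \<times> \<rat>"]) (auto simp: countable_rat)
  then have "(\<Union>(p, q)\<in>I. \<Union>n. E p q (real n)) \<in> null_sets lborel"
    by (intro null_sets_UN') (auto simp: I_def intro!: null_sets_UN E)
  then have "AE t in lborel. t \<notin> (\<Union>(p, q)\<in>I. \<Union>n. E p q (real n))" by (rule AE_not_in)
  then show ?thesis
  proof (rule AE_mp, intro AE_I2 impI)
    fix t :: real assume t: "t \<notin> (\<Union>(p, q)\<in>I. \<Union>n. E p q (real n))"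
    obtain n where n: "\<bar>t\<bar> < real n" using reals_Archimedean2 by blast
    have "\<exists>D. ((\<lambda>h. (F (t + h) - F t) / h) \<longlongrightarrow> D) (at 0)"
    proof (rule bounded_tendsto_if_no_rational_oscillation)
      fix h :: real assume "h \<noteq> 0"
      then show "0 \<le> (F (t + h) - F t) / h \<and> (F (t + h) - F t) / h \<le> 2 * K"
        using K[of "t + h" t] unfolding F_def by (cases "h > 0") (auto simp: field_simps abs_le_iff)
    next
      fix p q :: real
      assume pq: "p \<in> \<rat>" "q \<in> \<rat>" "0 \<le> p" "p < q"
        and "\<forall>d>0. \<exists>h. h \<noteq> 0 \<and> \<bar>h\<bar> < d \<and> (F (t + h) - F t) / h < p"
          "\<forall>d>0. \<exists>h. h \<noteq> 0 \<and> \<bar>h\<bar> < d \<and> q < (F (t + h) - F t) / h"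
      with n have "t \<in> E p q (real n)" unfolding E_def by blast
      moreover have "(p, q) \<in> I" using pq by (simp add: I_def)
      ultimately show False using t by blast
    qed
    then obtain D where "(F has_real_derivative D) (at t)" unfolding DERIV_def by blast
    then have "((\<lambda>x. F x - K * x) has_real_derivative (D - K)) (at t)"
      by (auto intro!: derivative_eq_intros)
    moreover have "(\<lambda>x. F x - K * x) = \<phi>" by (simp add: F_def)
    ultimately show "\<exists>D. (\<phi> has_real_derivative D) (at t)" by auto
  qed
qed

section \<open>Rademacher's theorem\<close>

text \<open>Turns differentiability into countably many conditions. The exceptional increments in a small
ball form an open set, which is empty as soon as it misses a dense set.\<close>

lemma has_derivative_at_iff_dense:
  fixes f :: "'a::euclidean_space \<Rightarrow> real"
  assumes cont: "continuous_on UNIV f" and dense: "\<And>X. open X \<Longrightarrow> X \<noteq> {} \<Longrightarrow> \<exists>d\<in>D. d \<in> X"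
    and A: "linear A"
  shows "(f has_derivative A) (at x) \<longleftrightarrow>
    (\<forall>k. \<exists>m. \<forall>h\<in>D. norm h < inverse (real (Suc m)) \<longrightarrow>
      \<bar>f (x + h) - f x - A h\<bar> \<le> inverse (real (Suc k)) * norm h)" (is "_ \<longleftrightarrow> ?R")
proof
  assume der: "(f has_derivative A) (at x)"
  show ?R
  proof
    fix k
    have "inverse (real (Suc k)) > 0" by simp
    then obtain d where d: "d > 0"
      "\<And>y. norm (y - x) < d \<Longrightarrow> norm (f y - f x - A (y - x)) \<le> inverse (real (Suc k)) * norm (y - x)"
      using der unfolding has_derivative_at_alt by blast
    obtain m where m: "inverse (real (Suc m)) < d" using reals_Archimedean[OF d(1)] by blast
    have "\<bar>f (x + h) - f x - A h\<bar> \<le> inverse (real (Suc k)) * norm h" if "norm h < inverse (real (Suc m))" for h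
      using d(2)[of "x + h"] that m by simp
    then show "\<exists>m. \<forall>h\<in>D. norm h < inverse (real (Suc m)) \<longrightarrow>
      \<bar>f (x + h) - f x - A h\<bar> \<le> inverse (real (Suc k)) * norm h" by blast
  qed
next
  assume R: ?R
  have bl: "bounded_linear A" using A by (simp add: linear_conv_bounded_linear)
  show "(f has_derivative A) (at x)"
    unfolding has_derivative_at_alt
  proof (intro conjI bl allI impI)
    fix e :: real assume "0 < e"
    obtain k where k: "inverse (real (Suc k)) < e" using reals_Archimedean[OF \<open>0 < e\<close>] by blast
    obtain m where m: "\<And>h. h \<in> D \<Longrightarrow> norm h < inverse (real (Suc m)) \<Longrightarrow>
      \<bar>f (x + h) - f x - A h\<bar> \<le> inverse (real (Suc k)) * norm h" using R by blast
    let ?r = "inverse (real (Suc m))"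
    have cA: "continuous_on UNIV A" using bl by (rule linear_continuous_on)
    have cf: "continuous_on UNIV (\<lambda>h. f (x + h))"
      by (intro continuous_on_compose2[OF cont] continuous_intros) auto
    let ?X = "ball 0 ?r \<inter> {h. inverse (real (Suc k)) * norm h < \<bar>f (x + h) - f x - A h\<bar>}"
    have "open ?X"
      by (intro open_Int open_ball open_Collect_less continuous_intros cA cf)
    moreover have "\<not> (\<exists>d\<in>D. d \<in> ?X)"
    proof
      assume "\<exists>d\<in>D. d \<in> ?X"
      then obtain d where "d \<in> D" "d \<in> ?X" by blast
      then show False using m[of d] by simp
    qed
    ultimately have "?X = {}" using dense by blast
    show "\<exists>d>0. \<forall>y. norm (y - x) < d \<longrightarrow> norm (f y - f x - A (y - x)) \<le> e * norm (y - x)"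
    proof (intro exI[of _ ?r] conjI allI impI)
      fix y assume "norm (y - x) < ?r"
      then have "y - x \<in> ball 0 ?r" by simp
      with \<open>?X = {}\<close> have "\<not> inverse (real (Suc k)) * norm (y - x) < \<bar>f (x + (y - x)) - f x - A (y - x)\<bar>"
        by blast
      then have "\<bar>f y - f x - A (y - x)\<bar> \<le> inverse (real (Suc k)) * norm (y - x)" by simp
      also have "\<dots> \<le> e * norm (y - x)" using k by (intro mult_right_mono) auto
      finally show "norm (f y - f x - A (y - x)) \<le> e * norm (y - x)" by simp
    qed simp
  qed
qed

lemma borel_has_derivative_at:
  fixes f :: "'a::euclidean_space \<Rightarrow> real"
  assumes cont: "continuous_on UNIV f" and [measurable]: "G \<in> borel_measurable borel"
  shows "Measurable.pred borel (\<lambda>x. (f has_derivative (\<lambda>h. G x \<bullet> h)) (at x))"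
proof -
  have [measurable]: "f \<in> borel_measurable borel" using cont by (rule borel_measurable_continuous_onI)
  obtain D :: "'a set" where D: "countable D" "\<And>X. open X \<Longrightarrow> X \<noteq> {} \<Longrightarrow> \<exists>d\<in>D. d \<in> X"
    using countable_dense_exists by blast
  have "linear (\<lambda>h. G x \<bullet> h)" for x
    by (simp add: bounded_linear_inner_right bounded_linear.linear)
  then have iff: "(f has_derivative (\<lambda>h. G x \<bullet> h)) (at x) \<longleftrightarrow>
      (\<forall>k. \<exists>m. \<forall>h\<in>D. norm h < inverse (real (Suc m)) \<longrightarrow>
        \<bar>f (x + h) - f x - G x \<bullet> h\<bar> \<le> inverse (real (Suc k)) * norm h)" for x
    by (intro has_derivative_at_iff_dense cont D(2))
  show ?thesis
    unfolding iff
    by (intro pred_intros_countable measurable_pred_countable(1) D(1)) measurable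
qed

lemma borel_has_directional_derivative:
  fixes f :: "'a::euclidean_space \<Rightarrow> real"
  assumes cont: "continuous_on UNIV f" and [measurable]: "g \<in> borel_measurable borel"
  shows "Measurable.pred borel (\<lambda>x. ((\<lambda>t. f (x + t *\<^sub>R v)) has_real_derivative g x) (at 0))"
proof -
  have [measurable]: "f \<in> borel_measurable borel" using cont by (rule borel_measurable_continuous_onI)
  obtain D :: "real set" where D: "countable D" "\<And>X. open X \<Longrightarrow> X \<noteq> {} \<Longrightarrow> \<exists>d\<in>D. d \<in> X"
    using countable_dense_exists by blast
  have c: "continuous_on UNIV (\<lambda>t. f (x + t *\<^sub>R v))" for x
    by (intro continuous_on_compose2[OF cont] continuous_intros) auto
  have iff: "((\<lambda>t. f (x + t *\<^sub>R v)) has_real_derivative g x) (at 0) \<longleftrightarrow>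
      (\<forall>k. \<exists>m. \<forall>h\<in>D. norm h < inverse (real (Suc m)) \<longrightarrow>
        \<bar>f (x + (0 + h) *\<^sub>R v) - f (x + 0 *\<^sub>R v) - g x * h\<bar> \<le> inverse (real (Suc k)) * norm h)" for x
    unfolding has_field_derivative_def
    by (intro has_derivative_at_iff_dense c D(2) linear_times)
  show ?thesis
    unfolding iff
    by (intro pred_intros_countable measurable_pred_countable(1) D(1)) measurable
qed

text \<open>The limit along the steps \<open>inverse (Suc n)\<close> is a Borel function of \<open>x\<close> in all cases and equals the
directional derivative wherever the latter exists.\<close>

definition dirderiv :: "('a::euclidean_space \<Rightarrow> real) \<Rightarrow> 'a \<Rightarrow> 'a \<Rightarrow> real" where
  "dirderiv f v x = lim (\<lambda>n. real (Suc n) * (f (x + inverse (real (Suc n)) *\<^sub>R v) - f x))"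

abbreviation has_dirderiv :: "('a::euclidean_space \<Rightarrow> real) \<Rightarrow> 'a \<Rightarrow> 'a \<Rightarrow> bool" where
  "has_dirderiv f v x \<equiv> ((\<lambda>t. f (x + t *\<^sub>R v)) has_real_derivative dirderiv f v x) (at 0)"

lemma dirderiv_measurable:
  assumes "continuous_on UNIV f"
  shows "dirderiv f v \<in> borel_measurable borel"
proof -
  have [measurable]: "f \<in> borel_measurable borel" using assms by (rule borel_measurable_continuous_onI)
  show ?thesis unfolding dirderiv_def[abs_def] by (intro borel_measurable_lim_metric) measurable
qed

lemma quotient_tendsto:
  fixes f :: "'a::euclidean_space \<Rightarrow> real"
  assumes "((\<lambda>t. f (x + t *\<^sub>R v)) has_real_derivative D) (at 0)"
  shows "(\<lambda>n. real (Suc n) * (f (x + inverse (real (Suc n)) *\<^sub>R v) - f x)) \<longlonglongrightarrow> D"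
proof -
  have lim0: "filterlim (\<lambda>n. inverse (real (Suc n))) (at 0) sequentially"
    unfolding filterlim_at by (intro conjI LIMSEQ_inverse_real_of_nat) simp
  have "((\<lambda>h. (f (x + (0 + h) *\<^sub>R v) - f (x + 0 *\<^sub>R v)) / h) \<longlongrightarrow> D) (at 0)"
    using assms unfolding DERIV_def .
  from filterlim_compose[OF this lim0] show ?thesis by (simp add: divide_inverse mult.commute)
qed

lemma dirderiv_eqI:
  fixes f :: "'a::euclidean_space \<Rightarrow> real"
  assumes "((\<lambda>t. f (x + t *\<^sub>R v)) has_real_derivative D) (at 0)"
  shows "dirderiv f v x = D"
  unfolding dirderiv_def by (rule limI[OF quotient_tendsto[OF assms]])

lemma AE_lborel_translate:
  fixes P :: "'a::euclidean_space \<Rightarrow> bool"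
  assumes [measurable]: "Measurable.pred borel P" and "AE x in lborel. P (c + x)"
  shows "AE x in lborel. P x"
proof -
  have "AE x in distr lborel borel ((+) c). P x"
    using assms by (subst AE_distr_iff) auto
  then show ?thesis unfolding lborel_distr_plus .
qed

lemma AE_lborel_obtain:
  assumes "AE x in (lborel :: 'a::euclidean_space measure). P x"
  obtains x where "P x"
proof -
  have "\<not> (AE x in (lborel :: 'a measure). False)"
    by (simp add: AE_iff_null null_sets_def)
  then show thesis using assms that by (metis (mono_tags, lifting) AE_mp AE_I2)
qed

lemma lipschitz_line:
  fixes f :: "'a::euclidean_space \<Rightarrow> real"
  assumes lip: "K-lipschitz_on UNIV f"
  shows "(K * norm v)-lipschitz_on UNIV (\<lambda>t. f (x + t *\<^sub>R v))"
proof (rule lipschitz_onI)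
  fix s t :: real
  have "dist (f (x + s *\<^sub>R v)) (f (x + t *\<^sub>R v)) \<le> K * dist (x + s *\<^sub>R v) (x + t *\<^sub>R v)"
    using lip by (rule lipschitz_onD) auto
  also have "dist (x + s *\<^sub>R v) (x + t *\<^sub>R v) = norm v * dist s t"
    by (simp add: dist_norm scaleR_diff_left[symmetric] mult.commute)
  finally show "dist (f (x + s *\<^sub>R v)) (f (x + t *\<^sub>R v)) \<le> K * norm v * dist s t" by (simp add: mult.assoc)
qed (use lipschitz_on_nonneg[OF lip] in simp)

text \<open>On each line in direction \<open>v\<close> the exceptional set is null. By Fubini's theorem, some translate of
the exceptional set in the whole space is therefore null, and hence so is the set itself.\<close>

lemma lipschitz_has_dirderiv_AE:
  fixes f :: "'a::euclidean_space \<Rightarrow> real"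
  assumes lip: "K-lipschitz_on UNIV f"
  shows "AE x in lborel. has_dirderiv f v x"
proof -
  have cont: "continuous_on UNIV f" using lip by (rule lipschitz_on_continuous_on)
  have P[measurable]: "Measurable.pred borel (has_dirderiv f v)"
    using borel_has_directional_derivative[OF cont dirderiv_measurable[OF cont]] .
  have "AE t in lborel. has_dirderiv f v (x + t *\<^sub>R v)" for x
  proof -
    from lipschitz_real_differentiable_AE[OF lipschitz_line[OF lip]] show ?thesis
    proof (rule AE_mp, intro AE_I2 impI)
      fix t assume "\<exists>D. ((\<lambda>t. f (x + t *\<^sub>R v)) has_real_derivative D) (at t)"
      then obtain D where "((\<lambda>t. f (x + t *\<^sub>R v)) has_real_derivative D) (at t)" by blast
      then have "((\<lambda>s. f (x + (s + t) *\<^sub>R v)) has_real_derivative D) (at 0)"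
        using DERIV_at_within_shift[of "\<lambda>t. f (x + t *\<^sub>R v)" D t 0 UNIV] by (simp add: add.commute)
      then have D: "((\<lambda>s. f ((x + t *\<^sub>R v) + s *\<^sub>R v)) has_real_derivative D) (at 0)"
        by (simp add: algebra_simps)
      with dirderiv_eqI[OF D] show "has_dirderiv f v (x + t *\<^sub>R v)" by simp
    qed
  qed
  then have "AE x in (lborel :: 'a measure). AE t in (lborel :: real measure). has_dirderiv f v (x + t *\<^sub>R v)" by simp
  then have "AE t in (lborel :: real measure). AE x in (lborel :: 'a measure). has_dirderiv f v (x + t *\<^sub>R v)"
    by (subst (asm) lborel_pair.AE_commute) measurable
  then obtain t :: real where "AE x in (lborel :: 'a measure). has_dirderiv f v (x + t *\<^sub>R v)"
    by (rule AE_lborel_obtain)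
  then show ?thesis
    by (intro AE_lborel_translate[OF P, of "t *\<^sub>R v"]) (simp add: add.commute)
qed

text \<open>After scaling, \<open>1 + u / B\<close> is a density whose measure agrees with Lebesgue measure on boxes.\<close>

lemma AE_eq_0_if_box_integrals_0:
  fixes u :: "'a::euclidean_space \<Rightarrow> real"
  assumes [measurable]: "u \<in> borel_measurable borel" and "AE x in lborel. \<bar>u x\<bar> \<le> C"
    and box: "\<And>a b. (LINT x|lborel. indicator (box a b) x * u x) = 0"
  shows "AE x in lborel. u x = 0"
proof -
  define B where "B = \<bar>C\<bar> + 1"
  have "B > 0" by (simp add: B_def)
  have le: "AE x in lborel. \<bar>u x\<bar> \<le> B" using assms(2) by eventually_elim (simp add: B_def)
  have int: "integrable lborel (\<lambda>x. indicator (box a b) x * u x)" for a b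
  proof (rule Bochner_Integration.integrable_bound)
    show "integrable lborel (\<lambda>x. B * indicator (box a b) x)" by (simp add: emeasure_lborel_box_eq)
    show "AE x in lborel. norm (indicator (box a b) x * u x) \<le> norm (B * indicator (box a b) x)"
      using le by eventually_elim (auto simp: indicator_def)
  qed simp
  let ?w = "\<lambda>x. ennreal (1 + u x / B)"
  have "lborel = density lborel ?w"
  proof (rule lborel_eqI)
    fix l v :: 'a assume "\<And>b. b \<in> Basis \<Longrightarrow> l \<bullet> b \<le> v \<bullet> b"
    then have vol: "emeasure lborel (box l v) = (\<Prod>b\<in>Basis. (v - l) \<bullet> b)" by simp
    have i1: "integrable lborel (\<lambda>x. indicator (box l v) x :: real)" by (simp add: emeasure_lborel_box_eq)
    have "emeasure (density lborel ?w) (box l v) = (\<integral>\<^sup>+x. ?w x * indicator (box l v) x \<partial>lborel)"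
      by (rule emeasure_density) auto
    also have "\<dots> = (\<integral>\<^sup>+x. ennreal (indicator (box l v) x + (indicator (box l v) x * u x) / B) \<partial>lborel)"
      by (intro nn_integral_cong) (auto simp: indicator_def)
    also have "\<dots> = ennreal (LINT x|lborel. indicator (box l v) x + (indicator (box l v) x * u x) / B)"
    proof (rule nn_integral_eq_integral)
      show "AE x in lborel. 0 \<le> indicat_real (box l v) x + indicat_real (box l v) x * u x / B"
        using le
      proof eventually_elim
        case (elim x)
        then have "- 1 \<le> u x / B" using \<open>B > 0\<close> by (simp add: field_simps abs_le_iff)
        then show ?case by (simp add: indicator_def)
      qed
    qed (intro Bochner_Integration.integrable_add i1 integrable_divide int)
    also have "(LINT x|lborel. indicator (box l v) x + (indicator (box l v) x * u x) / B) =
        measure lborel (box l v)"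
      using i1 int by (simp add: box)
    also have "ennreal (measure lborel (box l v)) = emeasure lborel (box l v)"
      by (intro emeasure_eq_ennreal_measure[symmetric]) (simp add: emeasure_lborel_box_eq)
    finally show "emeasure (density lborel ?w) (box l v) = (\<Prod>b\<in>Basis. (v - l) \<bullet> b)" using vol by simp
  qed simp
  then have "density lborel ?w = density lborel (\<lambda>_. 1)" by (simp add: density_1)
  then have "AE x in lborel. ?w x = 1"
    by (intro sigma_finite_measure.density_unique[OF sigma_finite_lborel]) auto
  with le show ?thesis
  proof eventually_elim
    case (elim x)
    have "0 \<le> 1 + u x / B" using elim(1) \<open>B > 0\<close> by (simp add: field_simps abs_le_iff)
    then have "1 + u x / B = 1" using elim(2) by (simp add: ennreal_eq_1)
    then show ?case using \<open>B > 0\<close> by simp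
  qed
qed

lemma lborel_integral_translate:
  fixes g :: "'a::euclidean_space \<Rightarrow> real"
  assumes [measurable]: "g \<in> borel_measurable borel"
  shows "(LINT x|lborel. g (c + x)) = (LINT x|lborel. g x)"
proof -
  have "(LINT x|distr lborel borel ((+) c). g x) = (LINT x|lborel. g (c + x))"
    by (rule integral_distr) measurable
  then show ?thesis unfolding lborel_distr_plus by simp
qed

lemma indicator_box_translate_tendsto:
  fixes y :: "'a::euclidean_space"
  assumes "y \<notin> frontier (box a b)" and s: "s \<longlonglongrightarrow> 0"
  shows "(\<lambda>n. indicator (box a b) (y - s n) :: real) \<longlonglongrightarrow> indicator (box a b) y"
proof -
  have lim: "(\<lambda>n. y - s n) \<longlonglongrightarrow> y" using tendsto_diff[OF tendsto_const s, of y] by simp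
  show ?thesis
  proof (cases "y \<in> box a b")
    case True
    then have "\<forall>\<^sub>F n in sequentially. y - s n \<in> box a b"
      using topological_tendstoD[OF lim open_box] by blast
    then show ?thesis using True
      by (intro tendsto_eventually) (auto elim: eventually_mono)
  next
    case False
    then have "y \<in> - closure (box a b)" using assms(1) by (simp add: frontier_def interior_open[OF open_box])
    then have "\<forall>\<^sub>F n in sequentially. y - s n \<in> - closure (box a b)"
      using topological_tendstoD[OF lim, of "- closure (box a b)"] by blast
    then show ?thesis using False closure_subset[of "box a b"]
      by (intro tendsto_eventually) (auto elim!: eventually_mono simp: indicator_def)
  qed
qed

definition diff_quot :: "('a::euclidean_space \<Rightarrow> real) \<Rightarrow> nat \<Rightarrow> 'a \<Rightarrow> 'a \<Rightarrow> real" where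
  "diff_quot f n v x = real (Suc n) * (f (x + inverse (real (Suc n)) *\<^sub>R v) - f x)"

text \<open>The gradient, wherever \<open>f\<close> is differentiable.\<close>

definition partials_vec :: "('a::euclidean_space \<Rightarrow> real) \<Rightarrow> 'a \<Rightarrow> 'a" where
  "partials_vec f x = (\<Sum>b\<in>Basis. dirderiv f b x *\<^sub>R b)"

context
  fixes f :: "'a::euclidean_space \<Rightarrow> real" and K :: real
  assumes lip: "K-lipschitz_on UNIV f"
begin

lemma lipschitz_continuous: "continuous_on UNIV f"
  using lip by (rule lipschitz_on_continuous_on)

lemma lipschitz_borel_measurable[measurable]: "f \<in> borel_measurable borel"
  using lipschitz_continuous by (rule borel_measurable_continuous_onI)

lemma dirderiv_borel_measurable[measurable]: "dirderiv f v \<in> borel_measurable borel"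
  using lipschitz_continuous by (rule dirderiv_measurable)

lemma diff_quot_measurable[measurable]: "diff_quot f n v \<in> borel_measurable borel"
  unfolding diff_quot_def[abs_def] by measurable

lemma diff_quot_bound: "\<bar>diff_quot f n v x\<bar> \<le> K * norm v"
proof -
  have "\<bar>f (x + inverse (real (Suc n)) *\<^sub>R v) - f x\<bar> \<le> K * (inverse (real (Suc n)) * norm v)"
    using lipschitz_onD[OF lip, of "x + inverse (real (Suc n)) *\<^sub>R v" x] by (simp add: dist_norm)
  then have "real (Suc n) * \<bar>f (x + inverse (real (Suc n)) *\<^sub>R v) - f x\<bar>
      \<le> real (Suc n) * (K * (inverse (real (Suc n)) * norm v))"
    by (rule mult_left_mono) simp
  also have "\<dots> = K * norm v" by simp
  finally show ?thesis by (simp add: diff_quot_def abs_mult)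
qed

lemma diff_quot_tendsto: "has_dirderiv f v x \<Longrightarrow> (\<lambda>n. diff_quot f n v x) \<longlonglongrightarrow> dirderiv f v x"
  unfolding diff_quot_def by (rule quotient_tendsto)

lemma dirderiv_bound:
  assumes "has_dirderiv f v x"
  shows "\<bar>dirderiv f v x\<bar> \<le> K * norm v"
  using tendsto_rabs[OF diff_quot_tendsto[OF assms]]
  by (rule Lim_bounded[where M = 0]) (use diff_quot_bound in blast)

lemma has_dirderiv_AE: "AE x in lborel. has_dirderiv f v x"
  by (rule lipschitz_has_dirderiv_AE[OF lip])

lemma integrable_box_dirderiv: "integrable lborel (\<lambda>x. indicator (box a b) x * dirderiv f v x)"
proof (rule Bochner_Integration.integrable_bound)
  show "integrable lborel (\<lambda>x. (K * norm v) * indicator (box a b) x)" by (simp add: emeasure_lborel_box_eq)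
  show "AE x in lborel. norm (indicator (box a b) x * dirderiv f v x) \<le> norm ((K * norm v) * indicator (box a b) x)"
    using has_dirderiv_AE[of v]
  proof eventually_elim
    case (elim x)
    from dirderiv_bound[OF this] show ?case by (auto simp: indicator_def)
  qed
qed simp

text \<open>The key to additivity: the base point of the quotient may move along with the step. A translation
shifts this movement to the box, whose indicator converges off the frontier of the box.\<close>

lemma box_integral_diff_quot_tendsto:
  "(\<lambda>n. LINT x|lborel. indicator (box a b) x * diff_quot f n w (inverse (real (Suc n)) *\<^sub>R v + x))
    \<longlonglongrightarrow> (LINT x|lborel. indicator (box a b) x * dirderiv f w x)"
proof -
  define s where "s n = inverse (real (Suc n)) *\<^sub>R v" for n
  have s0: "s \<longlonglongrightarrow> 0"
    using tendsto_scaleR[OF LIMSEQ_inverse_real_of_nat tendsto_const, of v] by (simp add: s_def[abs_def])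
  have s_le: "norm (s n) \<le> norm v" for n
    using mult_right_mono[of "inverse (real (Suc n))" 1 "norm v"] by (simp add: s_def inverse_le_1_iff)
  obtain R where R: "\<And>x. x \<in> box a b \<Longrightarrow> norm x \<le> R"
    using bounded_box[of a b] unfolding bounded_iff by blast
  have eq: "(LINT x|lborel. indicator (box a b) x * diff_quot f n w (s n + x)) =
      (LINT y|lborel. indicator (box a b) (y - s n) * diff_quot f n w y)" for n
    using lborel_integral_translate[of "\<lambda>y. indicator (box a b) (y - s n) * diff_quot f n w y" "s n"] by simp
  have "negligible (frontier (box a b))" by (rule negligible_convex_frontier) simp
  then have fr: "frontier (box a b) \<in> null_sets lborel"
    using null_sets_completion_iff[of "frontier (box a b)" lborel] by (simp add: negligible_iff_null_sets)
  have "(\<lambda>n. LINT y|lborel. indicator (box a b) (y - s n) * diff_quot f n w y)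
      \<longlonglongrightarrow> (LINT x|lborel. indicator (box a b) x * dirderiv f w x)"
  proof (rule integral_dominated_convergence)
    let ?w = "\<lambda>y::'a. (K * norm w) * indicator (cball 0 (R + norm v)) y :: real"
    have "emeasure lborel (cball (0::'a) (R + norm v)) < \<infinity>" by (rule emeasure_bounded_finite) simp
    then show "integrable lborel ?w"
      by (intro integrable_mult_right integrable_real_indicator) auto
    show "AE y in lborel. (\<lambda>n. indicator (box a b) (y - s n) * diff_quot f n w y) \<longlonglongrightarrow> indicator (box a b) y * dirderiv f w y"
      using has_dirderiv_AE[of w] AE_not_in[OF fr]
    proof eventually_elim
      case (elim y)
      then show ?case
        by (intro tendsto_mult diff_quot_tendsto indicator_box_translate_tendsto s0)
    qed
    show "AE y in lborel. norm (indicator (box a b) (y - s n) * diff_quot f n w y) \<le> ?w y" for n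
    proof (rule AE_I2)
      fix y
      show "norm (indicator (box a b) (y - s n) * diff_quot f n w y) \<le> ?w y"
      proof (cases "y - s n \<in> box a b")
        case True
        have "norm y \<le> norm (y - s n) + norm (s n)" by (metis diff_add_cancel norm_triangle_ineq)
        with R[OF True] s_le[of n] have "y \<in> cball 0 (R + norm v)" by simp
        with diff_quot_bound[of n w y] True show ?thesis by (simp add: abs_mult)
      next
        case False
        then show ?thesis using lipschitz_on_nonneg[OF lip] by simp
      qed
    qed
  qed simp_all
  then show ?thesis unfolding eq[symmetric] unfolding s_def .
qed

text \<open>The quotient in direction \<open>v + w\<close> is the sum of the one in direction \<open>v\<close> and the one in direction
\<open>w\<close> at the base point moved by the step along \<open>v\<close>. Pointwise this says nothing in the limit, but the
integrals over boxes converge.\<close>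

lemma box_integral_dirderiv_add:
  "(LINT x|lborel. indicator (box a b) x * dirderiv f (v + w) x) =
   (LINT x|lborel. indicator (box a b) x * dirderiv f v x) +
   (LINT x|lborel. indicator (box a b) x * dirderiv f w x)" (is "?I (v + w) = ?I v + ?I w")
proof -
  define J where "J n u c = (LINT x|lborel. indicator (box a b) x * diff_quot f n u (c + x))" for n u c
  have int: "integrable lborel (\<lambda>x. indicator (box a b) x * diff_quot f n u (c + x))" for n u c
  proof (rule Bochner_Integration.integrable_bound)
    show "integrable lborel (\<lambda>x. (K * norm u) * indicator (box a b) x)" by (simp add: emeasure_lborel_box_eq)
    show "AE x in lborel. norm (indicator (box a b) x * diff_quot f n u (c + x)) \<le> norm ((K * norm u) * indicator (box a b) x)"
      using order_trans[OF diff_quot_bound[of n u] abs_ge_self] by (intro AE_I2) (auto simp: indicator_def)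
  qed simp
  have sum: "J n (v + w) 0 = J n v 0 + J n w (inverse (real (Suc n)) *\<^sub>R v)" for n
  proof -
    have "diff_quot f n (v + w) x = diff_quot f n v x + diff_quot f n w (inverse (real (Suc n)) *\<^sub>R v + x)" for x
      unfolding diff_quot_def by (simp add: algebra_simps)
    then have "J n (v + w) 0 = (LINT x|lborel. indicator (box a b) x * diff_quot f n v (0 + x) +
        indicator (box a b) x * diff_quot f n w (inverse (real (Suc n)) *\<^sub>R v + x))"
      unfolding J_def by (simp add: distrib_left)
    also have "\<dots> = J n v 0 + J n w (inverse (real (Suc n)) *\<^sub>R v)"
      unfolding J_def by (rule Bochner_Integration.integral_add[OF int int])
    finally show ?thesis .
  qed
  have lim: "(\<lambda>n. J n u (inverse (real (Suc n)) *\<^sub>R c)) \<longlonglongrightarrow> ?I u" for u c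
    unfolding J_def by (rule box_integral_diff_quot_tendsto)
  have "(\<lambda>n. J n (v + w) 0) \<longlonglongrightarrow> ?I (v + w)" using lim[of "v + w" 0] by simp
  moreover have "(\<lambda>n. J n (v + w) 0) \<longlonglongrightarrow> ?I v + ?I w"
    unfolding sum using tendsto_add[OF lim[of v 0] lim[of w v]] by simp
  ultimately show ?thesis by (rule LIMSEQ_unique)
qed

lemma box_integral_dirderiv_scaleR:
  "(LINT x|lborel. indicator (box a b) x * dirderiv f (c *\<^sub>R v) x) =
   c * (LINT x|lborel. indicator (box a b) x * dirderiv f v x)"
proof -
  have "(LINT x|lborel. indicator (box a b) x * dirderiv f (c *\<^sub>R v) x) =
      (LINT x|lborel. c * (indicator (box a b) x * dirderiv f v x))"
  proof (rule integral_cong_AE)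
    show "AE x in lborel. indicator (box a b) x * dirderiv f (c *\<^sub>R v) x = c * (indicator (box a b) x * dirderiv f v x)"
      using has_dirderiv_AE[of v]
    proof eventually_elim
      case (elim x)
      have "((\<lambda>t. f (x + t *\<^sub>R v)) has_real_derivative dirderiv f v x) (at (c * 0))" using elim by simp
      from DERIV_chain'[OF DERIV_cmult_Id this]
      have "((\<lambda>t. f (x + t *\<^sub>R (c *\<^sub>R v))) has_real_derivative c * dirderiv f v x) (at 0)"
        by (simp add: mult.commute)
      from dirderiv_eqI[OF this] show ?case by simp
    qed
  qed simp_all
  then show ?thesis by simp
qed

lemma partials_vec_measurable[measurable]: "partials_vec f \<in> borel_measurable borel"
  unfolding partials_vec_def[abs_def] by measurable

text \<open>Additivity and homogeneity of the integrals over each box express the integral of the derivative in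
direction \<open>v\<close> by those of the partial derivatives, so the difference has integral \<open>0\<close> over each box.\<close>

lemma dirderiv_linear_AE: "AE x in lborel. dirderiv f v x = partials_vec f x \<bullet> v"
proof -
  have "AE x in lborel. dirderiv f v x - partials_vec f x \<bullet> v = 0"
  proof (rule AE_eq_0_if_box_integrals_0)
    have "AE x in lborel. \<forall>b\<in>insert v Basis. has_dirderiv f b x"
      by (intro AE_finite_allI has_dirderiv_AE) simp
    then show "AE x in lborel. \<bar>dirderiv f v x - partials_vec f x \<bullet> v\<bar> \<le> K * norm v + (\<Sum>b\<in>(Basis::'a set). K * norm b * norm v)"
    proof eventually_elim
      case (elim x)
      have "\<bar>partials_vec f x \<bullet> v\<bar> = \<bar>\<Sum>b\<in>Basis. dirderiv f b x * (b \<bullet> v)\<bar>"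
        by (simp add: partials_vec_def inner_sum_left)
      also have "\<dots> \<le> (\<Sum>b\<in>Basis. \<bar>dirderiv f b x * (b \<bullet> v)\<bar>)" by (rule sum_abs)
      also have "\<dots> \<le> (\<Sum>b\<in>(Basis::'a set). K * norm b * norm v)"
      proof (rule sum_mono)
        fix b :: 'a assume "b \<in> Basis"
        then have "\<bar>dirderiv f b x\<bar> \<le> K * norm b" using elim dirderiv_bound by blast
        moreover have "\<bar>b \<bullet> v\<bar> \<le> norm v" using Basis_le_norm[OF \<open>b \<in> Basis\<close>, of v] by (simp add: inner_commute)
        ultimately show "\<bar>dirderiv f b x * (b \<bullet> v)\<bar> \<le> K * norm b * norm v"
          unfolding abs_mult by (intro mult_mono) auto
      qed
      finally show ?case using dirderiv_bound[where v = v and x = x] elim by simp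
    qed
    fix a b :: 'a
    define I where "I v = (LINT x|lborel. indicator (box a b) x * dirderiv f v x)" for v
    have I0: "I 0 = 0" using box_integral_dirderiv_scaleR[of a b 0 0] by (simp add: I_def)
    have "I (\<Sum>e\<in>B. (v \<bullet> e) *\<^sub>R e) = (\<Sum>e\<in>B. (v \<bullet> e) * I e)" if "finite B" for B
      using that
      by induction (simp_all add: I0, simp add: I_def box_integral_dirderiv_add box_integral_dirderiv_scaleR)
    from this[of Basis] have Iv: "I v = (\<Sum>e\<in>Basis. (v \<bullet> e) * I e)" by (simp add: euclidean_representation)
    have dd: "partials_vec f x \<bullet> v = (\<Sum>e\<in>Basis. (v \<bullet> e) * dirderiv f e x)" for x
      unfolding partials_vec_def inner_sum_left by (intro sum.cong) (simp_all add: inner_commute)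
    have "(LINT x|lborel. indicator (box a b) x * (dirderiv f v x - partials_vec f x \<bullet> v)) =
      (LINT x|lborel. indicator (box a b) x * dirderiv f v x -
        (\<Sum>e\<in>Basis. (v \<bullet> e) * (indicator (box a b) x * dirderiv f e x)))"
      by (simp add: dd right_diff_distrib sum_distrib_left mult.left_commute)
    also have "\<dots> = I v - (\<Sum>e\<in>Basis. (v \<bullet> e) * I e)"
      unfolding I_def
      by (subst Bochner_Integration.integral_diff)
        (auto intro!: integrable_box_dirderiv Bochner_Integration.integrable_sum integrable_mult_right
          simp: Bochner_Integration.integral_sum integrable_box_dirderiv)
    finally show "(LINT x|lborel. indicator (box a b) x * (dirderiv f v x - partials_vec f x \<bullet> v)) = 0"
      using Iv by simp
  qed simp
  then show ?thesis by simp
qed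

text \<open>Finitely many of the directions approximate the whole unit sphere, so the directional derivatives
are uniform in the direction; the Lipschitz condition bridges the gap to the nearest of them.\<close>

lemma has_derivative_if_dense_directional:
  assumes dense: "\<And>X. open X \<Longrightarrow> X \<noteq> {} \<Longrightarrow> \<exists>d\<in>D. d \<in> X"
    and dd: "\<And>v. v \<in> D \<Longrightarrow> ((\<lambda>t. f (x + t *\<^sub>R v)) has_real_derivative G \<bullet> v) (at 0)"
  shows "(f has_derivative (\<lambda>h. G \<bullet> h)) (at x)"
  unfolding has_derivative_at_alt
proof (intro conjI allI impI)
  show "bounded_linear (\<lambda>h. G \<bullet> h)" by (rule bounded_linear_inner_right)
  fix e :: real assume "0 < e"
  have K: "0 \<le> K" using lip by (rule lipschitz_on_nonneg)
  \<comment> \<open>The three errors estimated below are \<open>K\<close>, \<open>1\<close> and \<open>norm G\<close> times \<open>e'\<close>, relative to the increment.\<close>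
  define e' where "e' = e / (K + 1 + norm G)"
  have "0 < K + 1 + norm G" using K norm_ge_zero[of G] by linarith
  then have e': "e' > 0" "(K + 1 + norm G) * e' = e" using \<open>0 < e\<close> by (auto simp: e'_def)
  have "sphere 0 1 \<subseteq> (\<Union>v\<in>D. ball v e')"
  proof
    fix u :: 'a
    obtain v where "v \<in> D" "v \<in> ball u e'" using dense[of "ball u e'"] e'(1) by auto
    then show "u \<in> (\<Union>v\<in>D. ball v e')" by (auto simp: dist_commute)
  qed
  then obtain S where S: "S \<subseteq> D" "finite S" "sphere 0 1 \<subseteq> (\<Union>v\<in>S. ball v e')"
    using compactE_image[of "sphere 0 1" D "\<lambda>v. ball v e'"] by auto
  have "\<exists>d>0. \<forall>t. \<bar>t\<bar> < d \<longrightarrow> \<bar>f (x + t *\<^sub>R v) - f x - (G \<bullet> v) * t\<bar> \<le> e' * \<bar>t\<bar>" if "v \<in> S" for v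
  proof -
    have "((\<lambda>t. f (x + t *\<^sub>R v)) has_derivative (*) (G \<bullet> v)) (at 0)"
      using dd[of v] that S(1) unfolding has_field_derivative_def by blast
    then show ?thesis using e'(1) unfolding has_derivative_at_alt by auto
  qed
  then obtain d where d: "\<And>v. v \<in> S \<Longrightarrow> d v > 0"
    "\<And>v t. v \<in> S \<Longrightarrow> \<bar>t\<bar> < d v \<Longrightarrow> \<bar>f (x + t *\<^sub>R v) - f x - (G \<bullet> v) * t\<bar> \<le> e' * \<bar>t\<bar>"
    by metis
  define r where "r = Min (insert 1 (d ` S))"
  have r: "r > 0" "\<And>v. v \<in> S \<Longrightarrow> r \<le> d v" using S(2) d(1) by (auto simp: r_def)
  show "\<exists>d>0. \<forall>y. norm (y - x) < d \<longrightarrow> norm (f y - f x - G \<bullet> (y - x)) \<le> e * norm (y - x)"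
  proof (intro exI[of _ r] conjI r(1) allI impI)
    fix y assume y: "norm (y - x) < r"
    show "norm (f y - f x - G \<bullet> (y - x)) \<le> e * norm (y - x)"
    proof (cases "y = x")
      case False
      define t where "t = norm (y - x)"
      define u where "u = (y - x) /\<^sub>R t"
      have t: "t > 0" "t < r" using False y by (auto simp: t_def)
      have u: "u \<in> sphere 0 1" "y - x = t *\<^sub>R u" using t by (auto simp: u_def t_def)
      obtain v where v: "v \<in> S" "dist v u < e'" using S(3) u(1) by auto
      have "\<bar>f y - f (x + t *\<^sub>R v)\<bar> \<le> K * (t * e')"
      proof -
        have "\<bar>f y - f (x + t *\<^sub>R v)\<bar> \<le> K * dist y (x + t *\<^sub>R v)"
          using lipschitz_onD[OF lip, of y "x + t *\<^sub>R v"] by (simp add: dist_real_def)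
        also have "dist y (x + t *\<^sub>R v) = norm (t *\<^sub>R (u - v))"
          unfolding dist_norm scaleR_diff_right u(2)[symmetric] by (simp add: algebra_simps)
        also have "\<dots> \<le> t * e'" using t v by (simp add: dist_norm norm_minus_commute)
        finally show ?thesis using K by (simp add: mult_left_mono)
      qed
      moreover have "\<bar>f (x + t *\<^sub>R v) - f x - (G \<bullet> v) * t\<bar> \<le> e' * t"
        using d(2)[OF v(1), of t] t r(2)[OF v(1)] by simp
      moreover have "\<bar>(G \<bullet> v) * t - G \<bullet> (y - x)\<bar> \<le> norm G * (t * e')"
      proof -
        have "(G \<bullet> v) * t - G \<bullet> (y - x) = G \<bullet> (t *\<^sub>R (v - u))" by (simp add: u(2) inner_diff_right algebra_simps)
        also have "\<bar>\<dots>\<bar> \<le> norm G * norm (t *\<^sub>R (v - u))" by (rule Cauchy_Schwarz_ineq2)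
        also have "\<dots> \<le> norm G * (t * e')" using t v by (intro mult_left_mono) (auto simp: dist_norm)
        finally show ?thesis .
      qed
      ultimately have "\<bar>f y - f x - G \<bullet> (y - x)\<bar> \<le> K * (t * e') + e' * t + norm G * (t * e')" by linarith
      also have "\<dots> = ((K + 1 + norm G) * e') * t" by (simp add: algebra_simps)
      finally show ?thesis by (simp add: e'(2) t_def)
    qed simp
  qed
qed

lemma rademacher: "AE x in lborel. (f has_derivative (\<lambda>h. partials_vec f x \<bullet> h)) (at x)"
proof -
  obtain D :: "'a set" where D: "countable D" "\<And>X. open X \<Longrightarrow> X \<noteq> {} \<Longrightarrow> \<exists>d\<in>D. d \<in> X"
    using countable_dense_exists by blast
  have "AE x in lborel. \<forall>v\<in>D. has_dirderiv f v x \<and> dirderiv f v x = partials_vec f x \<bullet> v"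
    using has_dirderiv_AE dirderiv_linear_AE by (subst AE_ball_countable[OF D(1)]) (auto intro: AE_conjI)
  then show ?thesis
  proof eventually_elim
    case (elim x)
    show ?case by (rule has_derivative_if_dense_directional[OF D(2)]) (use elim in auto)
  qed
qed

end

section \<open>Gradients of Lipschitz functions\<close>

lemma grad_eqI:
  fixes f :: "'a::euclidean_space \<Rightarrow> real"
  assumes "(f has_derivative (\<lambda>h. G \<bullet> h)) (at x)"
  shows "grad f x = G"
proof -
  have "GDERIV f x :> G" using assms by (simp add: gderiv_def inner_commute)
  moreover have "D = G" if "GDERIV f x :> D" for D
  proof -
    have "(\<lambda>h. h \<bullet> D) = (\<lambda>h. h \<bullet> G)"
      using that \<open>GDERIV f x :> G\<close> unfolding gderiv_def by (rule has_derivative_unique)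
    then have "h \<bullet> D = h \<bullet> G" for h by (rule fun_cong)
    then show ?thesis using vector_eq_ldot by blast
  qed
  ultimately show ?thesis unfolding grad_def by (rule the_equality)
qed

lemma has_derivative_grad:
  fixes f :: "'a::euclidean_space \<Rightarrow> real"
  assumes "f differentiable (at x)"
  shows "(f has_derivative (\<lambda>h. grad f x \<bullet> h)) (at x)"
proof -
  obtain A where A: "(f has_derivative A) (at x)" using assms unfolding differentiable_def by blast
  then have lin: "linear A" by (rule has_derivative_linear)
  have "A h = (\<Sum>b\<in>Basis. A b *\<^sub>R b) \<bullet> h" for h
  proof -
    have "A h = A (\<Sum>b\<in>Basis. (h \<bullet> b) *\<^sub>R b)" by (simp add: euclidean_representation)
    also have "\<dots> = (\<Sum>b\<in>Basis. (h \<bullet> b) * A b)" by (simp add: linear_sum[OF lin] linear_scale[OF lin])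
    also have "\<dots> = (\<Sum>b\<in>Basis. A b *\<^sub>R b) \<bullet> h" unfolding inner_sum_left by (intro sum.cong) (simp_all add: inner_commute)
    finally show ?thesis .
  qed
  then have "(f has_derivative (\<lambda>h. (\<Sum>b\<in>Basis. A b *\<^sub>R b) \<bullet> h)) (at x)" using A by (metis (no_types, lifting) ext)
  then show ?thesis using grad_eqI by metis
qed

lemma directional_derivative_grad:
  fixes f :: "'a::euclidean_space \<Rightarrow> real"
  assumes "f differentiable (at (x + s *\<^sub>R v))"
  shows "((\<lambda>t. f (x + t *\<^sub>R v)) has_real_derivative grad f (x + s *\<^sub>R v) \<bullet> v) (at s)"
proof -
  have "((\<lambda>t. x + t *\<^sub>R v) has_derivative (\<lambda>t. t *\<^sub>R v)) (at s)"
    by (auto intro!: derivative_eq_intros)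
  from diff_chain_at[OF this has_derivative_grad[OF assms]]
  show ?thesis by (simp add: has_field_derivative_def o_def mult.commute[of _ "_ \<bullet> _"] mult_commute_abs)
qed

lemma norm_grad_le:
  fixes f :: "'a::euclidean_space \<Rightarrow> real"
  assumes lip: "K-lipschitz_on UNIV f" and d: "f differentiable (at x)"
  shows "norm (grad f x) \<le> K"
proof -
  let ?g = "grad f x"
  have "((\<lambda>t. f (x + t *\<^sub>R ?g)) has_real_derivative ?g \<bullet> ?g) (at 0)"
    using directional_derivative_grad[of f x 0 ?g] d by simp
  from tendsto_rabs[OF quotient_tendsto[OF this]] have "\<bar>?g \<bullet> ?g\<bar> \<le> K * norm ?g"
    by (rule Lim_bounded[where M = 0]) (use diff_quot_bound[OF lip, unfolded diff_quot_def] in blast)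
  then have "norm ?g * norm ?g \<le> K * norm ?g" by (simp add: dot_square_norm power2_eq_square)
  then show ?thesis using lipschitz_on_nonneg[OF lip] by (cases "?g = 0") auto
qed

text \<open>The only candidate for the gradient is a Borel function, so the condition in question is that this
candidate is the derivative.\<close>

lemma borel_differentiable:
  fixes f :: "'a::euclidean_space \<Rightarrow> real"
  assumes lip: "K-lipschitz_on UNIV f"
  shows "Measurable.pred borel (\<lambda>x. f differentiable (at x))"
proof -
  have iff: "f differentiable (at x) \<longleftrightarrow> (f has_derivative (\<lambda>h. partials_vec f x \<bullet> h)) (at x)" for x
  proof
    assume "f differentiable (at x)"
    have "dirderiv f b x = grad f x \<bullet> b" for b
      using directional_derivative_grad[of f x 0 b] \<open>f differentiable (at x)\<close> by (intro dirderiv_eqI) simp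
    then have "partials_vec f x = grad f x"
      unfolding partials_vec_def by (simp add: euclidean_representation)
    with has_derivative_grad[OF \<open>f differentiable (at x)\<close>] show "(f has_derivative (\<lambda>h. partials_vec f x \<bullet> h)) (at x)" by simp
  qed (auto simp: differentiable_def)
  show ?thesis unfolding iff
    by (intro borel_has_derivative_at lipschitz_continuous[OF lip] partials_vec_measurable[OF lip])
qed

lemma lipschitz_differentiable_AE:
  fixes f :: "'a::euclidean_space \<Rightarrow> real"
  assumes lip: "K-lipschitz_on UNIV f"
  shows "AE x in lborel. f differentiable (at x)"
  using rademacher[OF lip] by eventually_elim (auto simp: differentiable_def)

text \<open>Off the set of differentiability the gradient is one fixed vector, by its definition with a
definite description.\<close>

lemma grad_measurable:
  fixes f :: "'a::euclidean_space \<Rightarrow> real"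
  assumes lip: "K-lipschitz_on UNIV f"
  shows "grad f \<in> borel_measurable borel"
proof -
  note [measurable] = borel_differentiable[OF lip] partials_vec_measurable[OF lip]
  have "grad f = (\<lambda>x. if f differentiable (at x) then partials_vec f x else (THE D. False))"
  proof
    fix x
    show "grad f x = (if f differentiable (at x) then partials_vec f x else (THE D. False))"
    proof (cases "f differentiable (at x)")
      case True
      have "dirderiv f b x = grad f x \<bullet> b" for b
        using directional_derivative_grad[of f x 0 b] True by (intro dirderiv_eqI) simp
      then show ?thesis using True unfolding partials_vec_def by (simp add: euclidean_representation)
    next
      case False
      then have "\<not> GDERIV f x :> D" for D by (auto simp: gderiv_def differentiable_def)
      then show ?thesis using False by (simp add: grad_def)
    qed
  qed
  also have "\<dots> \<in> borel_measurable borel" by measurable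
  finally show ?thesis .
qed

lemma AE_lborel_affine:
  fixes P :: "'a::euclidean_space \<Rightarrow> bool"
  assumes "c \<noteq> 0" and [measurable]: "Measurable.pred borel P" and "AE x in lborel. P x"
  shows "AE x in lborel. P (t + c *\<^sub>R x)"
proof -
  have "AE x in density (distr lborel borel (\<lambda>x. t + c *\<^sub>R x)) (\<lambda>_. \<bar>c\<bar> ^ DIM('a)). P x"
    using assms(3) lborel_affine[OF \<open>c \<noteq> 0\<close>, of t] by metis
  then have "AE x in distr lborel borel (\<lambda>x. t + c *\<^sub>R x). P x"
    using \<open>c \<noteq> 0\<close> by (subst (asm) AE_density) auto
  then show ?thesis by (subst (asm) AE_distr_iff) auto
qed

text \<open>For each fixed \<open>t \<noteq> 0\<close> the map from \<open>v\<close> to \<open>x + t *\<^sub>R v\<close> preserves null sets; then swap \<open>v\<close> and \<open>t\<close>.\<close>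

lemma AE_line:
  fixes P :: "'a::euclidean_space \<Rightarrow> bool"
  assumes [measurable]: "Measurable.pred borel P" and P: "AE x in lborel. P x"
  shows "AE v in lborel. AE t in (lborel :: real measure). P (x + t *\<^sub>R v)"
proof -
  have "AE t in (lborel :: real measure). t \<noteq> 0" by (rule AE_lborel_singleton)
  then have "AE t in (lborel :: real measure). AE v in lborel. P (x + t *\<^sub>R v)"
    by eventually_elim (rule AE_lborel_affine[OF _ assms])
  then show ?thesis by (subst lborel_pair.AE_commute) measurable
qed

lemma AE_line_rescale:
  fixes v :: "'a::euclidean_space"
  assumes [measurable]: "Measurable.pred borel P" and P: "AE t in (lborel :: real measure). P (x + t *\<^sub>R v)" and "c \<noteq> 0"
  shows "AE t in (lborel :: real measure). P (x + t *\<^sub>R (c *\<^sub>R v))"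
proof -
  have "AE t in (lborel :: real measure). P (x + (0 + c *\<^sub>R t) *\<^sub>R v)"
    by (rule AE_lborel_affine[OF \<open>c \<noteq> 0\<close> _ P]) measurable
  then show ?thesis by (simp add: mult.commute)
qed

text \<open>The difference quotients are bounded by the Lipschitz constant and converge almost everywhere, so
their integrals converge to that of the derivative; but these integrals are themselves difference
quotients of an antiderivative of \<open>\<phi>\<close>, taken at \<open>0\<close> and at \<open>1\<close>.\<close>

lemma lipschitz_FTC:
  fixes \<phi> :: "real \<Rightarrow> real"
  assumes lip: "K-lipschitz_on UNIV \<phi>" and [measurable]: "\<psi> \<in> borel_measurable borel"
    and der: "AE s in lborel. (\<phi> has_real_derivative \<psi> s) (at s)"
  shows "(LINT s|lborel. indicator {0..1} s * \<psi> s) = \<phi> 1 - \<phi> 0"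
proof -
  note [measurable] = lipschitz_borel_measurable[OF lip]
  have cont: "continuous_on A \<phi>" for A
    using lipschitz_on_continuous_on[OF lip] by (rule continuous_on_subset) simp
  define \<Phi> where "\<Phi> u = integral {-1..u} \<phi>" for u
  have \<Phi>: "(\<Phi> has_real_derivative \<phi> u) (at u)" if "-1 < u" "u < 3" for u
  proof -
    have "(\<Phi> has_real_derivative \<phi> u) (at u within {-1..3})"
      unfolding \<Phi>_def[abs_def] using that by (intro integral_has_real_derivative cont) auto
    then show ?thesis using at_within_Icc_at[of "-1" u 3] that by simp
  qed
  have continuous_shift: "continuous_on UNIV (\<lambda>s. \<phi> (s + h))" for h
    by (intro continuous_on_compose2[OF cont[of UNIV]] continuous_intros) auto
  have shift: "(LINT s|lborel. indicator {0..1} s * \<phi> (s + h)) = \<Phi> (1 + h) - \<Phi> h" if "0 \<le> h" "h \<le> 1" for h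
  proof -
    have "(LINT s|lborel. \<phi> (s + h) * indicator {0..1} s) = \<Phi> (1 + h) - \<Phi> (0 + h)"
    proof (rule integral_FTC_Icc_real[where F = "\<lambda>s. \<Phi> (s + h)"])
      fix s :: real assume "0 \<le> s" "s \<le> 1"
      show "((\<lambda>s. \<Phi> (s + h)) has_real_derivative \<phi> (s + h)) (at s)"
        using \<Phi>[of "s + h"] \<open>0 \<le> s\<close> \<open>s \<le> 1\<close> that by (simp add: DERIV_shift)
      show "isCont (\<lambda>s. \<phi> (s + h)) s"
        using continuous_shift by (simp add: continuous_on_eq_continuous_at)
    qed simp
    then show ?thesis by (simp add: mult.commute)
  qed
  define q where "q n s = real (Suc n) * (\<phi> (s + inverse (real (Suc n))) - \<phi> s)" for n s
  have q_diff_quot: "q n s = diff_quot \<phi> n 1 s" for n s unfolding q_def diff_quot_def by simp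
  have [measurable]: "q n \<in> borel_measurable borel" for n unfolding q_def[abs_def] by measurable
  have "(\<lambda>n. LINT s|lborel. indicator {0..1} s * q n s) \<longlonglongrightarrow> (LINT s|lborel. indicator {0..1} s * \<psi> s)"
  proof (rule integral_dominated_convergence)
    show "integrable lborel (\<lambda>s. K * indicator {0..1::real} s)" by simp
    show "AE s in lborel. (\<lambda>n. indicator {0..1} s * q n s) \<longlonglongrightarrow> indicator {0..1} s * \<psi> s"
      using der
    proof eventually_elim
      case (elim s)
      have "((\<lambda>t. \<phi> (s + t *\<^sub>R 1)) has_real_derivative \<psi> s) (at 0)"
        using elim DERIV_at_within_shift[of \<phi> "\<psi> s" s 0 UNIV] by simp
      from quotient_tendsto[OF this] show ?case
        by (intro tendsto_mult tendsto_const) (simp add: q_def)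
    qed
    show "AE s in lborel. norm (indicator {0..1} s * q n s) \<le> K * indicator {0..1} s" for n
      using diff_quot_bound[OF lip, of n 1] by (intro AE_I2) (auto simp: indicator_def q_diff_quot)
  qed simp_all
  moreover have "(\<lambda>n. LINT s|lborel. indicator {0..1} s * q n s) \<longlonglongrightarrow> \<phi> 1 - \<phi> 0"
  proof -
    have int: "integrable lborel (\<lambda>s. indicator {0..1} s * \<phi> (s + h))" for h
      using borel_integrable_atLeastAtMost'[of 0 1 "\<lambda>s. \<phi> (s + h)"]
        continuous_on_subset[OF continuous_shift] by (auto simp: set_integrable_def)
    have eq: "(LINT s|lborel. indicator {0..1} s * q n s) =
      real (Suc n) * (\<Phi> (1 + inverse (real (Suc n))) - \<Phi> 1) - real (Suc n) * (\<Phi> (0 + inverse (real (Suc n))) - \<Phi> 0)" for n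
    proof -
      let ?h = "inverse (real (Suc n))"
      have "(LINT s|lborel. indicator {0..1} s * q n s) =
        (LINT s|lborel. real (Suc n) * (indicator {0..1} s * \<phi> (s + ?h) - indicator {0..1} s * \<phi> (s + 0)))"
        by (simp add: q_def algebra_simps)
      also have "\<dots> = real (Suc n) * ((LINT s|lborel. indicator {0..1} s * \<phi> (s + ?h)) - (LINT s|lborel. indicator {0..1} s * \<phi> (s + 0)))"
        by (simp only: integral_mult_right_zero Bochner_Integration.integral_diff[OF int int])
      also have "\<dots> = real (Suc n) * ((\<Phi> (1 + ?h) - \<Phi> ?h) - (\<Phi> (1 + 0) - \<Phi> 0))"
        by (subst (1 2) shift) (simp_all add: inverse_le_1_iff)
      finally show ?thesis by (simp add: algebra_simps)
    qed
    have lim: "(\<lambda>n. real (Suc n) * (\<Phi> (u + inverse (real (Suc n))) - \<Phi> u)) \<longlonglongrightarrow> \<phi> u" if "-1 < u" "u < 3" for u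
    proof -
      have "((\<lambda>t. \<Phi> (u + t *\<^sub>R 1)) has_real_derivative \<phi> u) (at 0)"
        using \<Phi>[OF that] DERIV_at_within_shift[of \<Phi> "\<phi> u" u 0 UNIV] by simp
      from quotient_tendsto[OF this] show ?thesis by simp
    qed
    show ?thesis unfolding eq by (intro tendsto_diff lim) simp_all
  qed
  ultimately show ?thesis by (rule LIMSEQ_unique)
qed

lemma integral_grad_along_segment:
  fixes f :: "'a::euclidean_space \<Rightarrow> real"
  assumes lip: "K-lipschitz_on UNIV f"
    and diff: "AE s in (lborel :: real measure). f differentiable (at (x + s *\<^sub>R v))"
  shows "(LINT s|lborel. indicator {0..1} s * (grad f (x + s *\<^sub>R v) \<bullet> v)) = f (x + v) - f x"
proof -
  note [measurable] = grad_measurable[OF lip]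
  have "(LINT s|lborel. indicator {0..1} s * (grad f (x + s *\<^sub>R v) \<bullet> v)) = f (x + 1 *\<^sub>R v) - f (x + 0 *\<^sub>R v)"
  proof (rule lipschitz_FTC[OF lipschitz_line[OF lip]])
    show "AE s in lborel. ((\<lambda>t. f (x + t *\<^sub>R v)) has_real_derivative grad f (x + s *\<^sub>R v) \<bullet> v) (at s)"
      using diff by eventually_elim (rule directional_derivative_grad)
  qed measurable
  then show ?thesis by simp
qed

section \<open>Sampling kernels and the shortest vector of a segment\<close>

lemma measurable_borel_fst[measurable (raw)]:
  fixes f :: "'x \<Rightarrow> 'b::second_countable_topology \<times> 'c::second_countable_topology"
  assumes "f \<in> borel_measurable M"
  shows "(\<lambda>x. fst (f x)) \<in> borel_measurable M"
  by (rule measurable_compose[OF assms]) (intro borel_measurable_continuous_onI continuous_intros)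

lemma measurable_borel_snd[measurable (raw)]:
  fixes f :: "'x \<Rightarrow> 'b::second_countable_topology \<times> 'c::second_countable_topology"
  assumes "f \<in> borel_measurable M"
  shows "(\<lambda>x. snd (f x)) \<in> borel_measurable M"
  by (rule measurable_compose[OF assms]) (intro borel_measurable_continuous_onI continuous_intros)

text \<open>Every function on the natural numbers is Borel, as their topology is discrete.\<close>

lemma borel_measurable_nat_comp:
  fixes N :: "'x \<Rightarrow> nat" and F :: "nat \<Rightarrow> nat"
  assumes "N \<in> borel_measurable M"
  shows "(\<lambda>x. F (N x)) \<in> borel_measurable M"
proof (rule measurable_compose[OF assms])
  have "sets (borel :: nat measure) = sets (count_space UNIV)" by (rule sets_borel_eq_count_space)
  from measurable_cong_sets[OF this this] show "F \<in> borel_measurable borel" by simp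
qed

lemma sgn_measurable[measurable (raw)]:
  fixes g :: "'x \<Rightarrow> 'a::euclidean_space"
  assumes [measurable]: "g \<in> borel_measurable M"
  shows "(\<lambda>x. sgn (g x)) \<in> borel_measurable M"
  unfolding sgn_div_norm by measurable

lemma snoc_measurable[measurable (raw)]:
  fixes H :: "'x \<Rightarrow> 'a::euclidean_space history"
  assumes [measurable]: "H \<in> borel_measurable M" "V \<in> borel_measurable M"
  shows "(\<lambda>w. snoc (H w) (V w)) \<in> borel_measurable M"
proof -
  have coord: "(\<lambda>w. snd (H w) i) \<in> borel_measurable M" for i
    by (rule measurable_compose[OF _ measurable_product_coordinates]) measurable
  have len: "Measurable.pred M (\<lambda>w. i = fst (H w))" for i
  proof -
    have "fst \<circ> H \<in> borel_measurable M" unfolding o_def by measurable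
    moreover have "{i} \<in> sets borel" by simp
    ultimately have "(fst \<circ> H) -` {i} \<inter> space M \<in> sets M" by (rule measurable_sets)
    moreover have "(fst \<circ> H) -` {i} \<inter> space M = {w \<in> space M. i = fst (H w)}" by auto
    ultimately show ?thesis by (simp add: pred_def)
  qed
  have "(\<lambda>w. (snd (H w))(fst (H w) := V w)) \<in> borel_measurable M"
  proof (rule measurable_coordinatewise_then_product)
    fix i
    have "(\<lambda>w. if i = fst (H w) then V w else snd (H w) i) \<in> borel_measurable M"
      using len coord by (intro measurable_If) (auto simp: pred_def)
    then show "(\<lambda>w. ((snd (H w))(fst (H w) := V w)) i) \<in> borel_measurable M"
      by (simp add: fun_upd_def)
  qed
  moreover have "(\<lambda>w. Suc (fst (H w))) \<in> borel_measurable M"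
    by (rule borel_measurable_nat_comp) measurable
  ultimately show ?thesis unfolding snoc_def by (rule borel_measurable_Pair[rotated])
qed

text \<open>The unconstrained minimizer of the quadratic function \<open>norm (g + s *\<^sub>R (w - g))\<close> squared, clamped to
the unit interval. It is \<open>0\<close> when \<open>g = w\<close>, as division by zero yields zero.\<close>

definition min_norm_param :: "'a::euclidean_space \<Rightarrow> 'a \<Rightarrow> real" where
  "min_norm_param g w = max 0 (min 1 (g \<bullet> (g - w) / (norm (g - w))\<^sup>2))"

lemma norm_segment_point_sq:
  fixes g w :: "'a::euclidean_space"
  shows "(norm (g + s *\<^sub>R (w - g)))\<^sup>2 = (norm g)\<^sup>2 - 2 * s * (g \<bullet> (g - w)) + s\<^sup>2 * (norm (g - w))\<^sup>2"
  unfolding power2_norm_eq_inner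
  by (simp add: inner_add_left inner_add_right inner_diff_left inner_diff_right inner_commute algebra_simps power2_eq_square)

lemma min_norm_param_minimal:
  fixes g w :: "'a::euclidean_space"
  assumes s: "0 \<le> s" "s \<le> 1"
  shows "norm (g + min_norm_param g w *\<^sub>R (w - g)) \<le> norm (g + s *\<^sub>R (w - g))"
proof (cases "g = w")
  case False
  define A B t where "A = g \<bullet> (g - w)" and "B = (norm (g - w))\<^sup>2" and "t = min_norm_param g w"
  have B: "B > 0" using False by (simp add: B_def)
  have t: "t = max 0 (min 1 (A / B))" by (simp add: t_def min_norm_param_def A_def B_def)
  have "0 \<le> (s - t) * ((s + t) * B - 2 * A)"
  proof -
    consider "A \<le> 0" | "A \<ge> B" | "0 < A" "A < B" by linarith
    then show ?thesis
    proof cases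
      case 1
      then have "t = 0" using B by (simp add: t divide_nonpos_pos)
      moreover have "0 \<le> s * B - 2 * A" using 1 mult_nonneg_nonneg[of s B] B s by linarith
      ultimately show ?thesis using s by simp
    next
      case 2
      then have "t = 1" using B by (simp add: t)
      moreover have "(s + 1) * B \<le> 2 * B" using s B by (intro mult_right_mono) auto
      ultimately show ?thesis using 2 s by (intro mult_nonpos_nonpos) auto
    next
      case 3
      then have "t = A / B" using B by (simp add: t)
      then have "A = t * B" using B by simp
      then have "(s - t) * ((s + t) * B - 2 * A) = B * (s - t)\<^sup>2" by (simp add: power2_eq_square algebra_simps)
      then show ?thesis using B by simp
    qed
  qed
  also have "\<dots> = (norm (g + s *\<^sub>R (w - g)))\<^sup>2 - (norm (g + t *\<^sub>R (w - g)))\<^sup>2"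
    unfolding norm_segment_point_sq A_def[symmetric] B_def[symmetric] by (simp add: power2_eq_square algebra_simps)
  finally show ?thesis unfolding t_def by (simp add: power2_le_iff_abs_le)
qed simp

lemma in_closed_segment_iff: "z \<in> closed_segment g w \<longleftrightarrow> (\<exists>s. 0 \<le> s \<and> s \<le> 1 \<and> z = g + s *\<^sub>R (w - g))"
  for g w :: "'a::euclidean_space"
  unfolding in_segment by (auto simp: algebra_simps)

text \<open>The choice in \<open>ARG_MIN\<close> is forced, since a closed convex set has only one point closest to the origin.
The explicit formula makes it a Borel function of the end points.\<close>

lemma ARG_MIN_closed_segment:
  fixes g w :: "'a::euclidean_space"
  shows "(ARG_MIN norm z. z \<in> closed_segment g w) = g + min_norm_param g w *\<^sub>R (w - g)" (is "?m = ?p")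
proof -
  have p: "?p \<in> closed_segment g w"
    unfolding in_closed_segment_iff by (intro exI[of _ "min_norm_param g w"]) (simp add: min_norm_param_def)
  have min: "norm ?p \<le> norm z" if z: "z \<in> closed_segment g w" for z
  proof -
    obtain s where s: "0 \<le> s" "s \<le> 1" "z = g + s *\<^sub>R (w - g)" using z unfolding in_closed_segment_iff by blast
    show ?thesis unfolding s(3) by (rule min_norm_param_minimal[OF s(1,2)])
  qed
  have "is_arg_min norm (\<lambda>z. z \<in> closed_segment g w) ?p"
    unfolding is_arg_min_def using p min by (auto simp: not_less)
  then have "is_arg_min norm (\<lambda>z. z \<in> closed_segment g w) ?m"
    unfolding arg_min_def by (rule someI[where P = "is_arg_min norm (\<lambda>z. z \<in> closed_segment g w)"])
  then have m: "?m \<in> closed_segment g w" "\<And>z. z \<in> closed_segment g w \<Longrightarrow> norm ?m \<le> norm z"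
    unfolding is_arg_min_def by (auto simp: not_less)
  show ?thesis
    by (rule any_closest_point_unique[of "closed_segment g w" _ _ 0]) (use p min m in auto)
qed

lemma ARG_MIN_segment_measurable:
  fixes G W :: "'x \<Rightarrow> 'a::euclidean_space"
  assumes [measurable]: "G \<in> borel_measurable M" "W \<in> borel_measurable M"
  shows "(\<lambda>x. ARG_MIN norm z. z \<in> closed_segment (G x) (W x)) \<in> borel_measurable M"
  unfolding ARG_MIN_closed_segment min_norm_param_def by measurable

lemma emeasure_uniform_ball:
  fixes x :: "'a::euclidean_space"
  assumes "A \<in> sets borel"
  shows "emeasure (uniform_ball x \<rho>) A = emeasure lborel (ball x \<rho> \<inter> A) / emeasure lborel (ball x \<rho>)"
  unfolding uniform_ball_def using assms by (intro emeasure_uniform_measure) auto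

lemma sets_uniform_ball[simp, measurable_cong]: "sets (uniform_ball x \<rho>) = sets borel"
  by (simp add: uniform_ball_def)

lemma space_uniform_ball[simp]: "space (uniform_ball x \<rho>) = UNIV"
  by (simp add: uniform_ball_def)

lemma prob_space_uniform_ball: "0 < \<rho> \<Longrightarrow> prob_space (uniform_ball (x :: 'a::euclidean_space) \<rho>)"
  using unit_ball_vol_pos[of "real DIM('a)"] unfolding uniform_ball_def
  by (intro prob_space_uniform_measure) (simp_all add: emeasure_ball less_imp_neq[symmetric])

text \<open>For a radius that is not positive the normalization divides zero by zero, which is zero in the
extended nonnegative reals.\<close>

lemma uniform_ball_nonpos: "\<rho> \<le> 0 \<Longrightarrow> uniform_ball (x :: 'a::euclidean_space) \<rho> = null_measure borel"
  by (rule measure_eqI) (simp_all add: emeasure_uniform_ball ball_empty)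

lemma subprob_space_uniform_ball: "subprob_space (uniform_ball (x :: 'a::euclidean_space) \<rho>)"
proof (cases "0 < \<rho>")
  case True
  then show ?thesis by (intro prob_space_imp_subprob_space prob_space_uniform_ball)
next
  case False
  then show ?thesis by (simp add: uniform_ball_nonpos subprob_space_null_measure)
qed

text \<open>The measure of a ball intersected with a fixed set is the integral of an indicator that is jointly
measurable in the centre, the radius and the variable of integration.\<close>

lemma uniform_ball_measurable:
  fixes X :: "'x \<Rightarrow> 'a::euclidean_space"
  assumes [measurable]: "X \<in> borel_measurable M" "R \<in> borel_measurable M"
  shows "(\<lambda>w. uniform_ball (X w) (R w)) \<in> M \<rightarrow>\<^sub>M subprob_algebra borel"
proof (rule measurable_subprob_algebra)
  fix A :: "'a set" assume A[measurable]: "A \<in> sets borel"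
  have m: "(\<lambda>w. emeasure lborel (ball (X w) (R w) \<inter> B)) \<in> borel_measurable M" if [measurable]: "B \<in> sets borel" for B
  proof -
    have "(\<lambda>w. \<integral>\<^sup>+z. indicator {p. dist (X (fst p)) (snd p) < R (fst p) \<and> snd p \<in> B} (w, z) \<partial>lborel) \<in> borel_measurable M"
      by (rule sigma_finite_measure.borel_measurable_nn_integral[OF sigma_finite_lborel]) measurable
    also have "(\<lambda>w. \<integral>\<^sup>+z. indicator {p. dist (X (fst p)) (snd p) < R (fst p) \<and> snd p \<in> B} (w, z) \<partial>lborel) =
        (\<lambda>w. emeasure lborel (ball (X w) (R w) \<inter> B))"
    proof
      fix w
      have "(\<integral>\<^sup>+z. indicator {p. dist (X (fst p)) (snd p) < R (fst p) \<and> snd p \<in> B} (w, z) \<partial>lborel) =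
        (\<integral>\<^sup>+z. indicator (ball (X w) (R w) \<inter> B) z \<partial>lborel)"
        by (intro nn_integral_cong) (auto simp: indicator_def)
      then show "(\<integral>\<^sup>+z. indicator {p. dist (X (fst p)) (snd p) < R (fst p) \<and> snd p \<in> B} (w, z) \<partial>lborel) =
        emeasure lborel (ball (X w) (R w) \<inter> B)" by simp
    qed
    finally show ?thesis .
  qed
  show "(\<lambda>w. emeasure (uniform_ball (X w) (R w)) A) \<in> borel_measurable M"
    unfolding emeasure_uniform_ball[OF A] using m[OF A] m[of UNIV] by measurable simp
qed (simp_all add: subprob_space_uniform_ball)

lemma AE_uniform_ball:
  fixes P :: "'a::euclidean_space \<Rightarrow> bool"
  assumes "AE z in lborel. z \<in> ball x \<rho> \<longrightarrow> P z" and "0 < \<rho>"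
  shows "AE z in uniform_ball x \<rho>. P z"
  unfolding uniform_ball_def using assms by (intro AE_uniform_measureI) auto

lemma measurable_uniform_01: "measurable (uniform_measure lborel {0..1::real}) N = measurable borel N"
  by (rule measurable_cong_sets) simp_all

lemma uniform_01: "prob_space (uniform_measure lborel {0..1::real})"
  by (intro prob_space_uniform_measure) auto

lemma sets_uniform_segment[simp, measurable_cong]: "sets (uniform_segment a b) = sets borel"
  by (simp add: uniform_segment_def)

lemma space_uniform_segment[simp]: "space (uniform_segment a b) = UNIV"
  by (simp add: uniform_segment_def)

lemma prob_space_uniform_segment: "prob_space (uniform_segment a (b :: 'a::euclidean_space))"
  unfolding uniform_segment_def by (intro prob_space.prob_space_distr[OF uniform_01], unfold measurable_uniform_01) measurable

lemma uniform_segment_measurable: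
  fixes X Y :: "'x \<Rightarrow> 'a::euclidean_space"
  assumes [measurable]: "X \<in> borel_measurable M" "Y \<in> borel_measurable M"
  shows "(\<lambda>w. uniform_segment (X w) (Y w)) \<in> M \<rightarrow>\<^sub>M subprob_algebra borel"
  unfolding uniform_segment_def
proof (rule measurable_distr2[where M = borel])
  show "(\<lambda>(w, s). (1 - s) *\<^sub>R X w + s *\<^sub>R Y w) \<in> M \<Otimes>\<^sub>M borel \<rightarrow>\<^sub>M borel" by measurable
  show "(\<lambda>w. uniform_measure lborel {0..1::real}) \<in> M \<rightarrow>\<^sub>M subprob_algebra borel"
    by (rule measurable_const) (simp add: space_subprob_algebra prob_space_imp_subprob_space uniform_01)
qed

lemma AE_uniform_segment:
  fixes x v :: "'a::euclidean_space"
  assumes [measurable]: "Measurable.pred borel P" and "AE s in lborel. 0 \<le> s \<longrightarrow> s \<le> 1 \<longrightarrow> P (x + s *\<^sub>R v)"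
  shows "AE y in uniform_segment x (x + v). P y"
proof -
  have "AE s in uniform_measure lborel {0..1::real}. P (x + s *\<^sub>R v)"
    using assms(2) by (intro AE_uniform_measureI) auto
  moreover have "(1 - s) *\<^sub>R x + s *\<^sub>R (x + v) = x + s *\<^sub>R v" for s by (simp add: algebra_simps)
  ultimately show ?thesis unfolding uniform_segment_def by (subst AE_distr_iff) (auto simp: measurable_uniform_01)
qed

lemma integral_uniform_segment:
  fixes \<psi> :: "'a::euclidean_space \<Rightarrow> real"
  assumes [measurable]: "\<psi> \<in> borel_measurable borel"
  shows "(LINT y|uniform_segment x (x + v). \<psi> y) = (LINT s|lborel. indicator {0..1} s * \<psi> (x + s *\<^sub>R v))"
proof -
  have eq: "(1 - s) *\<^sub>R x + s *\<^sub>R (x + v) = x + s *\<^sub>R v" for s by (simp add: algebra_simps)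
  have "(LINT y|uniform_segment x (x + v). \<psi> y) = (LINT s|uniform_measure lborel {0..1::real}. \<psi> (x + s *\<^sub>R v))"
    unfolding uniform_segment_def eq by (rule integral_distr) (auto simp: uniform_measure_def)
  also have "\<dots> = (LINT s|lborel. indicator {0..1} s * \<psi> (x + s *\<^sub>R v))"
  proof -
    have "uniform_measure lborel {0..1::real} = density lborel (\<lambda>s. ennreal (indicator {0..1} s))"
      unfolding uniform_measure_def by (intro density_cong) (auto simp: indicator_def)
    then show ?thesis by (simp add: integral_density)
  qed
  finally show ?thesis .
qed

section \<open>Measurability of the programs\<close>

lemma measurable_bind_case:
  assumes "f \<in> M \<rightarrow>\<^sub>M subprob_algebra borel" "(\<lambda>(x, y). g x y) \<in> M \<Otimes>\<^sub>M borel \<rightarrow>\<^sub>M subprob_algebra R"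
  shows "(\<lambda>x. f x \<bind> g x) \<in> M \<rightarrow>\<^sub>M subprob_algebra R"
  using assms by (intro measurable_bind[where N = borel]) (simp_all add: case_prod_beta)

lemma return_borel_measurable:
  "F \<in> borel_measurable M \<Longrightarrow> (\<lambda>w. return borel (F w)) \<in> M \<rightarrow>\<^sub>M subprob_algebra borel"
  by (rule measurable_compose[OF _ return_measurable])

context
  fixes f :: "'a::euclidean_space \<Rightarrow> real" and \<delta> \<epsilon> L :: real and r :: "'a history \<Rightarrow> 'a \<Rightarrow> real"
  assumes lip: "L-lipschitz_on UNIV f" and radius_ok: "radius_rule L \<epsilon> r"
begin

lemma radius_measurable:
  assumes [measurable]: "H \<in> borel_measurable M" "G \<in> borel_measurable M"
  shows "(\<lambda>w. r (H w) (G w)) \<in> borel_measurable M"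
proof -
  have "(\<lambda>(h, g). r h g) \<in> borel_measurable borel" using radius_ok unfolding radius_rule_def by blast
  from measurable_compose[OF borel_measurable_Pair[OF assms] this] show ?thesis by simp
qed

lemma loop_guard_measurable:
  assumes [measurable]: "X \<in> borel_measurable M" "G \<in> borel_measurable M"
  shows "Measurable.pred M (\<lambda>w. loop_guard f \<delta> \<epsilon> (X w) (G w))"
proof -
  note [measurable] = lipschitz_borel_measurable[OF lip]
  show ?thesis unfolding loop_guard_def by measurable
qed

lemma evals_measurable:
  assumes [measurable]: "G \<in> borel_measurable M" "N \<in> borel_measurable M"
  shows "(\<lambda>w. N w + guard_evals \<epsilon> k (G w)) \<in> borel_measurable M"
proof -
  define c :: nat where "c = (if k = 0 then 2 else 1)"
  have [measurable]: "(\<lambda>w. N w + c) \<in> borel_measurable M" by (rule borel_measurable_nat_comp) measurable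
  have "(\<lambda>w. if norm (G w) > \<epsilon> then N w + c else N w) \<in> borel_measurable M" by measurable
  moreover have "(\<lambda>w. N w + guard_evals \<epsilon> k (G w)) = (\<lambda>w. if norm (G w) > \<epsilon> then N w + c else N w)"
    by (auto simp: guard_evals_def c_def)
  ultimately show ?thesis by simp
qed

text \<open>The starting point, the current vector, the counter and the history all vary inside the program, so
the induction is about the kernel in all four of them.\<close>

lemma minnorm_loop_measurable:
  fixes X G :: "'x \<Rightarrow> 'a"
  assumes "X \<in> borel_measurable M" "G \<in> borel_measurable M" "N \<in> borel_measurable M" "H \<in> borel_measurable M"
  shows "(\<lambda>w. minnorm_loop f \<delta> \<epsilon> r i k (X w) (G w) (N w) (H w)) \<in> M \<rightarrow>\<^sub>M subprob_algebra borel"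
proof -
  note [measurable] = lipschitz_borel_measurable[OF lip] grad_measurable[OF lip]
  let ?K = "\<lambda>i k (x, g, n, h). minnorm_loop f \<delta> \<epsilon> r i k x g n h"
  have K: "?K i k \<in> borel \<rightarrow>\<^sub>M subprob_algebra borel" for k
  proof (induction i arbitrary: k)
    case 0
    then show ?case by (auto simp: case_prod_beta)
  next
    case (Suc i)
    let ?B = "borel :: ('a \<times> 'a \<times> nat \<times> 'a history) measure"
    define x g n h where "x = (fst :: 'a \<times> 'a \<times> nat \<times> 'a history \<Rightarrow> 'a)" and
      "g = (\<lambda>w :: 'a \<times> 'a \<times> nat \<times> 'a history. fst (snd w))" and
      "n = (\<lambda>w :: 'a \<times> 'a \<times> nat \<times> 'a history. fst (snd (snd w)))" and
      "h = (\<lambda>w :: 'a \<times> 'a \<times> nat \<times> 'a history. snd (snd (snd w)))"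
    have [measurable]: "x \<in> borel_measurable ?B" "g \<in> borel_measurable ?B" "n \<in> borel_measurable ?B" "h \<in> borel_measurable ?B"
      unfolding x_def g_def n_def h_def by measurable
    have [measurable]: "(\<lambda>w. n w + guard_evals \<epsilon> k (g w)) \<in> borel_measurable ?B"
      by (rule evals_measurable) measurable
    have step: "(\<lambda>w. do {
          \<zeta> \<leftarrow> uniform_ball (g w) (r (h w) (g w));
          y \<leftarrow> uniform_segment (x w) (x w - \<delta> *\<^sub>R sgn \<zeta>);
          minnorm_loop f \<delta> \<epsilon> r i (Suc k) (x w)
            (ARG_MIN norm z. z \<in> closed_segment (g w) (grad f y)) (n w + guard_evals \<epsilon> k (g w) + 1) (snoc (snoc (h w) \<zeta>) y)
        }) \<in> ?B \<rightarrow>\<^sub>M subprob_algebra borel"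
    proof (rule measurable_bind_case)
      show "(\<lambda>w. uniform_ball (g w) (r (h w) (g w))) \<in> ?B \<rightarrow>\<^sub>M subprob_algebra borel"
        by (intro uniform_ball_measurable radius_measurable) measurable
      show "(\<lambda>(w, \<zeta>). do {
          y \<leftarrow> uniform_segment (x w) (x w - \<delta> *\<^sub>R sgn \<zeta>);
          minnorm_loop f \<delta> \<epsilon> r i (Suc k) (x w)
            (ARG_MIN norm z. z \<in> closed_segment (g w) (grad f y)) (n w + guard_evals \<epsilon> k (g w) + 1) (snoc (snoc (h w) \<zeta>) y)
        }) \<in> ?B \<Otimes>\<^sub>M borel \<rightarrow>\<^sub>M subprob_algebra borel"
        unfolding case_prod_beta
      proof (rule measurable_bind_case)
        show "(\<lambda>p. uniform_segment (x (fst p)) (x (fst p) - \<delta> *\<^sub>R sgn (snd p))) \<in> ?B \<Otimes>\<^sub>M borel \<rightarrow>\<^sub>M subprob_algebra borel"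
          by (rule uniform_segment_measurable) measurable
        let ?M = "(?B \<Otimes>\<^sub>M (borel :: 'a measure)) \<Otimes>\<^sub>M (borel :: 'a measure)"
        let ?T = "\<lambda>q :: (('a \<times> 'a \<times> nat \<times> 'a history) \<times> 'a) \<times> 'a. (x (fst (fst q)),
            (ARG_MIN norm z. z \<in> closed_segment (g (fst (fst q))) (grad f (snd q))),
            n (fst (fst q)) + guard_evals \<epsilon> k (g (fst (fst q))) + 1, snoc (snoc (h (fst (fst q))) (snd (fst q))) (snd q))"
        have "?T \<in> borel_measurable ?M"
        proof (intro borel_measurable_Pair)
          show "(\<lambda>q. x (fst (fst q))) \<in> borel_measurable ?M" by measurable
          show "(\<lambda>q. ARG_MIN norm z. z \<in> closed_segment (g (fst (fst q))) (grad f (snd q))) \<in> borel_measurable ?M"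
            by (rule ARG_MIN_segment_measurable) measurable
          show "(\<lambda>q. n (fst (fst q)) + guard_evals \<epsilon> k (g (fst (fst q))) + 1) \<in> borel_measurable ?M"
            by (rule borel_measurable_nat_comp) measurable
          show "(\<lambda>q. snoc (snoc (h (fst (fst q))) (snd (fst q))) (snd q)) \<in> borel_measurable ?M"
            by (intro snoc_measurable) measurable
        qed
        from measurable_compose[OF this Suc.IH[of "Suc k"]]
        show "(\<lambda>(p, y). minnorm_loop f \<delta> \<epsilon> r i (Suc k) (x (fst p))
            (ARG_MIN norm z. z \<in> closed_segment (g (fst p)) (grad f y))
            (n (fst p) + guard_evals \<epsilon> k (g (fst p)) + 1) (snoc (snoc (h (fst p)) (snd p)) y))
            \<in> ?M \<rightarrow>\<^sub>M subprob_algebra borel"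
          by (simp add: case_prod_beta)
      qed
    qed
    have ret: "(\<lambda>w. return borel (g w, n w + guard_evals \<epsilon> k (g w), h w)) \<in> ?B \<rightarrow>\<^sub>M subprob_algebra borel"
      by (intro return_borel_measurable borel_measurable_Pair) measurable
    have "Measurable.pred ?B (\<lambda>w. loop_guard f \<delta> \<epsilon> (x w) (g w))"
      by (rule loop_guard_measurable) measurable
    from measurable_If[OF step ret this[unfolded pred_def]]
    show ?case
      unfolding x_def g_def n_def h_def by (simp add: case_prod_beta Let_def)
  qed
  have "(\<lambda>w. (X w, G w, N w, H w)) \<in> borel_measurable M" by (intro borel_measurable_Pair assms)
  from measurable_compose[OF this K[of k]] show ?thesis by simp
qed

lemma minnorm_measurable:
  fixes X :: "'x \<Rightarrow> 'a"
  assumes [measurable]: "X \<in> borel_measurable M" "N \<in> borel_measurable M" "H \<in> borel_measurable M"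
  shows "(\<lambda>w. minnorm f \<delta> \<epsilon> r i (X w) (N w) (H w)) \<in> M \<rightarrow>\<^sub>M subprob_algebra borel"
  unfolding minnorm_def
proof (rule measurable_bind_case)
  note [measurable] = grad_measurable[OF lip]
  show "(\<lambda>w. uniform_ball (X w) \<delta>) \<in> M \<rightarrow>\<^sub>M subprob_algebra borel"
    by (intro uniform_ball_measurable) measurable
  have [measurable]: "(\<lambda>p. N (fst p) + 1) \<in> borel_measurable (M \<Otimes>\<^sub>M borel)"
    by (rule borel_measurable_nat_comp) measurable
  show "(\<lambda>(w, \<zeta>). minnorm_loop f \<delta> \<epsilon> r i 0 (X w) (grad f \<zeta>) (N w + 1) (snoc (H w) \<zeta>)) \<in> M \<Otimes>\<^sub>M borel \<rightarrow>\<^sub>M subprob_algebra borel"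
    unfolding case_prod_beta by (intro minnorm_loop_measurable snoc_measurable) measurable
qed

lemma ingd_measurable:
  fixes X :: "'x \<Rightarrow> 'a"
  assumes "X \<in> borel_measurable M" "N \<in> borel_measurable M" "H \<in> borel_measurable M"
  shows "(\<lambda>w. ingd f \<delta> \<epsilon> r i t (X w) (N w) (H w)) \<in> M \<rightarrow>\<^sub>M subprob_algebra borel"
proof -
  let ?K = "\<lambda>t (x, n, h). ingd f \<delta> \<epsilon> r i t x n h"
  let ?B = "borel :: ('a \<times> nat \<times> 'a history) measure"
  have K: "?K t \<in> borel \<rightarrow>\<^sub>M subprob_algebra borel"
  proof (induction t)
    case 0
    have "(\<lambda>w. return borel (fst w, fst (snd w))) \<in> ?B \<rightarrow>\<^sub>M subprob_algebra borel"
      by (intro return_borel_measurable borel_measurable_Pair) measurable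
    then show ?case by (simp add: case_prod_beta)
  next
    case (Suc t)
    have "(\<lambda>w. do {
        m \<leftarrow> minnorm f \<delta> \<epsilon> r i (fst w) (fst (snd w)) (snd (snd w));
        (case m of (g, n', h') \<Rightarrow> if norm g \<le> \<epsilon> then return borel (fst w, n')
           else ingd f \<delta> \<epsilon> r i t (fst w - \<delta> *\<^sub>R sgn g) n' h')
      }) \<in> ?B \<rightarrow>\<^sub>M subprob_algebra borel"
    proof (rule measurable_bind_case)
      show "(\<lambda>w. minnorm f \<delta> \<epsilon> r i (fst w) (fst (snd w)) (snd (snd w))) \<in> ?B \<rightarrow>\<^sub>M subprob_algebra borel"
        by (rule minnorm_measurable) measurable
      let ?M = "?B \<Otimes>\<^sub>M ?B"
      have ret: "(\<lambda>p. return borel (fst (fst p), fst (snd (snd p)))) \<in> ?M \<rightarrow>\<^sub>M subprob_algebra borel"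
        by (intro return_borel_measurable borel_measurable_Pair) measurable
      have "(\<lambda>p. (fst (fst p) - \<delta> *\<^sub>R sgn (fst (snd p)), fst (snd (snd p)), snd (snd (snd p)))) \<in> borel_measurable ?M"
        by (intro borel_measurable_Pair) measurable
      from measurable_compose[OF this Suc.IH]
      have rec: "(\<lambda>p. ingd f \<delta> \<epsilon> r i t (fst (fst p) - \<delta> *\<^sub>R sgn (fst (snd p))) (fst (snd (snd p))) (snd (snd (snd p)))) \<in> ?M \<rightarrow>\<^sub>M subprob_algebra borel"
        by (simp add: case_prod_beta)
      have "{p \<in> space ?M. norm (fst (snd p)) \<le> \<epsilon>} \<in> sets ?M" by measurable
      from measurable_If[OF ret rec this]
      show "(\<lambda>(w, m). case m of (g, n', h') \<Rightarrow> if norm g \<le> \<epsilon> then return borel (fst w, n')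
           else ingd f \<delta> \<epsilon> r i t (fst w - \<delta> *\<^sub>R sgn g) n' h') \<in> ?M \<rightarrow>\<^sub>M subprob_algebra borel"
        by (simp add: case_prod_beta)
    qed
    then show ?case by (simp add: case_prod_unfold)
  qed
  have "(\<lambda>w. (X w, N w, H w)) \<in> borel_measurable M" by (intro borel_measurable_Pair assms)
  from measurable_compose[OF this K] show ?thesis by simp
qed

end

section \<open>Expected decrease of the squared norm\<close>

text \<open>The function \<open>exp (- (c / u))\<close> lies below its tangent at \<open>u \<ge> c\<close> to the left of \<open>u\<close>, here with \<open>x = c / u\<close> and the
other argument equal to \<open>q * u\<close>. The factor \<open>exp (x - x / q)\<close> is estimated by \<open>exp (- z) \<le> 1 / (1 + z)\<close>.\<close>

lemma exp_tangent_bound: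
  fixes x q :: real
  assumes x: "0 \<le> x" "x \<le> 1" and q: "0 < q" "q \<le> 1"
  shows "exp (- (x / q)) \<le> exp (- x) * (1 - x * (1 - q))"
proof -
  define z where "z = x * (1 - q) / q"
  have z: "0 \<le> z" using x q by (simp add: z_def)
  have "exp (- z) \<le> 1 / (1 + z)"
    using exp_ge_add_one_self[of z] z by (simp add: exp_minus field_simps)
  also have "1 / (1 + z) = q / (q + x * (1 - q))" using q by (simp add: z_def field_simps)
  also have "\<dots> \<le> 1 - x * (1 - q)"
  proof -
    have "0 \<le> x * (1 - q)\<^sup>2 * (1 - x)" using x by simp
    then have "q \<le> (1 - x * (1 - q)) * (q + x * (1 - q))" by (simp add: power2_eq_square algebra_simps)
    moreover have "0 < q + x * (1 - q)" using x q by (intro add_pos_nonneg) auto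
    ultimately show ?thesis by (simp add: pos_divide_le_eq)
  qed
  finally have "exp (- x) * exp (- z) \<le> exp (- x) * (1 - x * (1 - q))" by simp
  moreover have "exp (- x) * exp (- z) = exp (- (x / q))"
    unfolding exp_add[symmetric] using q by (simp add: z_def field_simps)
  ultimately show ?thesis by simp
qed

text \<open>The bound on the radius says that the angle between \<open>g\<close> and \<open>\<zeta>\<close> has cosine above
\<open>1 - norm g ^ 2 / (128 * L ^ 2)\<close>, and the chord is twice the square root of half the deficit.\<close>

lemma sgn_close_if_in_small_ball:
  fixes g \<zeta> :: "'a::euclidean_space"
  assumes g: "0 < norm g" "norm g \<le> L"
    and \<zeta>: "\<zeta> \<in> ball g \<rho>" and \<rho>: "\<rho> < norm g * sqrt (1 - (1 - (norm g)\<^sup>2 / (128 * L\<^sup>2))\<^sup>2)"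
  shows "norm (sgn g - sgn \<zeta>) \<le> norm g / (8 * L)"
proof -
  define s where "s = (norm g)\<^sup>2 / (128 * L\<^sup>2)"
  have L: "0 < L" using g by linarith
  have "(norm g)\<^sup>2 \<le> L\<^sup>2" using g by (intro power_mono) auto
  then have "s \<le> L\<^sup>2 / (128 * L\<^sup>2)" unfolding s_def by (rule divide_right_mono) simp
  also have "L\<^sup>2 / (128 * L\<^sup>2) = 1 / 128" using L by simp
  finally have "s \<le> 1 / 128" .
  moreover have "0 < s" unfolding s_def using L g by (intro divide_pos_pos) auto
  ultimately have s: "0 < s" "s \<le> 1 / 128" by auto
  have "(1 - s)\<^sup>2 \<le> 1" by (rule power_le_one) (use s in auto)
  then have s1: "0 \<le> 1 - (1 - s)\<^sup>2" "1 - (1 - s)\<^sup>2 \<le> 1" by auto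
  have d: "norm (g - \<zeta>) < norm g * sqrt (1 - (1 - s)\<^sup>2)"
    using \<zeta> \<rho> by (simp add: s_def dist_norm)
  then have "norm (g - \<zeta>) < norm g" using s1 by (smt (verit) mult_left_le real_sqrt_le_1_iff norm_ge_zero)
  then have "\<zeta> \<noteq> 0" by auto
  have "(norm (g - \<zeta>))\<^sup>2 < (norm g * sqrt (1 - (1 - s)\<^sup>2))\<^sup>2" using d by (intro power_strict_mono) auto
  then have "(norm (g - \<zeta>))\<^sup>2 < (norm g)\<^sup>2 * (1 - (1 - s)\<^sup>2)" using s1 by (simp add: power_mult_distrib)
  moreover have "(norm (g - \<zeta>))\<^sup>2 = (norm g)\<^sup>2 - 2 * (g \<bullet> \<zeta>) + (norm \<zeta>)\<^sup>2"
    unfolding power2_norm_eq_inner by (simp add: inner_diff_left inner_diff_right inner_commute)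
  moreover have "(norm g)\<^sup>2 * (1 - (1 - s)\<^sup>2) = (norm g)\<^sup>2 - (norm g * (1 - s))\<^sup>2"
    by (simp only: power_mult_distrib right_diff_distrib[of "(norm g)\<^sup>2"] mult_1_right)
  ultimately have "(norm \<zeta>)\<^sup>2 + (norm g * (1 - s))\<^sup>2 < 2 * (g \<bullet> \<zeta>)" by linarith
  moreover have "2 * (norm \<zeta> * (norm g * (1 - s))) \<le> (norm \<zeta>)\<^sup>2 + (norm g * (1 - s))\<^sup>2"
    using sum_squares_bound[of "norm \<zeta>" "norm g * (1 - s)"] by (simp add: mult.assoc)
  ultimately have "norm \<zeta> * norm g * (1 - s) < g \<bullet> \<zeta>" by (simp add: mult.assoc)
  moreover have "sgn g \<bullet> sgn \<zeta> = (g \<bullet> \<zeta>) / (norm \<zeta> * norm g)" by (simp add: sgn_div_norm field_simps)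
  ultimately have c: "1 - s < sgn g \<bullet> sgn \<zeta>" using g \<open>\<zeta> \<noteq> 0\<close> by (simp add: pos_less_divide_eq mult.commute)
  have "(norm (sgn g - sgn \<zeta>))\<^sup>2 = (norm (sgn g))\<^sup>2 - 2 * (sgn g \<bullet> sgn \<zeta>) + (norm (sgn \<zeta>))\<^sup>2"
    unfolding power2_norm_eq_inner by (simp add: inner_diff_left inner_diff_right inner_commute)
  also have "\<dots> \<le> 2 * s" using c g \<open>\<zeta> \<noteq> 0\<close> by (auto simp: norm_sgn)
  also have "\<dots> = (norm g / (8 * L))\<^sup>2" by (simp add: s_def power_divide power_mult_distrib)
  finally show ?thesis using g L by (simp add: power2_le_iff_abs_le)
qed

lemma ennreal_integral_le_nn_integral:
  fixes \<phi> :: "'x \<Rightarrow> real"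
  assumes "integrable M \<phi>"
  shows "ennreal (LINT x|M. \<phi> x) \<le> (\<integral>\<^sup>+x. ennreal (\<phi> x) \<partial>M)"
proof -
  have "(LINT x|M. \<phi> x) \<le> (LINT x|M. max 0 (\<phi> x))" using assms by (intro integral_mono) auto
  then have "ennreal (LINT x|M. \<phi> x) \<le> ennreal (LINT x|M. max 0 (\<phi> x))" by (rule ennreal_leI)
  also have "\<dots> = (\<integral>\<^sup>+x. ennreal (max 0 (\<phi> x)) \<partial>M)"
    using assms by (intro nn_integral_eq_integral[symmetric]) auto
  also have "\<dots> = (\<integral>\<^sup>+x. ennreal (\<phi> x) \<partial>M)" by (intro nn_integral_cong) (simp add: max_def ennreal_neg)
  finally show ?thesis .
qed

text \<open>The directions whose segment can be used: almost every point of it has a gradient.\<close>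

definition good_dir :: "('a::euclidean_space \<Rightarrow> real) \<Rightarrow> real \<Rightarrow> 'a \<Rightarrow> 'a \<Rightarrow> bool" where
  "good_dir f \<delta> x \<zeta> \<longleftrightarrow> \<zeta> \<noteq> 0 \<and> (AE s in (lborel :: real measure). f differentiable (at (x + s *\<^sub>R (- \<delta> *\<^sub>R sgn \<zeta>))))"

context
  fixes f :: "'a::euclidean_space \<Rightarrow> real" and \<delta> L :: real
  assumes lip: "L-lipschitz_on UNIV f" and \<delta>: "0 < \<delta>"
begin

lemma good_dir_AE: "AE \<zeta> in lborel. good_dir f \<delta> x \<zeta>"
proof -
  note meas[measurable] = borel_differentiable[OF lip]
  have "AE \<zeta> in lborel. AE t in (lborel :: real measure). f differentiable (at (x + t *\<^sub>R \<zeta>))"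
    by (rule AE_line[OF meas lipschitz_differentiable_AE[OF lip]])
  moreover have "AE \<zeta> in (lborel :: 'a measure). \<zeta> \<noteq> 0" by (rule AE_lborel_singleton)
  ultimately show ?thesis
  proof eventually_elim
    case (elim \<zeta>)
    have "AE t in (lborel :: real measure). f differentiable (at (x + t *\<^sub>R ((- \<delta> * inverse (norm \<zeta>)) *\<^sub>R \<zeta>)))"
      by (rule AE_line_rescale[OF meas elim(1)]) (use \<delta> elim(2) in simp)
    then show ?case using elim(2) by (simp add: good_dir_def sgn_div_norm)
  qed
qed

lemma segment_eq: "x - \<delta> *\<^sub>R v = x + (- \<delta> *\<^sub>R v)" for x v :: 'a
  by simp

text \<open>The end point has distance \<open>\<delta>\<close> from \<open>x\<close>, so it lies outside the open ball, but it is hit with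
probability zero.\<close>

lemma AE_segment_differentiable:
  assumes "good_dir f \<delta> x \<zeta>"
  shows "AE y in uniform_segment x (x - \<delta> *\<^sub>R sgn \<zeta>). f differentiable (at y) \<and> y \<in> ball x \<delta>"
  unfolding segment_eq
proof (rule AE_uniform_segment)
  note [measurable] = borel_differentiable[OF lip]
  show "Measurable.pred borel (\<lambda>y. f differentiable (at y) \<and> y \<in> ball x \<delta>)" unfolding mem_ball by measurable
  have "AE s in (lborel :: real measure). s \<noteq> 1" by (rule AE_lborel_singleton)
  moreover have "AE s in (lborel :: real measure). f differentiable (at (x + s *\<^sub>R (- \<delta> *\<^sub>R sgn \<zeta>)))"
    using assms by (simp add: good_dir_def)
  ultimately show "AE s in lborel. 0 \<le> s \<longrightarrow> s \<le> 1 \<longrightarrow>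
      f differentiable (at (x + s *\<^sub>R (- \<delta> *\<^sub>R sgn \<zeta>))) \<and> x + s *\<^sub>R (- \<delta> *\<^sub>R sgn \<zeta>) \<in> ball x \<delta>"
  proof eventually_elim
    case (elim s)
    then show ?case using \<delta> assms by (auto simp: dist_norm good_dir_def norm_sgn)
  qed
qed

lemma AE_segment_norm_grad:
  assumes "good_dir f \<delta> x \<zeta>"
  shows "AE y in uniform_segment x (x - \<delta> *\<^sub>R sgn \<zeta>). norm (grad f y) \<le> L"
  using AE_segment_differentiable[OF assms] by eventually_elim (simp add: norm_grad_le[OF lip])

lemma integrable_segment_grad:
  assumes "good_dir f \<delta> x \<zeta>"
  shows "integrable (uniform_segment x (x - \<delta> *\<^sub>R sgn \<zeta>)) (\<lambda>y. grad f y \<bullet> v)"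
proof (rule finite_measure.integrable_const_bound[where B = "L * norm v"])
  show "finite_measure (uniform_segment x (x - \<delta> *\<^sub>R sgn \<zeta>))"
    using prob_space_uniform_segment by (rule prob_space.finite_measure)
  show "AE y in uniform_segment x (x - \<delta> *\<^sub>R sgn \<zeta>). norm (grad f y \<bullet> v) \<le> L * norm v"
    using AE_segment_norm_grad[OF assms]
  proof eventually_elim
    case (elim y)
    have "norm (grad f y \<bullet> v) \<le> norm (grad f y) * norm v" by (simp add: Cauchy_Schwarz_ineq2)
    also have "\<dots> \<le> L * norm v" using elim by (rule mult_right_mono) simp
    finally show ?case .
  qed
  note [measurable] = grad_measurable[OF lip]
  show "(\<lambda>y. grad f y \<bullet> v) \<in> borel_measurable (uniform_segment x (x - \<delta> *\<^sub>R sgn \<zeta>))" by measurable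
qed

lemma integral_segment_grad:
  assumes "good_dir f \<delta> x \<zeta>"
  shows "(LINT y|uniform_segment x (x - \<delta> *\<^sub>R sgn \<zeta>). grad f y \<bullet> sgn \<zeta>) = (f x - f (x - \<delta> *\<^sub>R sgn \<zeta>)) / \<delta>"
proof -
  note [measurable] = grad_measurable[OF lip]
  let ?v = "- \<delta> *\<^sub>R sgn \<zeta>"
  have "- \<delta> * (LINT y|uniform_segment x (x + ?v). grad f y \<bullet> sgn \<zeta>) = (LINT y|uniform_segment x (x + ?v). grad f y \<bullet> ?v)"
    by simp
  also have "\<dots> = (LINT s|lborel. indicator {0..1} s * (grad f (x + s *\<^sub>R ?v) \<bullet> ?v))"
    by (rule integral_uniform_segment) measurable
  also have "\<dots> = f (x + ?v) - f x"
    using assms unfolding good_dir_def by (intro integral_grad_along_segment[OF lip]) auto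
  finally show ?thesis using \<delta> unfolding segment_eq by (simp add: field_simps)
qed

text \<open>The guard bounds the mean slope towards \<open>- sgn g\<close> by \<open>norm g / 4\<close>. Replacing \<open>g\<close> by \<open>\<zeta>\<close> in the end point
of the segment, and \<open>\<zeta>\<close> by \<open>g\<close> in the inner product, costs \<open>norm g / 8\<close> each.\<close>

lemma expected_inner_grad_le:
  assumes good: "good_dir f \<delta> x \<zeta>" and g: "0 < norm g" "norm g \<le> L"
    and close: "norm (sgn g - sgn \<zeta>) \<le> norm g / (8 * L)"
    and insufficient: "f x - f (x - \<delta> *\<^sub>R sgn g) \<le> \<delta> / 4 * norm g"
  shows "(LINT y|uniform_segment x (x - \<delta> *\<^sub>R sgn \<zeta>). grad f y \<bullet> g) \<le> (norm g)\<^sup>2 / 2"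
proof -
  interpret prob_space "uniform_segment x (x - \<delta> *\<^sub>R sgn \<zeta>)" by (rule prob_space_uniform_segment)
  have [simp]: "prob UNIV = 1" using prob_space by simp
  have L: "0 < L" using g by linarith
  have Lc: "L * norm (sgn g - sgn \<zeta>) \<le> norm g / 8"
    using mult_left_mono[OF close, of L] L by simp
  have "f (x - \<delta> *\<^sub>R sgn g) - f (x - \<delta> *\<^sub>R sgn \<zeta>) \<le> L * norm (\<delta> *\<^sub>R (sgn \<zeta> - sgn g))"
    using lipschitz_onD[OF lip, of "x - \<delta> *\<^sub>R sgn g" "x - \<delta> *\<^sub>R sgn \<zeta>"] by (simp add: dist_norm algebra_simps)
  also have "\<dots> = \<delta> * (L * norm (sgn g - sgn \<zeta>))" using \<delta> by (simp add: norm_minus_commute)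
  also have "\<dots> \<le> \<delta> * (norm g / 8)" using Lc \<delta> by (intro mult_left_mono) auto
  finally have "f x - f (x - \<delta> *\<^sub>R sgn \<zeta>) \<le> \<delta> * (3 / 8 * norm g)" using insufficient by (simp add: algebra_simps)
  then have int: "(LINT y|uniform_segment x (x - \<delta> *\<^sub>R sgn \<zeta>). grad f y \<bullet> sgn \<zeta>) \<le> 3 / 8 * norm g"
    unfolding integral_segment_grad[OF good] using \<delta> by (simp add: pos_divide_le_eq mult.commute)
  have "(LINT y|uniform_segment x (x - \<delta> *\<^sub>R sgn \<zeta>). grad f y \<bullet> sgn g) \<le>
      (LINT y|uniform_segment x (x - \<delta> *\<^sub>R sgn \<zeta>). grad f y \<bullet> sgn \<zeta> + norm g / 8)"
  proof (rule integral_mono_AE)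
    show "AE y in uniform_segment x (x - \<delta> *\<^sub>R sgn \<zeta>). grad f y \<bullet> sgn g \<le> grad f y \<bullet> sgn \<zeta> + norm g / 8"
      using AE_segment_norm_grad[OF good]
    proof eventually_elim
      case (elim y)
      have "grad f y \<bullet> (sgn g - sgn \<zeta>) \<le> norm (grad f y) * norm (sgn g - sgn \<zeta>)" by (rule norm_cauchy_schwarz)
      also have "\<dots> \<le> L * norm (sgn g - sgn \<zeta>)" using elim by (rule mult_right_mono) simp
      also note Lc
      finally show ?case by (simp add: inner_diff_right)
    qed
  qed (intro integrable_segment_grad[OF good] Bochner_Integration.integrable_add integrable_const)+
  also have "\<dots> = (LINT y|uniform_segment x (x - \<delta> *\<^sub>R sgn \<zeta>). grad f y \<bullet> sgn \<zeta>) + norm g / 8"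
    using integrable_segment_grad[OF good] by simp
  also have "\<dots> \<le> norm g / 2" using int by simp
  finally have "norm g * (LINT y|uniform_segment x (x - \<delta> *\<^sub>R sgn \<zeta>). grad f y \<bullet> sgn g) \<le> norm g * (norm g / 2)"
    by (rule mult_left_mono) simp
  moreover have "grad f y \<bullet> g = norm g * (grad f y \<bullet> sgn g)" for y
    using g(1) by (simp add: sgn_div_norm)
  ultimately show ?thesis by (simp add: power2_eq_square)
qed

end

section \<open>The probability that a while loop runs long\<close>

\<comment> \<open>The loop is unfolded only together with a case distinction on its guard.\<close>
declare minnorm_loop.simps(2)[simp del]

lemma nn_integral_ge_const_AE:
  assumes "prob_space M" "AE x in M. c \<le> F x"
  shows "c \<le> (\<integral>\<^sup>+x. F x \<partial>M)"
proof -
  have "c = (\<integral>\<^sup>+x. c \<partial>M)" using assms(1) by (simp add: prob_space.emeasure_space_1)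
  also have "\<dots> \<le> (\<integral>\<^sup>+x. F x \<partial>M)" using assms(2) by (rule nn_integral_mono_AE)
  finally show ?thesis .
qed

lemma convex_goldstein: "convex (goldstein_subdiff f \<delta> x)"
  unfolding goldstein_subdiff_def by (rule convex_convex_hull)

lemma grad_in_goldstein:
  assumes "f differentiable (at y)" "y \<in> ball x \<delta>"
  shows "grad f y \<in> goldstein_subdiff f \<delta> x"
proof -
  have "grad f y \<in> clarke_subdiff f y"
    unfolding clarke_subdiff_def using assms(1) by (intro hull_inc) (auto intro!: exI[of _ "\<lambda>_. y"])
  then show ?thesis unfolding goldstein_subdiff_def using assms(2) by (intro hull_inc) blast
qed

abbreviation next_vec :: "('a::euclidean_space \<Rightarrow> real) \<Rightarrow> 'a \<Rightarrow> 'a \<Rightarrow> 'a" where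
  "next_vec f g y \<equiv> (ARG_MIN norm z. z \<in> closed_segment g (grad f y))"

lemma loop_Suc_guard:
  assumes "loop_guard f \<delta> \<epsilon> x g"
  shows "minnorm_loop f \<delta> \<epsilon> r (Suc i) k x g n h = uniform_ball g (r h g) \<bind> (\<lambda>\<zeta>. uniform_segment x (x - \<delta> *\<^sub>R sgn \<zeta>) \<bind>
    (\<lambda>y. minnorm_loop f \<delta> \<epsilon> r i (Suc k) x (next_vec f g y) (n + guard_evals \<epsilon> k g + 1) (snoc (snoc h \<zeta>) y)))"
  using assms by (simp add: minnorm_loop.simps(2) Let_def)

lemma next_vec_in_segment: "next_vec f g y \<in> closed_segment g (grad f y)"
  unfolding ARG_MIN_closed_segment unfolding in_closed_segment_iff
  by (intro exI[of _ "min_norm_param g (grad f y)"]) (simp add: min_norm_param_def)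

lemma next_vec_minimal:
  assumes z: "z \<in> closed_segment g (grad f y)"
  shows "norm (next_vec f g y) \<le> norm z"
proof -
  obtain s where s: "0 \<le> s" "s \<le> 1" "z = g + s *\<^sub>R (grad f y - g)" using z unfolding in_closed_segment_iff by blast
  show ?thesis unfolding ARG_MIN_closed_segment s(3) by (rule min_norm_param_minimal[OF s(1,2)])
qed

lemma norm_next_vec_le: "norm (next_vec f g y) \<le> norm g"
  by (rule next_vec_minimal) simp

text \<open>A bound for the probability that, starting from \<open>g\<close>, the guard holds in \<open>i + 1\<close> successive tests. The
factor \<open>exp 1\<close> makes it at least \<open>1\<close> for \<open>i = 0\<close> and \<open>norm g > \<epsilon>\<close>.\<close>

definition run_on_bound :: "real \<Rightarrow> real \<Rightarrow> nat \<Rightarrow> 'a::euclidean_space \<Rightarrow> real" where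
  "run_on_bound \<epsilon> L i g = (if \<epsilon> < norm g then exp 1 * (1 - \<epsilon>\<^sup>2 / (4 * L\<^sup>2)) ^ i * exp (- (\<epsilon>\<^sup>2 / (norm g)\<^sup>2)) else 0)"

context
  fixes f :: "'a::euclidean_space \<Rightarrow> real" and \<delta> \<epsilon> L :: real and r :: "'a history \<Rightarrow> 'a \<Rightarrow> real"
  assumes lip: "L-lipschitz_on UNIV f" and radius_ok: "radius_rule L \<epsilon> r" and \<delta>: "0 < \<delta>" and \<epsilon>: "0 < \<epsilon>"
begin

lemma inner_kernel_measurable:
  "(\<lambda>y. minnorm_loop f \<delta> \<epsilon> r i k x (next_vec f g y) n (snoc h y)) \<in> borel \<rightarrow>\<^sub>M subprob_algebra borel"
proof -
  note [measurable] = grad_measurable[OF lip]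
  show ?thesis
    by (intro minnorm_loop_measurable[OF lip radius_ok] ARG_MIN_segment_measurable snoc_measurable) measurable
qed

lemma outer_kernel_measurable:
  "(\<lambda>\<zeta>. uniform_segment x (x - \<delta> *\<^sub>R sgn \<zeta>) \<bind>
    (\<lambda>y. minnorm_loop f \<delta> \<epsilon> r i k x (next_vec f g y) n (snoc (snoc h \<zeta>) y))) \<in> borel \<rightarrow>\<^sub>M subprob_algebra borel"
proof (rule measurable_bind_case)
  note [measurable] = grad_measurable[OF lip]
  show "(\<lambda>\<zeta>. uniform_segment x (x - \<delta> *\<^sub>R sgn \<zeta>)) \<in> borel \<rightarrow>\<^sub>M subprob_algebra borel"
    by (intro uniform_segment_measurable) measurable
  show "(\<lambda>(\<zeta>, y). minnorm_loop f \<delta> \<epsilon> r i k x (next_vec f g y) n (snoc (snoc h \<zeta>) y)) \<in> borel \<Otimes>\<^sub>M borel \<rightarrow>\<^sub>M subprob_algebra borel"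
    unfolding case_prod_beta
    by (intro minnorm_loop_measurable[OF lip radius_ok] ARG_MIN_segment_measurable snoc_measurable) measurable
qed

lemma radius_pos:
  assumes "loop_guard f \<delta> \<epsilon> x g" "norm g \<le> L"
  shows "0 < r h g" and "\<zeta> \<in> ball g (r h g) \<Longrightarrow> norm (sgn g - sgn \<zeta>) \<le> norm g / (8 * L)"
proof -
  have r: "0 < r h g" "r h g < norm g * sqrt (1 - (1 - (norm g)\<^sup>2 / (128 * L\<^sup>2))\<^sup>2)"
    using radius_ok assms unfolding radius_rule_def loop_guard_def by blast+
  show "0 < r h g" by (rule r)
  have "0 < norm g" using assms(1) \<epsilon> unfolding loop_guard_def by linarith
  then show "norm (sgn g - sgn \<zeta>) \<le> norm g / (8 * L)" if "\<zeta> \<in> ball g (r h g)"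
    using assms(2) that r(2) by (rule sgn_close_if_in_small_ball)
qed

lemma AE_ball_good_dir:
  assumes "loop_guard f \<delta> \<epsilon> x g" "norm g \<le> L"
  shows "AE \<zeta> in uniform_ball g (r h g). good_dir f \<delta> x \<zeta> \<and> norm (sgn g - sgn \<zeta>) \<le> norm g / (8 * L)"
proof (rule AE_uniform_ball[OF _ radius_pos(1)[OF assms]])
  show "AE \<zeta> in lborel. \<zeta> \<in> ball g (r h g) \<longrightarrow> good_dir f \<delta> x \<zeta> \<and> norm (sgn g - sgn \<zeta>) \<le> norm g / (8 * L)"
    using good_dir_AE[OF lip \<delta>, of x] by eventually_elim (use radius_pos(2)[OF assms] in blast)
qed

text \<open>The shortest vector of the segment is at most as long as \<open>(1 - t) *\<^sub>R g + t *\<^sub>R grad f y\<close>, and the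
potential is bounded by its tangent; this makes the right-hand side affine in \<open>grad f y \<bullet> g\<close>, so
that only the mean of this inner product is needed. The value of \<open>t\<close> minimizes
\<open>a - a * t + t\<^sup>2 * L\<^sup>2\<close>, where \<open>a\<close> is the squared norm of \<open>g\<close>.\<close>

lemma run_on_bound_next_le:
  assumes g: "\<epsilon> < norm g" "norm g \<le> L" and w: "norm (grad f y) \<le> L"
  defines "t \<equiv> (norm g)\<^sup>2 / (2 * L\<^sup>2)"
  shows "run_on_bound \<epsilon> L i (next_vec f g y) \<le> exp 1 * (1 - \<epsilon>\<^sup>2 / (4 * L\<^sup>2)) ^ i * exp (- (\<epsilon>\<^sup>2 / (norm g)\<^sup>2)) *
    (1 - \<epsilon>\<^sup>2 / (norm g)\<^sup>2 * (1 - ((1 - t)\<^sup>2 * (norm g)\<^sup>2 + 2 * t * (1 - t) * (grad f y \<bullet> g) + t\<^sup>2 * L\<^sup>2) / (norm g)\<^sup>2))"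
proof -
  let ?g' = "next_vec f g y" and ?a = "(norm g)\<^sup>2" and ?w = "grad f y"
  let ?P = "(1 - t)\<^sup>2 * ?a + 2 * t * (1 - t) * (?w \<bullet> g) + t\<^sup>2 * L\<^sup>2"
  define x q c where "x = \<epsilon>\<^sup>2 / ?a" and "q = (norm ?g')\<^sup>2 / ?a" and "c = exp 1 * (1 - \<epsilon>\<^sup>2 / (4 * L\<^sup>2)) ^ i"
  have pos: "0 < norm g" "0 < L" using g \<epsilon> by linarith+
  have aL: "?a \<le> L\<^sup>2" using g(2) by (intro power_mono) auto
  have "t \<le> L\<^sup>2 / (2 * L\<^sup>2)" unfolding t_def by (intro divide_right_mono aL) simp
  also have "L\<^sup>2 / (2 * L\<^sup>2) = 1 / 2" using pos by simp
  finally have t: "0 \<le> t" "t \<le> 1" by (auto simp: t_def)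
  have \<epsilon>a: "\<epsilon>\<^sup>2 \<le> ?a" using g(1) \<epsilon> by (intro power_mono) auto
  have x: "0 \<le> x" "x \<le> 1" using \<epsilon>a pos by (auto simp: x_def divide_simps)
  have "\<epsilon>\<^sup>2 \<le> L\<^sup>2" using \<epsilon>a aL by linarith
  then have "\<epsilon>\<^sup>2 \<le> 4 * L\<^sup>2" using zero_le_power2[of L] by linarith
  then have "\<epsilon>\<^sup>2 / (4 * L\<^sup>2) \<le> 1" using pos by (simp add: pos_divide_le_eq)
  then have c: "0 \<le> c" by (simp add: c_def)
  have "norm ?g' \<le> norm (g + t *\<^sub>R (?w - g))"
    by (rule next_vec_minimal) (use t in \<open>auto simp: in_closed_segment_iff\<close>)
  then have "(norm ?g')\<^sup>2 \<le> (norm (g + t *\<^sub>R (?w - g)))\<^sup>2" by (intro power_mono) auto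
  also have "g + t *\<^sub>R (?w - g) = (1 - t) *\<^sub>R g + t *\<^sub>R ?w" by (simp add: algebra_simps)
  also have "(norm ((1 - t) *\<^sub>R g + t *\<^sub>R ?w))\<^sup>2 = (1 - t)\<^sup>2 * ?a + 2 * t * (1 - t) * (?w \<bullet> g) + t\<^sup>2 * (norm ?w)\<^sup>2"
    unfolding power2_norm_eq_inner by (simp add: inner_add_left inner_add_right inner_commute algebra_simps power2_eq_square)
  also have "\<dots> \<le> ?P" using w by (intro add_left_mono mult_left_mono power_mono) auto
  finally have "q \<le> ?P / ?a" unfolding q_def by (rule divide_right_mono) simp
  then have "1 - x * (1 - q) \<le> 1 - x * (1 - ?P / ?a)" using x by (simp add: mult_left_mono)
  then have mono: "c * exp (- x) * (1 - x * (1 - q)) \<le> c * exp (- x) * (1 - x * (1 - ?P / ?a))"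
    using c by (intro mult_left_mono) auto
  have q: "0 \<le> q" "q \<le> 1"
    using norm_next_vec_le[of g f y] pos by (auto simp: q_def divide_le_eq_1 intro: power_mono)
  have "run_on_bound \<epsilon> L i ?g' \<le> c * exp (- x) * (1 - x * (1 - q))"
  proof (cases "\<epsilon> < norm ?g'")
    case True
    then have "0 < norm ?g'" using \<epsilon> by linarith
    then have "0 < q" using pos by (simp add: q_def)
    have "x / q = \<epsilon>\<^sup>2 / (norm ?g')\<^sup>2" using pos by (simp add: x_def q_def)
    then have "run_on_bound \<epsilon> L i ?g' = c * exp (- (x / q))" using True by (simp add: run_on_bound_def c_def)
    also have "\<dots> \<le> c * (exp (- x) * (1 - x * (1 - q)))"
      by (intro mult_left_mono exp_tangent_bound x c \<open>0 < q\<close> q)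
    finally show ?thesis by (simp add: mult.assoc)
  next
    case False
    have "x * (1 - q) \<le> 1" using x q by (intro mult_le_one) auto
    then show ?thesis using False c by (simp add: run_on_bound_def)
  qed
  with mono show ?thesis unfolding x_def c_def by linarith
qed

text \<open>With the mean of the inner product at most \<open>a / 2\<close>, the affine bound evaluates to exactly one more
factor \<open>1 - \<epsilon>\<^sup>2 / (4 * L\<^sup>2)\<close>. Here \<open>F y\<close> stands for the mass of the rest of the loop once \<open>y\<close> is sampled.\<close>

lemma expected_run_on_bound_le:
  assumes good: "good_dir f \<delta> x \<zeta>" and guard: "loop_guard f \<delta> \<epsilon> x g" and gL: "norm g \<le> L"
    and close: "norm (sgn g - sgn \<zeta>) \<le> norm g / (8 * L)"
    and bound: "\<And>y. norm (next_vec f g y) \<le> L \<Longrightarrow> ennreal (1 - run_on_bound \<epsilon> L i (next_vec f g y)) \<le> F y"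
  shows "ennreal (1 - run_on_bound \<epsilon> L (Suc i) g) \<le> (\<integral>\<^sup>+y. F y \<partial>uniform_segment x (x - \<delta> *\<^sub>R sgn \<zeta>))"
proof -
  let ?U = "uniform_segment x (x - \<delta> *\<^sub>R sgn \<zeta>)"
  interpret prob_space ?U by (rule prob_space_uniform_segment)
  have [simp]: "prob UNIV = 1" using prob_space by simp
  have g: "\<epsilon> < norm g" "f x - f (x - \<delta> *\<^sub>R sgn g) \<le> \<delta> / 4 * norm g"
    using guard by (auto simp: loop_guard_def)
  define t a where "t = (norm g)\<^sup>2 / (2 * L\<^sup>2)" and "a = (norm g)\<^sup>2"
  define K where "K = exp 1 * (1 - \<epsilon>\<^sup>2 / (4 * L\<^sup>2)) ^ i * exp (- (\<epsilon>\<^sup>2 / a))"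
  define \<phi> where "\<phi> I = 1 - K * (1 - \<epsilon>\<^sup>2 / a * (1 - ((1 - t)\<^sup>2 * a + 2 * t * (1 - t) * I + t\<^sup>2 * L\<^sup>2) / a))" for I
  have pos: "0 < norm g" "0 < L" using g gL \<epsilon> by linarith+
  have a: "0 < a" using pos by (simp add: a_def)
  have aL: "a \<le> L\<^sup>2" unfolding a_def using gL by (intro power_mono) auto
  have "t \<le> L\<^sup>2 / (2 * L\<^sup>2)" unfolding t_def by (intro divide_right_mono aL[unfolded a_def]) simp
  also have "L\<^sup>2 / (2 * L\<^sup>2) = 1 / 2" using pos by simp
  finally have t: "0 \<le> t" "t \<le> 1" by (auto simp: t_def)
  have \<epsilon>a: "\<epsilon>\<^sup>2 \<le> a" unfolding a_def using g(1) \<epsilon> by (intro power_mono) auto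
  have "\<epsilon>\<^sup>2 \<le> L\<^sup>2" using \<epsilon>a aL by linarith
  then have "\<epsilon>\<^sup>2 \<le> 4 * L\<^sup>2" using zero_le_power2[of L] by linarith
  then have "\<epsilon>\<^sup>2 / (4 * L\<^sup>2) \<le> 1" using pos by (simp add: pos_divide_le_eq)
  then have K: "0 \<le> K" by (simp add: K_def)
  define c1 where "c1 = K * (\<epsilon>\<^sup>2 / a) * (2 * t * (1 - t) / a)"
  have c1: "0 \<le> c1" using K a t by (simp add: c1_def)
  define c0 where "c0 = 1 - K * (1 - \<epsilon>\<^sup>2 / a * (1 - ((1 - t)\<^sup>2 * a + t\<^sup>2 * L\<^sup>2) / a))"
  have \<phi>_affine: "\<phi> I = c0 - c1 * I" for I
    unfolding \<phi>_def c0_def c1_def using a by (simp add: field_simps)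
  have int: "integrable ?U (\<lambda>y. grad f y \<bullet> g)" by (rule integrable_segment_grad[OF lip \<delta> good])
  have I: "(LINT y|?U. grad f y \<bullet> g) \<le> a / 2"
    unfolding a_def by (rule expected_inner_grad_le[OF lip \<delta> good pos(1) gL close g(2)])
  have "1 - run_on_bound \<epsilon> L (Suc i) g = \<phi> (a / 2)"
  proof -
    have "(1 - t)\<^sup>2 * a + 2 * t * (1 - t) * (a / 2) + t\<^sup>2 * L\<^sup>2 = a - a * t + t * (t * L\<^sup>2)"
      by (simp add: power2_eq_square algebra_simps)
    also have "t * L\<^sup>2 = a / 2" using pos by (simp add: t_def a_def)
    also have "a - a * t + t * (a / 2) = a - a * t / 2" by (simp add: field_simps)
    finally have "\<phi> (a / 2) = 1 - K * (1 - \<epsilon>\<^sup>2 / a * (1 - (a - a * t / 2) / a))" by (simp add: \<phi>_def)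
    also have "1 - (a - a * t / 2) / a = t / 2" using a by (simp add: field_simps)
    also have "\<epsilon>\<^sup>2 / a * (t / 2) = \<epsilon>\<^sup>2 / (4 * L\<^sup>2)" using a by (simp add: t_def a_def)
    finally show ?thesis using g(1) by (simp add: run_on_bound_def K_def a_def mult_ac)
  qed
  also have "\<phi> (a / 2) \<le> \<phi> (LINT y|?U. grad f y \<bullet> g)"
    unfolding \<phi>_affine using mult_left_mono[OF I c1] by simp
  also have "\<dots> = (LINT y|?U. \<phi> (grad f y \<bullet> g))"
    unfolding \<phi>_affine using int by simp
  finally have "ennreal (1 - run_on_bound \<epsilon> L (Suc i) g) \<le> ennreal (LINT y|?U. \<phi> (grad f y \<bullet> g))" by (rule ennreal_leI)
  also have "\<dots> \<le> (\<integral>\<^sup>+y. ennreal (\<phi> (grad f y \<bullet> g)) \<partial>?U)"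
    by (rule ennreal_integral_le_nn_integral) (use int in \<open>simp add: \<phi>_affine\<close>)
  also have "\<dots> \<le> (\<integral>\<^sup>+y. F y \<partial>?U)"
  proof (rule nn_integral_mono_AE)
    show "AE y in ?U. ennreal (\<phi> (grad f y \<bullet> g)) \<le> F y"
      using AE_segment_norm_grad[OF lip \<delta> good]
    proof eventually_elim
      case (elim y)
      have "\<phi> (grad f y \<bullet> g) \<le> 1 - run_on_bound \<epsilon> L i (next_vec f g y)"
        using run_on_bound_next_le[OF g(1) gL elim, of i] unfolding \<phi>_def K_def t_def a_def by simp
      then have "ennreal (\<phi> (grad f y \<bullet> g)) \<le> ennreal (1 - run_on_bound \<epsilon> L i (next_vec f g y))" by (rule ennreal_leI)
      also have "\<dots> \<le> F y" using norm_next_vec_le[of g f y] gL by (intro bound) simp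
      finally show ?case .
    qed
  qed
  finally show ?thesis .
qed

text \<open>Runs that exhaust the bound on the number of tests have no mass, so the total mass is the
probability that the loop ends in time.\<close>

lemma loop_mass_ge:
  assumes "norm g \<le> L"
  shows "ennreal (1 - run_on_bound \<epsilon> L i g) \<le> emeasure (minnorm_loop f \<delta> \<epsilon> r (Suc i) k x g n h) UNIV"
  using assms
proof (induction i arbitrary: k g n h)
  case (0 k g n h)
  show ?case
  proof (cases "loop_guard f \<delta> \<epsilon> x g")
    case True
    then have "\<epsilon> < norm g" by (simp add: loop_guard_def)
    then have "\<epsilon>\<^sup>2 \<le> (norm g)\<^sup>2" "0 < (norm g)\<^sup>2" using \<epsilon> by (auto intro: power_mono)
    then have "\<epsilon>\<^sup>2 / (norm g)\<^sup>2 \<le> 1" by (simp add: pos_divide_le_eq)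
    then have "1 \<le> exp (1 - \<epsilon>\<^sup>2 / (norm g)\<^sup>2)" by simp
    also have "\<dots> = run_on_bound \<epsilon> L 0 g" using \<open>\<epsilon> < norm g\<close> by (simp add: run_on_bound_def exp_add[symmetric])
    finally show ?thesis by (simp add: ennreal_neg)
  next
    case False
    then show ?thesis by (simp add: minnorm_loop.simps(2) Let_def run_on_bound_def ennreal_le_1)
  qed
next
  case (Suc i k g n h)
  show ?case
  proof (cases "loop_guard f \<delta> \<epsilon> x g")
    case False
    have "0 \<le> run_on_bound \<epsilon> L (Suc i) g"
    proof (cases "\<epsilon> < norm g")
      case True
      then have "\<epsilon> < L" using Suc.prems by simp
      then have "\<epsilon>\<^sup>2 \<le> L\<^sup>2" using \<epsilon> by (intro power_mono) auto
      then have "\<epsilon>\<^sup>2 \<le> 4 * L\<^sup>2" using zero_le_power2[of L] by linarith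
      moreover have "0 < L\<^sup>2" using \<open>\<epsilon> < L\<close> \<epsilon> by simp
      ultimately have "\<epsilon>\<^sup>2 / (4 * L\<^sup>2) \<le> 1" by (simp add: pos_divide_le_eq)
      then show ?thesis by (simp add: run_on_bound_def)
    qed (simp add: run_on_bound_def)
    then show ?thesis using False by (simp add: minnorm_loop.simps(2) Let_def ennreal_le_1)
  next
    case True
    let ?n = "n + guard_evals \<epsilon> k g + 1"
    let ?L = "\<lambda>\<zeta> y. minnorm_loop f \<delta> \<epsilon> r (Suc i) (Suc k) x (next_vec f g y) ?n (snoc (snoc h \<zeta>) y)"
    have "ennreal (1 - run_on_bound \<epsilon> L (Suc i) g) \<le>
      (\<integral>\<^sup>+\<zeta>. emeasure (uniform_segment x (x - \<delta> *\<^sub>R sgn \<zeta>) \<bind> ?L \<zeta>) UNIV \<partial>uniform_ball g (r h g))"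
    proof (rule nn_integral_ge_const_AE)
      show "prob_space (uniform_ball g (r h g))"
        by (rule prob_space_uniform_ball[OF radius_pos(1)[OF True Suc.prems]])
      show "AE \<zeta> in uniform_ball g (r h g). ennreal (1 - run_on_bound \<epsilon> L (Suc i) g) \<le>
        emeasure (uniform_segment x (x - \<delta> *\<^sub>R sgn \<zeta>) \<bind> ?L \<zeta>) UNIV"
        using AE_ball_good_dir[OF True Suc.prems]
      proof eventually_elim
        case (elim \<zeta>)
        have eq: "emeasure (uniform_segment x (x - \<delta> *\<^sub>R sgn \<zeta>) \<bind> ?L \<zeta>) UNIV =
          (\<integral>\<^sup>+y. emeasure (?L \<zeta> y) UNIV \<partial>uniform_segment x (x - \<delta> *\<^sub>R sgn \<zeta>))"
          using inner_kernel_measurable[of "Suc i" "Suc k" x g ?n "snoc h \<zeta>"]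
          by (intro emeasure_bind[where N = borel]) (simp_all cong: measurable_cong_sets)
        from elim show ?case
          unfolding eq by (intro expected_run_on_bound_le[OF _ True Suc.prems] Suc.IH) auto
      qed
    qed
    also have "\<dots> = emeasure (minnorm_loop f \<delta> \<epsilon> r (Suc (Suc i)) k x g n h) UNIV"
      unfolding loop_Suc_guard[OF True, where i = "Suc i"]
      using outer_kernel_measurable[of x "Suc i" "Suc k" g ?n h]
      by (intro emeasure_bind[where N = borel, symmetric]) (simp_all cong: measurable_cong_sets)
    finally show ?thesis .
  qed
qed

end

section \<open>Approximate stationarity and the iterations\<close>

lemma prob_space_AE_obtain:
  assumes "prob_space M" "AE x in M. P x"
  obtains x where "P x"
proof -
  have "\<exists>x. P x"
  proof (rule ccontr)
    assume "\<nexists>x. P x"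
    with assms(2) have "AE x in M. False" by simp
    then show False using prob_space.AE_False[OF assms(1)] by simp
  qed
  then show thesis using that by blast
qed

lemma infdist_less_iff:
  assumes "A \<noteq> {}"
  shows "infdist x A < c \<longleftrightarrow> (\<exists>a\<in>A. dist x a < c)"
proof
  assume "infdist x A < c"
  then show "\<exists>a\<in>A. dist x a < c"
    using assms unfolding infdist_notempty[OF assms] by (metis (no_types, lifting) cINF_greatest leD leI)
qed (meson infdist_le le_less_trans)

text \<open>An element of the convex hull uses finitely many points of the open ball, and these stay in the
ball when its centre moves slightly. Openness of the ball is essential here.\<close>

lemma open_goldstein_member: "open {x. v \<in> goldstein_subdiff f \<delta> x}"
  unfolding open_contains_ball
proof safe
  fix x assume "v \<in> goldstein_subdiff f \<delta> x"
  then obtain S where S: "finite S" "S \<subseteq> (\<Union>y\<in>ball x \<delta>. clarke_subdiff f y)" "v \<in> convex hull S"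
    unfolding goldstein_subdiff_def convex_hull_explicit by blast
  then have "\<forall>s\<in>S. \<exists>y. y \<in> ball x \<delta> \<and> s \<in> clarke_subdiff f y" by blast
  then obtain y where y: "\<And>s. s \<in> S \<Longrightarrow> y s \<in> ball x \<delta> \<and> s \<in> clarke_subdiff f (y s)" by metis
  define e where "e = Min (insert 1 ((\<lambda>s. \<delta> - dist x (y s)) ` S))"
  have e: "0 < e" "\<And>s. s \<in> S \<Longrightarrow> e \<le> \<delta> - dist x (y s)" using S(1) y by (auto simp: e_def)
  have "v \<in> goldstein_subdiff f \<delta> x'" if x': "x' \<in> ball x e" for x'
  proof -
    have "S \<subseteq> (\<Union>y\<in>ball x' \<delta>. clarke_subdiff f y)"
    proof
      fix s assume s: "s \<in> S"
      have "dist x' (y s) \<le> dist x x' + dist x (y s)" by (rule dist_triangle3)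
      then have "y s \<in> ball x' \<delta>" using x' e(2)[OF s] by simp
      then show "s \<in> (\<Union>y\<in>ball x' \<delta>. clarke_subdiff f y)" using y[OF s] by blast
    qed
    then show ?thesis unfolding goldstein_subdiff_def using S(3) hull_mono by blast
  qed
  then show "\<exists>e>0. ball x e \<subseteq> {x. v \<in> goldstein_subdiff f \<delta> x}" using e(1) by blast
qed

lemma goldstein_nonempty:
  assumes lip: "L-lipschitz_on UNIV f" and \<delta>: "0 < \<delta>"
  shows "goldstein_subdiff f \<delta> x \<noteq> {}"
proof -
  have "AE y in uniform_ball x \<delta>. f differentiable (at y) \<and> y \<in> ball x \<delta>"
    using lipschitz_differentiable_AE[OF lip] \<delta> by (intro AE_uniform_ball) (auto elim: eventually_mono)
  from prob_space_AE_obtain[OF prob_space_uniform_ball[OF \<delta>] this]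
  obtain y where "f differentiable (at y)" "y \<in> ball x \<delta>" by blast
  then show ?thesis using grad_in_goldstein by blast
qed

text \<open>The strict sublevel sets of the distance are unions of the open sets of \<open>open_goldstein_member\<close>. The
Goldstein subdifferential must be nonempty for this, because \<open>infdist\<close> is \<open>0\<close> for the empty set.\<close>

lemma borel_approx_stationary:
  assumes lip: "L-lipschitz_on UNIV f" and \<delta>: "0 < \<delta>"
  shows "{x. infdist 0 (goldstein_subdiff f \<delta> x) \<le> \<epsilon>} \<in> sets borel"
proof -
  let ?G = "goldstein_subdiff f \<delta>"
  have "open {x. infdist 0 (?G x) < c}" for c
  proof -
    have eq: "{x. infdist 0 (?G x) < c} = (\<Union>v\<in>{v. dist 0 v < c}. {x. v \<in> ?G x})"
      unfolding infdist_less_iff[OF goldstein_nonempty[OF assms]] by blast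
    show ?thesis unfolding eq by (intro open_UN ballI open_goldstein_member)
  qed
  then have [measurable]: "{x. infdist 0 (?G x) < c} \<in> sets borel" for c by simp
  have "{x. infdist 0 (?G x) \<le> \<epsilon>} = (\<Inter>n. {x. infdist 0 (?G x) < \<epsilon> + inverse (real (Suc n))})"
  proof safe
    fix x n assume "infdist 0 (?G x) \<le> \<epsilon>"
    moreover have "0 < inverse (real (Suc n))" by simp
    ultimately show "infdist 0 (?G x) < \<epsilon> + inverse (real (Suc n))" by linarith
  next
    fix x assume all: "x \<in> (\<Inter>n. {x. infdist 0 (?G x) < \<epsilon> + inverse (real (Suc n))})"
    show "infdist 0 (?G x) \<le> \<epsilon>"
    proof (rule ccontr)
      assume "\<not> ?thesis"
      then obtain n where "inverse (real (Suc n)) < infdist 0 (?G x) - \<epsilon>"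
        using reals_Archimedean[of "infdist 0 (?G x) - \<epsilon>"] by auto
      moreover have "infdist 0 (?G x) < \<epsilon> + inverse (real (Suc n))" using all by blast
      ultimately show False by linarith
    qed
  qed
  also have "\<dots> \<in> sets borel" by measurable
  finally show ?thesis .
qed

text \<open>If the distance \<open>d\<close> to \<open>0\<close> is above \<open>\<epsilon>\<close>, then the point \<open>z\<close> of the closure nearest to \<open>0\<close> satisfies
\<open>w \<bullet> sgn z \<ge> d\<close> for all elements \<open>w\<close>, in particular for all gradients in the ball. The segment in
direction \<open>z\<close> itself may contain no point of differentiability, so a nearby good direction is used;
it loses at most half of the slope.\<close>

lemma approx_stationary_if_near_optimal:
  fixes f :: "'a::euclidean_space \<Rightarrow> real"
  assumes lip: "L-lipschitz_on UNIV f" and \<delta>: "0 < \<delta>" and \<epsilon>: "0 < \<epsilon>"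
    and near: "\<And>y. f x - f y < \<delta> * \<epsilon> / 2"
  shows "infdist 0 (goldstein_subdiff f \<delta> x) \<le> \<epsilon>"
proof (rule ccontr)
  let ?G = "goldstein_subdiff f \<delta> x"
  assume far: "\<not> infdist 0 ?G \<le> \<epsilon>"
  define z where "z = closest_point (closure ?G) 0"
  have ne: "closure ?G \<noteq> {}" using goldstein_nonempty[OF lip \<delta>] by simp
  have conv: "convex (closure ?G)" by (intro convex_closure convex_goldstein)
  have "z \<in> closure ?G" unfolding z_def by (intro closest_point_in_set ne) simp
  moreover have "closure ?G \<subseteq> {w. infdist 0 ?G \<le> norm w}"
  proof (rule closure_minimal)
    show "?G \<subseteq> {w. infdist 0 ?G \<le> norm w}" using infdist_le[of _ ?G 0] by auto
    show "closed {w. infdist 0 ?G \<le> norm w}" by (intro closed_Collect_le continuous_intros)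
  qed
  ultimately have z: "\<epsilon> < norm z" using far by auto
  then have z0: "0 < norm z" using \<epsilon> by linarith
  have sep: "norm z \<le> w \<bullet> sgn z" if "w \<in> ?G" for w
  proof -
    have "(0 - z) \<bullet> (w - z) \<le> 0"
      unfolding z_def using that closure_subset by (intro closest_point_dot conv) auto
    then have "(norm z)\<^sup>2 \<le> w \<bullet> z" by (simp add: inner_diff_right inner_diff_left power2_norm_eq_inner inner_commute)
    moreover have "w \<bullet> sgn z = (w \<bullet> z) / norm z" by (simp add: sgn_div_norm divide_inverse mult.commute)
    ultimately show ?thesis using z0 by (simp add: pos_le_divide_eq power2_eq_square)
  qed
  have L: "0 \<le> L" using lip by (rule lipschitz_on_nonneg)
  \<comment> \<open>With this distance between the directions, \<open>L * \<kappa>\<close> is at most half of \<open>norm z\<close>.\<close>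
  define \<kappa> where "\<kappa> = norm z / (2 * (L + 1))"
  have \<kappa>: "0 < \<kappa>" using z0 L by (simp add: \<kappa>_def)
  have "L * \<kappa> \<le> (L + 1) * \<kappa>" using \<kappa> by (intro mult_right_mono) auto
  also have "\<dots> = norm z / 2" using L by (simp add: \<kappa>_def field_simps)
  finally have L\<kappa>: "L * \<kappa> \<le> norm z / 2" .
  have "isCont sgn z" using z0 by (intro isCont_sgn) auto
  then obtain \<rho> where \<rho>: "0 < \<rho>" "\<And>\<zeta>. dist \<zeta> z < \<rho> \<Longrightarrow> dist (sgn \<zeta>) (sgn z) < \<kappa>"
    using \<kappa> unfolding continuous_at_eps_delta by blast
  have "AE \<zeta> in uniform_ball z \<rho>. good_dir f \<delta> x \<zeta> \<and> dist (sgn \<zeta>) (sgn z) < \<kappa>"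
  proof (rule AE_uniform_ball[OF _ \<rho>(1)])
    show "AE \<zeta> in lborel. \<zeta> \<in> ball z \<rho> \<longrightarrow> good_dir f \<delta> x \<zeta> \<and> dist (sgn \<zeta>) (sgn z) < \<kappa>"
      using good_dir_AE[OF lip \<delta>, of x] by eventually_elim (use \<rho>(2) in \<open>auto simp: dist_commute\<close>)
  qed
  from prob_space_AE_obtain[OF prob_space_uniform_ball[OF \<rho>(1)] this]
  obtain \<zeta> where \<zeta>: "good_dir f \<delta> x \<zeta>" "dist (sgn \<zeta>) (sgn z) < \<kappa>" by blast
  let ?U = "uniform_segment x (x - \<delta> *\<^sub>R sgn \<zeta>)"
  interpret prob_space ?U by (rule prob_space_uniform_segment)
  have [simp]: "prob UNIV = 1" using prob_space by simp
  have "(LINT y|?U. norm z / 2) \<le> (LINT y|?U. grad f y \<bullet> sgn \<zeta>)"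
  proof (rule integral_mono_AE)
    show "AE y in ?U. norm z / 2 \<le> grad f y \<bullet> sgn \<zeta>"
      using AE_segment_differentiable[OF lip \<delta> \<zeta>(1)]
    proof eventually_elim
      case (elim y)
      have "grad f y \<bullet> (sgn z - sgn \<zeta>) \<le> norm (grad f y) * norm (sgn z - sgn \<zeta>)" by (rule norm_cauchy_schwarz)
      also have "\<dots> \<le> L * \<kappa>"
        using norm_grad_le[OF lip] elim \<zeta>(2) L by (intro mult_mono) (auto simp: dist_norm norm_minus_commute)
      finally have "grad f y \<bullet> (sgn z - sgn \<zeta>) \<le> norm z / 2" using L\<kappa> by linarith
      moreover have "norm z \<le> grad f y \<bullet> sgn z" using elim by (intro sep grad_in_goldstein) auto
      ultimately show ?case by (simp add: inner_diff_right)
    qed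
  qed (intro integrable_segment_grad[OF lip \<delta> \<zeta>(1)] integrable_const)+
  then have "norm z / 2 \<le> (f x - f (x - \<delta> *\<^sub>R sgn \<zeta>)) / \<delta>"
    unfolding integral_segment_grad[OF lip \<delta> \<zeta>(1)] by simp
  then have "\<delta> * (norm z / 2) \<le> f x - f (x - \<delta> *\<^sub>R sgn \<zeta>)"
    using \<delta> by (simp add: pos_le_divide_eq mult.commute)
  moreover have "\<delta> * (\<epsilon> / 2) < \<delta> * (norm z / 2)" using z \<delta> by simp
  ultimately show False using near[of "x - \<delta> *\<^sub>R sgn \<zeta>"] by simp
qed

definition minnorm_post :: "('a::euclidean_space \<Rightarrow> real) \<Rightarrow> real \<Rightarrow> real \<Rightarrow> 'a \<Rightarrow> nat \<Rightarrow> 'a \<times> nat \<times> 'a history \<Rightarrow> bool" where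
  "minnorm_post f \<delta> \<epsilon> x N w \<longleftrightarrow>
    (norm (fst w) \<le> \<epsilon> \<longrightarrow> infdist 0 (goldstein_subdiff f \<delta> x) \<le> \<epsilon>) \<and>
    (\<epsilon> < norm (fst w) \<longrightarrow> \<delta> / 4 * norm (fst w) < f x - f (x - \<delta> *\<^sub>R sgn (fst w))) \<and>
    fst (snd w) \<le> N"

text \<open>An upper bound for the evaluations in a call with at most \<open>i\<close> tests of the guard: one for the
initial gradient, two function values at the first test, and a gradient and a function value for
each further test, rounded up by one. A vector of norm at most \<open>\<epsilon>\<close> is recognized without any
function value, which is the only case when \<open>L \<le> \<epsilon>\<close>.\<close>

definition call_cost :: "real \<Rightarrow> real \<Rightarrow> nat \<Rightarrow> nat" where
  "call_cost \<epsilon> L i = 1 + (if \<epsilon> < L then 2 * i + 1 else 0)"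

definition call_failure :: "real \<Rightarrow> real \<Rightarrow> nat \<Rightarrow> real" where
  "call_failure \<epsilon> L i = (if \<epsilon> < L then exp 1 * (1 - \<epsilon>\<^sup>2 / (4 * L\<^sup>2)) ^ i else 0)"

definition success :: "('a::euclidean_space \<Rightarrow> real) \<Rightarrow> real \<Rightarrow> real \<Rightarrow> nat \<Rightarrow> ('a \<times> nat) set" where
  "success f \<delta> \<epsilon> N = {(x, n). infdist 0 (goldstein_subdiff f \<delta> x) \<le> \<epsilon> \<and> n \<le> N}"

context
  fixes f :: "'a::euclidean_space \<Rightarrow> real" and \<delta> \<epsilon> L :: real and r :: "'a history \<Rightarrow> 'a \<Rightarrow> real"
  assumes lip: "L-lipschitz_on UNIV f" and radius_ok: "radius_rule L \<epsilon> r" and \<delta>: "0 < \<delta>" and \<epsilon>: "0 < \<epsilon>"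
begin

lemma minnorm_post_measurable[measurable]: "Measurable.pred borel (minnorm_post f \<delta> \<epsilon> x N)"
proof -
  note [measurable] = lipschitz_borel_measurable[OF lip]
  show ?thesis unfolding minnorm_post_def[abs_def] by measurable
qed

text \<open>Membership of \<open>g\<close> in the Goldstein subdifferential is an invariant, since the new vector lies on
a segment between two elements of this convex set.\<close>

lemma minnorm_loop_post:
  assumes "norm g \<le> L" "g \<in> goldstein_subdiff f \<delta> x"
    and "n + (if \<epsilon> < norm g then 2 * i + (if k = 0 then 1 else 0) else 0) \<le> N"
  shows "AE w in minnorm_loop f \<delta> \<epsilon> r i k x g n h. minnorm_post f \<delta> \<epsilon> x N w"
  using assms
proof (induction i arbitrary: k g n h)
  case 0
  show ?case by (rule AE_I[where N = UNIV]) auto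
next
  case (Suc i k g n h)
  show ?case
  proof (cases "loop_guard f \<delta> \<epsilon> x g")
    case False
    have "infdist 0 (goldstein_subdiff f \<delta> x) \<le> \<epsilon>" if "norm g \<le> \<epsilon>"
      using infdist_le[OF Suc.prems(2), of 0] that by simp
    then have post: "minnorm_post f \<delta> \<epsilon> x N (g, n + guard_evals \<epsilon> k g, h)"
      using False Suc.prems(3) by (auto simp: minnorm_post_def loop_guard_def guard_evals_def split: if_splits)
    have eq: "minnorm_loop f \<delta> \<epsilon> r (Suc i) k x g n h = return borel (g, n + guard_evals \<epsilon> k g, h)"
      using False by (simp add: minnorm_loop.simps(2) Let_def)
    show ?thesis unfolding eq using post by (subst AE_return) (simp_all add: minnorm_post_measurable)
  next
    case True
    let ?n = "n + guard_evals \<epsilon> k g + 1"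
    let ?L = "\<lambda>\<zeta> y. minnorm_loop f \<delta> \<epsilon> r i (Suc k) x (ARG_MIN norm z. z \<in> closed_segment g (grad f y)) ?n (snoc (snoc h \<zeta>) y)"
    have g: "\<epsilon> < norm g" using True by (simp add: loop_guard_def)
    have "AE \<zeta> in uniform_ball g (r h g). AE w in uniform_segment x (x - \<delta> *\<^sub>R sgn \<zeta>) \<bind> ?L \<zeta>. minnorm_post f \<delta> \<epsilon> x N w"
      using AE_ball_good_dir[OF lip radius_ok \<delta> \<epsilon> True Suc.prems(1)]
    proof eventually_elim
      case (elim \<zeta>)
      have "AE y in uniform_segment x (x - \<delta> *\<^sub>R sgn \<zeta>). AE w in ?L \<zeta> y. minnorm_post f \<delta> \<epsilon> x N w"
        using AE_segment_differentiable[OF lip \<delta> conjunct1[OF elim]]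
      proof eventually_elim
        case (elim y)
        let ?g' = "ARG_MIN norm z. z \<in> closed_segment g (grad f y)"
        have "grad f y \<in> goldstein_subdiff f \<delta> x" using elim by (intro grad_in_goldstein) auto
        then have "?g' \<in> goldstein_subdiff f \<delta> x"
          using next_vec_in_segment[of g f y] closed_segment_subset[OF Suc.prems(2) _ convex_goldstein] by blast
        moreover have "norm ?g' \<le> L" using norm_next_vec_le[of g f y] Suc.prems(1) by linarith
        ultimately show ?case
          using Suc.prems(3) g by (intro Suc.IH) (auto simp: guard_evals_def split: if_splits)
      qed
      then show ?case
        using inner_kernel_measurable[OF lip radius_ok \<delta> \<epsilon>, where i = i and k = "Suc k" and x = x and g = g and n = ?n and h = "snoc h \<zeta>"]
        by (subst AE_bind[where B = borel]) (simp_all cong: measurable_cong_sets)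
    qed
    then show ?thesis
      unfolding loop_Suc_guard[OF True]
      using outer_kernel_measurable[OF lip radius_ok \<delta> \<epsilon>, where i = i and k = "Suc k" and x = x and g = g and n = ?n and h = h]
      by (subst AE_bind[where B = borel]) (simp_all cong: measurable_cong_sets)
  qed
qed

lemma AE_initial_gradient:
  "AE \<zeta> in uniform_ball x \<delta>. norm (grad f \<zeta>) \<le> L \<and> grad f \<zeta> \<in> goldstein_subdiff f \<delta> x"
proof (rule AE_uniform_ball[OF _ \<delta>])
  show "AE \<zeta> in lborel. \<zeta> \<in> ball x \<delta> \<longrightarrow> norm (grad f \<zeta>) \<le> L \<and> grad f \<zeta> \<in> goldstein_subdiff f \<delta> x"
    using lipschitz_differentiable_AE[OF lip]
    by eventually_elim (auto intro: norm_grad_le[OF lip] grad_in_goldstein)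
qed

lemma minnorm_kernel_measurable:
  "(\<lambda>\<zeta>. minnorm_loop f \<delta> \<epsilon> r i 0 x (grad f \<zeta>) n (snoc h \<zeta>)) \<in> borel \<rightarrow>\<^sub>M subprob_algebra borel"
proof -
  note [measurable] = grad_measurable[OF lip]
  show ?thesis by (intro minnorm_loop_measurable[OF lip radius_ok] snoc_measurable) measurable
qed

lemma minnorm_AE_post: "AE w in minnorm f \<delta> \<epsilon> r i x n h. minnorm_post f \<delta> \<epsilon> x (n + call_cost \<epsilon> L i) w"
proof -
  have "AE \<zeta> in uniform_ball x \<delta>. AE w in minnorm_loop f \<delta> \<epsilon> r i 0 x (grad f \<zeta>) (n + 1) (snoc h \<zeta>).
      minnorm_post f \<delta> \<epsilon> x (n + call_cost \<epsilon> L i) w"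
    using AE_initial_gradient
  proof eventually_elim
    case (elim \<zeta>)
    then show ?case by (intro minnorm_loop_post) (auto simp: call_cost_def)
  qed
  then show ?thesis
    unfolding minnorm_def
    using minnorm_kernel_measurable[where i = i and x = x and n = "n + 1" and h = h]
    by (subst AE_bind[where B = borel]) (simp_all cong: measurable_cong_sets)
qed

lemma rate_le_1: "\<epsilon> < L \<Longrightarrow> \<epsilon>\<^sup>2 / (4 * L\<^sup>2) \<le> 1"
proof -
  assume "\<epsilon> < L"
  then have "\<epsilon>\<^sup>2 \<le> L\<^sup>2" using \<epsilon> by (intro power_mono) auto
  then have "\<epsilon>\<^sup>2 \<le> 4 * L\<^sup>2" using zero_le_power2[of L] by linarith
  moreover have "0 < L\<^sup>2" using \<open>\<epsilon> < L\<close> \<epsilon> by simp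
  ultimately show ?thesis by (simp add: pos_divide_le_eq)
qed

lemma call_failure_nonneg: "0 \<le> call_failure \<epsilon> L i"
  using rate_le_1 by (simp add: call_failure_def)

lemma minnorm_mass_ge: "ennreal (1 - call_failure \<epsilon> L i) \<le> emeasure (minnorm f \<delta> \<epsilon> r (Suc i) x n h) UNIV"
proof -
  have "ennreal (1 - call_failure \<epsilon> L i) \<le>
    (\<integral>\<^sup>+\<zeta>. emeasure (minnorm_loop f \<delta> \<epsilon> r (Suc i) 0 x (grad f \<zeta>) (n + 1) (snoc h \<zeta>)) UNIV \<partial>uniform_ball x \<delta>)"
  proof (rule nn_integral_ge_const_AE[OF prob_space_uniform_ball[OF \<delta>]])
    show "AE \<zeta> in uniform_ball x \<delta>. ennreal (1 - call_failure \<epsilon> L i) \<le>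
        emeasure (minnorm_loop f \<delta> \<epsilon> r (Suc i) 0 x (grad f \<zeta>) (n + 1) (snoc h \<zeta>)) UNIV"
      using AE_initial_gradient
    proof eventually_elim
      case (elim \<zeta>)
      let ?g = "grad f \<zeta>"
      have "run_on_bound \<epsilon> L i ?g \<le> call_failure \<epsilon> L i"
      proof (cases "\<epsilon> < norm ?g")
        case True
        then have "\<epsilon> < L" using elim by linarith
        have "exp 1 * (1 - \<epsilon>\<^sup>2 / (4 * L\<^sup>2)) ^ i * exp (- (\<epsilon>\<^sup>2 / (norm ?g)\<^sup>2)) \<le> exp 1 * (1 - \<epsilon>\<^sup>2 / (4 * L\<^sup>2)) ^ i"
          using rate_le_1[OF \<open>\<epsilon> < L\<close>] by (intro mult_left_le) auto
        then show ?thesis using True \<open>\<epsilon> < L\<close> by (simp add: run_on_bound_def call_failure_def)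
      next
        case False
        then show ?thesis by (simp add: run_on_bound_def call_failure_nonneg)
      qed
      then have "ennreal (1 - call_failure \<epsilon> L i) \<le> ennreal (1 - run_on_bound \<epsilon> L i ?g)" by (intro ennreal_leI) simp
      also have "\<dots> \<le> emeasure (minnorm_loop f \<delta> \<epsilon> r (Suc i) 0 x ?g (n + 1) (snoc h \<zeta>)) UNIV"
        using elim by (intro loop_mass_ge[OF lip radius_ok \<delta> \<epsilon>]) simp
      finally show ?case .
    qed
  qed
  also have "\<dots> = emeasure (minnorm f \<delta> \<epsilon> r (Suc i) x n h) UNIV"
    unfolding minnorm_def
    using minnorm_kernel_measurable[where i = "Suc i" and x = x and n = "n + 1" and h = h]
    by (intro emeasure_bind[where N = borel, symmetric]) (simp_all cong: measurable_cong_sets)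
  finally show ?thesis .
qed

lemma success_borel[measurable]: "success f \<delta> \<epsilon> N \<in> sets borel"
proof -
  have [measurable]: "Measurable.pred borel (\<lambda>x. infdist 0 (goldstein_subdiff f \<delta> x) \<le> \<epsilon>)"
    using borel_approx_stationary[OF lip \<delta>] by (simp add: pred_def)
  have "Measurable.pred borel (\<lambda>w :: 'a \<times> nat. infdist 0 (goldstein_subdiff f \<delta> (fst w)) \<le> \<epsilon> \<and> snd w \<le> N)"
    by measurable
  moreover have "success f \<delta> \<epsilon> N = {w \<in> space borel. infdist 0 (goldstein_subdiff f \<delta> (fst w)) \<le> \<epsilon> \<and> snd w \<le> N}"
    by (auto simp: success_def)
  ultimately show ?thesis unfolding pred_def by (simp only:)
qed

lemma sets_minnorm: "sets (minnorm f \<delta> \<epsilon> r i x n h) = sets borel"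
  using minnorm_measurable[OF lip radius_ok, where X = "\<lambda>_. x" and M = borel and N = "\<lambda>_. n" and H = "\<lambda>_. h" and \<delta> = \<delta> and i = i]
  by (auto simp: space_subprob_algebra dest: measurable_space)

text \<open>Every iteration that moves on pays \<open>\<delta> * \<epsilon> / 4\<close> from the gap between \<open>f x\<close> and the infimum, so \<open>t\<close>
remaining iterations suffice for a gap below \<open>t + 1\<close> times this amount.\<close>

lemma ingd_success_prob_ge:
  assumes "f x - (INF y. f y) < (real t + 1) * (\<delta> * \<epsilon> / 4)" and bdd: "bdd_below (range f)"
    and "n + t * call_cost \<epsilon> L (Suc i) \<le> N"
  shows "ennreal (1 - real t * call_failure \<epsilon> L i) \<le> emeasure (ingd f \<delta> \<epsilon> r (Suc i) t x n h) (success f \<delta> \<epsilon> N)"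
  using assms(1,3)
proof (induction t arbitrary: x n h)
  case (0 x n h)
  have "infdist 0 (goldstein_subdiff f \<delta> x) \<le> \<epsilon>"
  proof (rule approx_stationary_if_near_optimal[OF lip \<delta> \<epsilon>])
    fix y
    have "(INF y. f y) \<le> f y" using bdd by (rule cINF_lower) simp
    moreover have "0 < \<delta> * \<epsilon>" using \<delta> \<epsilon> by simp
    ultimately show "f x - f y < \<delta> * \<epsilon> / 2" using 0 by simp
  qed
  then have "(x, n) \<in> success f \<delta> \<epsilon> N" using 0 by (simp add: success_def)
  then show ?case by simp
next
  case (Suc t x n h)
  let ?\<beta> = "call_failure \<epsilon> L i"
  let ?M = "minnorm f \<delta> \<epsilon> r (Suc i) x n h"
  let ?k = "\<lambda>(g, n', h'). if norm g \<le> \<epsilon> then return borel (x, n')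
       else ingd f \<delta> \<epsilon> r (Suc i) t (x - \<delta> *\<^sub>R sgn g) n' h'"
  have k: "?k \<in> borel \<rightarrow>\<^sub>M subprob_algebra borel"
    unfolding case_prod_unfold
    by (intro measurable_If return_borel_measurable borel_measurable_Pair ingd_measurable[OF lip radius_ok]) measurable
  have step: "ennreal (1 - real t * ?\<beta>) \<le> emeasure (?k w) (success f \<delta> \<epsilon> N)" if w: "minnorm_post f \<delta> \<epsilon> x (n + call_cost \<epsilon> L (Suc i)) w" for w
  proof -
    obtain g n' h' where [simp]: "w = (g, n', h')" by (cases w)
    show ?thesis
    proof (cases "norm g \<le> \<epsilon>")
      case True
      then have "(x, n') \<in> success f \<delta> \<epsilon> N" using w Suc.prems(2) by (auto simp: success_def minnorm_post_def)
      then show ?thesis using True call_failure_nonneg[of i] by (simp add: ennreal_le_1)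
    next
      case False
      then have "\<delta> / 4 * norm g < f x - f (x - \<delta> *\<^sub>R sgn g)" using w by (simp add: minnorm_post_def)
      moreover have "\<delta> / 4 * \<epsilon> \<le> \<delta> / 4 * norm g" using False \<delta> by (intro mult_left_mono) auto
      ultimately have "f (x - \<delta> *\<^sub>R sgn g) - (INF y. f y) < (real t + 1) * (\<delta> * \<epsilon> / 4)"
        using Suc.prems(1) by (simp add: algebra_simps)
      moreover have "n' + t * call_cost \<epsilon> L (Suc i) \<le> N" using w Suc.prems(2) by (simp add: minnorm_post_def)
      ultimately show ?thesis using False Suc.IH by simp
    qed
  qed
  \<comment> \<open>The union bound: \<open>(1 - t * \<beta>) * (1 - \<beta>)\<close> is at least \<open>1 - (t + 1) * \<beta>\<close>.\<close>
  have "ennreal (1 - real (Suc t) * ?\<beta>) \<le> ennreal (1 - real t * ?\<beta>) * ennreal (1 - ?\<beta>)"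
  proof (cases "real (Suc t) * ?\<beta> \<le> 1")
    case True
    have "?\<beta> \<le> real (Suc t) * ?\<beta>" "real t * ?\<beta> \<le> real (Suc t) * ?\<beta>"
      using call_failure_nonneg[of i] by (simp_all add: algebra_simps)
    then have le: "?\<beta> \<le> 1" "real t * ?\<beta> \<le> 1" using True by linarith+
    have "0 \<le> real t * ?\<beta> * ?\<beta>" using call_failure_nonneg[of i] by simp
    then have "1 - real (Suc t) * ?\<beta> \<le> (1 - real t * ?\<beta>) * (1 - ?\<beta>)" by (simp add: algebra_simps)
    then show ?thesis using le by (simp add: ennreal_mult[symmetric] ennreal_leI)
  next
    case False
    then show ?thesis by (simp add: ennreal_neg)
  qed
  also have "\<dots> \<le> ennreal (1 - real t * ?\<beta>) * emeasure ?M UNIV"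
    by (intro mult_left_mono minnorm_mass_ge) simp
  also have "\<dots> = (\<integral>\<^sup>+w. ennreal (1 - real t * ?\<beta>) \<partial>?M)"
    using sets_eq_imp_space_eq[OF sets_minnorm] by simp
  also have "\<dots> \<le> (\<integral>\<^sup>+w. emeasure (?k w) (success f \<delta> \<epsilon> N) \<partial>?M)"
    using minnorm_AE_post[where i = "Suc i" and x = x and n = n and h = h] step by (intro nn_integral_mono_AE) (auto elim: eventually_mono)
  also have "\<dots> = emeasure (?M \<bind> ?k) (success f \<delta> \<epsilon> N)"
    using k sets_eq_imp_space_eq[OF sets_minnorm[where i = "Suc i" and x = x and n = n and h = h]] sets_minnorm[where i = "Suc i" and x = x and n = n and h = h]
    by (intro emeasure_bind[where N = borel, symmetric]) (simp_all cong: measurable_cong_sets)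
  also have "?M \<bind> ?k = ingd f \<delta> \<epsilon> r (Suc i) (Suc t) x n h" by simp
  finally show ?case .
qed

end

text \<open>The exponent \<open>real i * \<epsilon>\<^sup>2 / (4 * L\<^sup>2)\<close> is about \<open>8 * m\<close>, which leaves ample room for the factor \<open>exp 1\<close>
and for rounding.\<close>

lemma call_failure_le:
  assumes "0 < \<epsilon>" and m: "1 \<le> m" and M: "64 * L\<^sup>2 / \<epsilon>\<^sup>2 \<le> real M" and i: "real M * real m \<le> 2 * real i + 5"
  shows "call_failure \<epsilon> L i \<le> exp (- (real m / 2))"
proof (cases "\<epsilon> < L")
  case True
  define \<eta> where "\<eta> = \<epsilon>\<^sup>2 / L\<^sup>2"
  have L: "0 < L" using True assms(1) by linarith
  have "\<epsilon>\<^sup>2 \<le> L\<^sup>2" using True assms(1) by (intro power_mono) auto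
  then have \<eta>: "0 < \<eta>" "\<eta> \<le> 1" using L assms(1) by (auto simp: \<eta>_def)
  have "64 \<le> \<eta> * real M"
    using M L assms(1) by (simp add: \<eta>_def field_simps)
  then have "64 * real m \<le> \<eta> * real M * real m" by (intro mult_right_mono) auto
  also have "\<dots> = \<eta> * (real M * real m)" by simp
  also have "\<dots> \<le> \<eta> * (2 * real i + 5)" using i \<eta> by (intro mult_left_mono) auto
  also have "\<dots> \<le> 2 * (\<eta> * real i) + 5" using \<eta> by (simp add: algebra_simps)
  finally have \<eta>i: "64 * real m \<le> 2 * (\<eta> * real i) + 5" .
  have "(1 - \<eta> / 4) ^ i \<le> exp (- (\<eta> / 4)) ^ i"
    using exp_ge_add_one_self[of "- (\<eta> / 4)"] \<eta> by (intro power_mono) auto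
  also have "\<dots> = exp (- (\<eta> / 4 * real i))" by (simp add: exp_of_nat_mult[symmetric] mult.commute)
  finally have "exp 1 * (1 - \<eta> / 4) ^ i \<le> exp 1 * exp (- (\<eta> / 4 * real i))" by simp
  also have "\<dots> = exp (1 - \<eta> / 4 * real i)" by (simp add: exp_add[symmetric])
  also have "\<dots> \<le> exp (- (real m / 2))" using \<eta>i m by simp
  finally show ?thesis using True by (simp add: call_failure_def \<eta>_def mult.commute)
qed (simp add: call_failure_def)

theorem theorem2p6:
  fixes f :: "'a::euclidean_space \<Rightarrow> real"
    and r :: "'a history \<Rightarrow> 'a \<Rightarrow> real"
    and x\<^sub>0 :: 'a
    and L \<delta> \<epsilon> \<gamma> \<Delta> T :: real
  assumes "L-lipschitz_on UNIV f"
    and "0 < \<delta>" "\<delta> < 1" "0 < \<epsilon>" "0 < \<gamma>" "\<gamma> < 1"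
    and "bdd_below (range f)"
    and "\<Delta> = f x\<^sub>0 - (INF x. f x)"
    and "T = 4 * \<Delta> / (\<delta> * \<epsilon>)"
    and "radius_rule L \<epsilon> r"
  shows "ennreal (1 - \<gamma>) \<le> ingd_prob f \<delta> \<epsilon> r (nat \<lfloor>T\<rfloor>) x\<^sub>0
    {(x\<^sub>T, n). infdist 0 (goldstein_subdiff f \<delta> x\<^sub>T) \<le> \<epsilon> \<and>
      n \<le> nat \<lceil>4 * \<Delta> / (\<delta> * \<epsilon>)\<rceil> * nat \<lceil>64 * L\<^sup>2 / \<epsilon>\<^sup>2\<rceil>
           * nat \<lceil>2 * ln (4 * \<Delta> / (\<gamma> * \<delta> * \<epsilon>))\<rceil>}"
proof -
  note lip = assms(1) and \<delta> = assms(2) and \<epsilon> = assms(4) and \<gamma> = assms(5,6) and bdd = assms(7) and radius_ok = assms(10)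
  define t M m where "t = nat \<lfloor>T\<rfloor>" and "M = nat \<lceil>64 * L\<^sup>2 / \<epsilon>\<^sup>2\<rceil>" and "m = nat \<lceil>2 * ln (T / \<gamma>)\<rceil>"
  define N where "N = nat \<lceil>T\<rceil> * M * m"
  have "(INF x. f x) \<le> f x\<^sub>0" using bdd by (rule cINF_lower) simp
  then have \<Delta>: "0 \<le> \<Delta>" using assms(8) by simp
  then have T: "0 \<le> T" using \<delta> \<epsilon> assms(9) by simp
  then have t: "real t \<le> T" "T < real t + 1" unfolding t_def by linarith+
  have "T * (\<delta> * \<epsilon> / 4) = \<Delta>" using \<delta> \<epsilon> assms(9) by simp
  then have gap: "f x\<^sub>0 - (INF x. f x) < (real t + 1) * (\<delta> * \<epsilon> / 4)"
    using mult_strict_right_mono[OF t(2), of "\<delta> * \<epsilon> / 4"] \<delta> \<epsilon> assms(8) by simp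
  have "\<exists>i. t * call_cost \<epsilon> L (Suc i) \<le> N \<and> real t * call_failure \<epsilon> L i \<le> \<gamma>"
  proof (cases "t = 0")
    case True
    then show ?thesis using \<gamma> by simp
  next
    case False
    then have T1: "1 \<le> T" using t(1) by linarith
    then have "1 < T / \<gamma>" using \<gamma> by (simp add: less_divide_eq)
    then have ln: "0 < ln (T / \<gamma>)" by simp
    have m: "1 \<le> m" "2 * ln (T / \<gamma>) \<le> real m" using ln unfolding m_def by linarith+
    have M: "64 * L\<^sup>2 / \<epsilon>\<^sup>2 \<le> real M" unfolding M_def by linarith
    have "L \<noteq> 0"
    proof
      assume "L = 0"
      then have "f y = f x\<^sub>0" for y using lipschitz_onD[OF lip, of y x\<^sub>0] by simp
      then have "range f = {f x\<^sub>0}" by auto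
      then have "\<Delta> = 0" using assms(8) by simp
      then show False using T1 assms(9) by simp
    qed
    then have "0 < 64 * L\<^sup>2 / \<epsilon>\<^sup>2" using \<epsilon> by simp
    then have M1: "1 \<le> M" using M by linarith
    have tT: "t \<le> nat \<lceil>T\<rceil>" unfolding t_def by (intro nat_mono) linarith
    \<comment> \<open>For \<open>\<epsilon> < L\<close> this is the largest \<open>i\<close> such that \<open>call_cost \<epsilon> L (Suc i) = 2 * i + 4\<close> is at most \<open>M * m\<close>.\<close>
    define i where "i = (M * m - 4) div 2"
    have cost: "call_cost \<epsilon> L (Suc i) \<le> M * m"
    proof (cases "\<epsilon> < L")
      case True
      then have "\<epsilon>\<^sup>2 \<le> L\<^sup>2" using \<epsilon> by (intro power_mono) auto
      then have "64 \<le> 64 * L\<^sup>2 / \<epsilon>\<^sup>2" using \<epsilon> by (simp add: pos_le_divide_eq)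
      then have "64 \<le> M" using M by linarith
      then have "64 \<le> M * m" using m(1) by (metis le_trans mult_le_mono nat_mult_1_right)
      then show ?thesis using True by (simp add: call_cost_def i_def)
    next
      case False
      then show ?thesis using M1 m(1) by (simp add: call_cost_def Suc_le_eq)
    qed
    have "t * call_cost \<epsilon> L (Suc i) \<le> nat \<lceil>T\<rceil> * (M * m)" using tT cost by (rule mult_le_mono)
    moreover have "real t * call_failure \<epsilon> L i \<le> \<gamma>"
    proof -
      have "M * m \<le> 2 * i + 5" unfolding i_def by presburger
      then have "real M * real m \<le> 2 * real i + 5" by (simp flip: of_nat_mult)
      then have "call_failure \<epsilon> L i \<le> exp (- (real m / 2))" by (rule call_failure_le[OF \<epsilon> m(1) M])
      also have "\<dots> \<le> exp (- ln (T / \<gamma>))" using m(2) by simp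
      also have "\<dots> = \<gamma> / T" using T1 \<gamma> by (simp add: exp_minus)
      finally have "real t * call_failure \<epsilon> L i \<le> T * (\<gamma> / T)"
        using t(1) T1 \<gamma> call_failure_nonneg[OF lip radius_ok \<delta> \<epsilon>] by (intro mult_mono) auto
      then show ?thesis using T1 by simp
    qed
    ultimately show ?thesis unfolding N_def by (auto simp: mult.assoc)
  qed
  then obtain i where i: "t * call_cost \<epsilon> L (Suc i) \<le> N" "real t * call_failure \<epsilon> L i \<le> \<gamma>" by blast
  have "ennreal (1 - \<gamma>) \<le> ennreal (1 - real t * call_failure \<epsilon> L i)" using i(2) by (intro ennreal_leI) simp
  also have "\<dots> \<le> emeasure (ingd f \<delta> \<epsilon> r (Suc i) t x\<^sub>0 0 empty_history) (success f \<delta> \<epsilon> N)"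
    using i(1) by (intro ingd_success_prob_ge[OF lip radius_ok \<delta> \<epsilon> gap bdd]) simp
  also have "\<dots> \<le> ingd_prob f \<delta> \<epsilon> r t x\<^sub>0 (success f \<delta> \<epsilon> N)"
    unfolding ingd_prob_def by (rule SUP_upper) simp
  also have "4 * \<Delta> / (\<gamma> * \<delta> * \<epsilon>) = T / \<gamma>" using assms(9) by (simp add: mult.assoc mult.commute)
  then have "success f \<delta> \<epsilon> N = {(x\<^sub>T, n). infdist 0 (goldstein_subdiff f \<delta> x\<^sub>T) \<le> \<epsilon> \<and>
      n \<le> nat \<lceil>4 * \<Delta> / (\<delta> * \<epsilon>)\<rceil> * nat \<lceil>64 * L\<^sup>2 / \<epsilon>\<^sup>2\<rceil> * nat \<lceil>2 * ln (4 * \<Delta> / (\<gamma> * \<delta> * \<epsilon>))\<rceil>}"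
    unfolding success_def N_def M_def m_def assms(9)[symmetric] by simp
  finally show ?thesis unfolding t_def .
qed

end
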